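(* Let $T=(T_\omega)_{\omega\in\Omega}$ be a continuous bundle random dynamical system on a compact metric space $(X,d)$ over $(\Omega,\mathcal{F},\mathbf{P},\vartheta)$, and let $\mu\in M^1_{\mathbf{P}}(\Omega\times X,T)$. Then for $\mathbf{P}$-a.e. $\omega\in\Omega$, $$h^{(r)}_\mu(T)\le\lim_{\varepsilon\to0}\liminf_{n\to\infty}\frac1n\log sp_{FK}(\omega,\mu,n,\varepsilon).$$ If moreover $\mu\in E^1_{\mathbf{P}}(\Omega\times X,T)$ and $h^{(r)}_\mu(T)<\infty$, then for $\mathbf{P}$-a.e. $\omega\in\Omega$, $$h^{(r)}_\mu(T)=\lim_{\varepsilon\to0}\liminf_{n\to\infty}\frac1n\log sp_{FK}(\omega,\mu,n,\varepsilon)=\lim_{\varepsilon\to0}\limsup_{n\to\infty}\frac1n\log sp_{FK}(\omega,\mu,n,\varepsilon).$$ Here $sp_{FK}(\omega,\mu,n,\varepsilon)$ denotes the smallest number of balls of radius $\varepsilon$ in the metric $d^{FK_n}_\omega$ whose union has $\mu_\omega$-measure larger than $1-\varepsilon$.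
   Context: Setting. $(\Omega,\mathcal{F},\mathbf{P})$ is a probability space with $\mathcal{F}$ complete, countably generated and separating points (so it is a Lebesgue space), and $\vartheta:\Omega\to\Omega$ is an invertible ergodic $\mathbf{P}$-preserving transformation. $(X,d)$ is a compact metric space with Borel $\sigma$-algebra $\mathcal{B}$. A continuous bundle random dynamical system (RDS) $T=(T_\omega)_\omega$ over $(\Omega,\mathcal{F},\mathbf{P},\vartheta)$ is a family of maps $T_\omega:X\to X$ such that $(\omega,x)\mapsto T_\omega(x)$ is measurable with respect to $\mathcal{F}\times\mathcal{B}$ and $x\mapsto T_\omega(x)$ is continuous for $\mathbf{P}$-a.e. $\omega$. Iterates: $T^0_\omega=\mathrm{id}$ and $T^n_\omega=T_{\vartheta^{n-1}\omega}\circ\cdots\circ T_{\vartheta\omega}\circ T_\omega$ for $n\ge 1$. The skew product is $\Theta(\omega,x)=(\vartheta\omega,T_\omega x)$ on $\Omega\times X$. Measures. $M^1_{\mathbf{P}}(\Omega\times X,T)$ is the set of probability measures on $(\Omega\times X,\mathcal{F}\times\mathcal{B})$ that are $\Theta$-invariant and have marginal $\mathbf{P}$ on $\Omega$; $E^1_{\mathbf{P}}(\Omega\times X,T)$ is the subset of those that are $\Theta$-ergodic. Such $\mu$ is disintegrated as $d\mu(\omega,x)=d\mu_\omega(x)\,d\mathbf{P}(\omega)$. Measure-theoretic entropy. For a finite measurable partition $\zeta$ of $\Omega\times X$ with $\omega$-sections $\zeta_\omega$ (partitions of $X$), set $$h^{(r)}_\mu(T,\zeta)=\lim_{n\to\infty}\frac1n\int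 H_{\mu_\omega}\Big(\bigvee_{i=0}^{n-1}(T^i_\omega)^{-1}\zeta_{\vartheta^i\omega}\Big)d\mathbf{P}(\omega),$$ where $H_{\mu_\omega}(\alpha)=-\sum_{A\in\alpha}\mu_\omega(A)\log\mu_\omega(A)$ for a finite partition $\alpha$ of $X$ (the limit exists). Then $h^{(r)}_\mu(T)=\sup\{h^{(r)}_\mu(T,\zeta):\zeta\text{ a finite measurable partition of }\Omega\times X\}$. Feldman-Katok (FK) metric. For $n\in\mathbb{N}$, $\varepsilon>0$, $x,y\in X$, an $(\omega,n,\varepsilon)$-match of $x$ and $y$ is an order preserving bijection $\pi:D(\pi)\to R(\pi)$ (i.e. $\pi(i)<\pi(j)$ whenever $i<j$) with $D(\pi),R(\pi)\subset\{0,1,\dots,n-1\}$ such that $d(T^i_\omega(x),T^{\pi(i)}_\omega(y))<\varepsilon$ for every $i\in D(\pi)$ (the empty match is allowed). Let $|\pi|$ be the cardinality of $D(\pi)$, and put $$\bar f_{\omega,n,\varepsilon}(x,y)=1-\tfrac1n\max\{|\pi|:\pi\text{ is an }(\omega,n,\varepsilon)\text{-match of }x\text{ and }y\},$$ $$d^{FK_n}_\omega(x,y)=\inf\{\varepsilon>0:\bar f_{\omega,n,\varepsilon}(x,y)<\varepsilon\}.$$ The ball of radius $\varepsilon$ about $x$ in this metric is $B_{FK_n}(\omega,x,\varepsilon)=\{y\in X:d^{FK_n}_\omega(x,y)<\varepsilon\}$. *)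

theory Defs
  imports "HOL-Probability.Probability"
begin

section \<open>The base system and bundle random dynamical systems\<close>

text \<open>
  A complete probability space that separates points and is countably generated.  As usual for
  complete probability spaces, the last notion is understood modulo null sets: a countable
  point-separating family \<open>C\<close> of measurable sets generates a \<open>\<sigma>\<close>-algebra whose completion is the
  whole \<open>\<sigma>\<close>-algebra.  (Without the completion, Lebesgue measure on the unit interval
  would be excluded.)  If \<open>sets P\<close> is itself generated by such a \<open>C\<close>, the condition holds as well,
  because \<open>sets P\<close> is complete.
\<close>

locale complete_separable_prob_space = prob_space P for P :: "'w measure" +
  assumes complete: "N \<in> null_sets P \<Longrightarrow> A \<subseteq> N \<Longrightarrow> A \<in> sets P"
    and countably_generated_separating:
      "\<exists>C. countable C \<and> C \<subseteq> sets P
         \<and> (\<forall>x\<in>space P. \<forall>y\<in>space P. x \<noteq> y \<longrightarrow> (\<exists>A\<in>C. (x \<in> A) \<noteq> (y \<in> A)))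
         \<and> sets P = sets (completion (restr_to_subalg P (sigma (space P) C)))"

definition measure_preserving_map :: "'a measure \<Rightarrow> ('a \<Rightarrow> 'a) \<Rightarrow> bool" where
  "measure_preserving_map M f \<longleftrightarrow> f \<in> M \<rightarrow>\<^sub>M M \<and> distr M M f = M"

definition ergodic_map :: "'a measure \<Rightarrow> ('a \<Rightarrow> 'a) \<Rightarrow> bool" where
  "ergodic_map M f \<longleftrightarrow> measure_preserving_map M f \<and>
     (\<forall>A\<in>sets M. f -` A \<inter> space M = A \<longrightarrow> measure M A = 0 \<or> measure M A = 1)"

locale continuous_bundle_rds = complete_separable_prob_space P
  for P :: "'w measure" and \<theta> :: "'w \<Rightarrow> 'w" and T :: "'w \<Rightarrow> 'x::metric_space \<Rightarrow> 'x" +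
  assumes base_bij: "bij_betw \<theta> (space P) (space P)"
    and base_inv_measurable: "the_inv_into (space P) \<theta> \<in> P \<rightarrow>\<^sub>M P"
    and base_ergodic: "ergodic_map P \<theta>"
    and fibre_compact: "compact (UNIV :: 'x set)"
    and fibre_measurable: "(\<lambda>(\<omega>, x). T \<omega> x) \<in> (P \<Otimes>\<^sub>M borel) \<rightarrow>\<^sub>M borel"
    and fibre_continuous: "AE \<omega> in P. continuous_on UNIV (T \<omega>)"

primrec rds_iter :: "('w \<Rightarrow> 'w) \<Rightarrow> ('w \<Rightarrow> 'x \<Rightarrow> 'x) \<Rightarrow> nat \<Rightarrow> 'w \<Rightarrow> 'x \<Rightarrow> 'x" where
  "rds_iter \<theta> T 0 \<omega> = id"
| "rds_iter \<theta> T (Suc n) \<omega> = T ((\<theta> ^^ n) \<omega>) \<circ> rds_iter \<theta> T n \<omega>"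

definition skew_product :: "('w \<Rightarrow> 'w) \<Rightarrow> ('w \<Rightarrow> 'x \<Rightarrow> 'x) \<Rightarrow> 'w \<times> 'x \<Rightarrow> 'w \<times> 'x" where
  "skew_product \<theta> T = (\<lambda>(\<omega>, x). (\<theta> \<omega>, T \<omega> x))"

section \<open>Invariant measures and their disintegrations\<close>

definition invariant_measures ::
  "'w measure \<Rightarrow> ('w \<Rightarrow> 'w) \<Rightarrow> ('w \<Rightarrow> 'x::metric_space \<Rightarrow> 'x) \<Rightarrow> ('w \<times> 'x) measure set" where
  "invariant_measures P \<theta> T =
     {\<mu>. prob_space \<mu> \<and> sets \<mu> = sets (P \<Otimes>\<^sub>M borel) \<and> distr \<mu> P fst = P \<and>
         measure_preserving_map \<mu> (skew_product \<theta> T)}"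

definition ergodic_measures ::
  "'w measure \<Rightarrow> ('w \<Rightarrow> 'w) \<Rightarrow> ('w \<Rightarrow> 'x::metric_space \<Rightarrow> 'x) \<Rightarrow> ('w \<times> 'x) measure set" where
  "ergodic_measures P \<theta> T = {\<mu> \<in> invariant_measures P \<theta> T. ergodic_map \<mu> (skew_product \<theta> T)}"

definition disintegration ::
  "'w measure \<Rightarrow> ('w \<times> 'x::metric_space) measure \<Rightarrow> ('w \<Rightarrow> 'x measure) \<Rightarrow> bool" where
  "disintegration P \<mu> \<kappa> \<longleftrightarrow> \<kappa> \<in> P \<rightarrow>\<^sub>M prob_algebra borel \<and>
     (\<forall>A\<in>sets (P \<Otimes>\<^sub>M borel). emeasure \<mu> A = (\<integral>\<^sup>+\<omega>. emeasure (\<kappa> \<omega>) (Pair \<omega> -` A) \<partial>P))"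

section \<open>Fibre entropy\<close>

definition partition_entropy :: "'x measure \<Rightarrow> 'x set set \<Rightarrow> real" where
  "partition_entropy \<nu> \<alpha> = - (\<Sum>A\<in>\<alpha>. measure \<nu> A * ln (measure \<nu> A))"

text \<open>Sections, preimages and joins of partitions drop the empty set.\<close>

definition partition_section :: "('w \<times> 'x) set set \<Rightarrow> 'w \<Rightarrow> 'x set set" where
  "partition_section \<zeta> \<omega> = (\<lambda>A. Pair \<omega> -` A) ` \<zeta> - {{}}"

definition partition_vimage :: "('x \<Rightarrow> 'x) \<Rightarrow> 'x set set \<Rightarrow> 'x set set" where
  "partition_vimage f \<alpha> = (\<lambda>A. f -` A) ` \<alpha> - {{}}"

definition partition_join :: "nat \<Rightarrow> (nat \<Rightarrow> 'x set set) \<Rightarrow> 'x set set" where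
  "partition_join n \<alpha> = {\<Inter>i<n. g i | g. \<forall>i<n. g i \<in> \<alpha> i} - {{}}"

definition finite_measurable_partition :: "'a measure \<Rightarrow> 'a set set \<Rightarrow> bool" where
  "finite_measurable_partition M \<zeta> \<longleftrightarrow> finite \<zeta> \<and> \<zeta> \<subseteq> sets M \<and> partition_on (space M) \<zeta>"

definition fibre_entropy_partition ::
  "'w measure \<Rightarrow> ('w \<Rightarrow> 'w) \<Rightarrow> ('w \<Rightarrow> 'x \<Rightarrow> 'x) \<Rightarrow> ('w \<Rightarrow> 'x measure) \<Rightarrow> ('w \<times> 'x) set set \<Rightarrow> real"
  where
  "fibre_entropy_partition P \<theta> T \<kappa> \<zeta> =
     lim (\<lambda>n. (1 / real n) *
       (\<integral>\<omega>. partition_entropy (\<kappa> \<omega>)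
             (partition_join n (\<lambda>i. partition_vimage (rds_iter \<theta> T i \<omega>)
                                      (partition_section \<zeta> ((\<theta> ^^ i) \<omega>)))) \<partial>P))"

text \<open>The entropy of an invariant measure, as a function of its disintegration \<open>\<kappa>\<close>.\<close>

definition fibre_entropy ::
  "'w measure \<Rightarrow> ('w \<Rightarrow> 'w) \<Rightarrow> ('w \<Rightarrow> 'x::metric_space \<Rightarrow> 'x) \<Rightarrow> ('w \<Rightarrow> 'x measure) \<Rightarrow> ereal" where
  "fibre_entropy P \<theta> T \<kappa> =
     (SUP \<zeta>\<in>{\<zeta>. finite_measurable_partition (P \<Otimes>\<^sub>M borel) \<zeta>}.
        ereal (fibre_entropy_partition P \<theta> T \<kappa> \<zeta>))"

section \<open>The Feldman-Katok metric\<close>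

text \<open>
  A match is given by its domain \<open>D\<close> and a map \<open>\<pi>\<close>, of which only the values on \<open>D\<close> matter;
  being strictly increasing, \<open>\<pi>\<close> is a bijection of \<open>D\<close> onto its range \<open>\<pi> ` D\<close>.
\<close>

definition fk_match ::
  "('w \<Rightarrow> 'w) \<Rightarrow> ('w \<Rightarrow> 'x::metric_space \<Rightarrow> 'x) \<Rightarrow> 'w \<Rightarrow> nat \<Rightarrow> real \<Rightarrow> 'x \<Rightarrow> 'x \<Rightarrow>
     nat set \<Rightarrow> (nat \<Rightarrow> nat) \<Rightarrow> bool" where
  "fk_match \<theta> T \<omega> n \<epsilon> x y D \<pi> \<longleftrightarrow>
     D \<subseteq> {..<n} \<and> \<pi> ` D \<subseteq> {..<n} \<and> strict_mono_on D \<pi> \<and>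
     (\<forall>i\<in>D. dist (rds_iter \<theta> T i \<omega> x) (rds_iter \<theta> T (\<pi> i) \<omega> y) < \<epsilon>)"

definition fk_bar ::
  "('w \<Rightarrow> 'w) \<Rightarrow> ('w \<Rightarrow> 'x::metric_space \<Rightarrow> 'x) \<Rightarrow> 'w \<Rightarrow> nat \<Rightarrow> real \<Rightarrow> 'x \<Rightarrow> 'x \<Rightarrow> real" where
  "fk_bar \<theta> T \<omega> n \<epsilon> x y =
     1 - (1 / real n) * real (Max {card D | D \<pi>. fk_match \<theta> T \<omega> n \<epsilon> x y D \<pi>})"

definition fk_dist ::
  "('w \<Rightarrow> 'w) \<Rightarrow> ('w \<Rightarrow> 'x::metric_space \<Rightarrow> 'x) \<Rightarrow> 'w \<Rightarrow> nat \<Rightarrow> 'x \<Rightarrow> 'x \<Rightarrow> real" where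
  "fk_dist \<theta> T \<omega> n x y = Inf {\<epsilon>. \<epsilon> > 0 \<and> fk_bar \<theta> T \<omega> n \<epsilon> x y < \<epsilon>}"

definition fk_ball ::
  "('w \<Rightarrow> 'w) \<Rightarrow> ('w \<Rightarrow> 'x::metric_space \<Rightarrow> 'x) \<Rightarrow> 'w \<Rightarrow> nat \<Rightarrow> 'x \<Rightarrow> real \<Rightarrow> 'x set" where
  "fk_ball \<theta> T \<omega> n x \<epsilon> = {y. fk_dist \<theta> T \<omega> n x y < \<epsilon>}"

definition sp_fk ::
  "('w \<Rightarrow> 'w) \<Rightarrow> ('w \<Rightarrow> 'x::metric_space \<Rightarrow> 'x) \<Rightarrow> ('w \<Rightarrow> 'x measure) \<Rightarrow> 'w \<Rightarrow> nat \<Rightarrow> real \<Rightarrow> nat" where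
  "sp_fk \<theta> T \<kappa> \<omega> n \<epsilon> =
     (LEAST k. \<exists>F. finite F \<and> card F = k \<and>
        measure (\<kappa> \<omega>) (\<Union>x\<in>F. fk_ball \<theta> T \<omega> n x \<epsilon>) > 1 - \<epsilon>)"

end

theory Submission
  imports Defs
begin

text \<open>
  Code the orbit of \<open>(\<omega>, x)\<close> by the atoms of a finite partition that it visits.  By strong
  subadditivity of entropy, the entropy of the names of length \<open>n\<close> under \<open>\<kappa> \<omega>\<close> is a sum along the
  base orbit of conditional entropies that decrease to a limit with mean \<open>h(T, \<zeta>)\<close>, so Birkhoff's
  theorem for \<open>\<theta>\<close> bounds it from below by about \<open>n * h(T, \<zeta>)\<close> for almost every \<open>\<omega>\<close>.

  Lower bound: outside a set of small measure, nearby points of a fibre lie in the same atom.  Both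
  \<open>x\<close> and \<open>x'\<close> being matched to the same centre along the same times, their names agree except at
  few times, so up to a subexponential factor the FK balls count names.  Only points of one
  fibre are ever compared, so it does no harm that FK matches shift time.

  Upper bound: FK balls contain the name classes of a partition into sets of small diameter.
  Assign to words of length \<open>n\<close> the product weights built from the distributions of names of length
  \<open>k\<close>.  The weights sum to 1, and by Birkhoff's theorem for the ergodic skew product almost every
  name has weight at least \<open>exp (- n * (h + \<eta>))\<close>; so there are at most \<open>exp (n * (h + \<eta>))\<close> such names
  up to a bounded factor.
\<close>

section \<open>Birkhoff averages of bounded functions\<close>

text \<open>In the first claim \<mu> is only invariant, so the names in one fibre may decay at
  different exponential rates. The lower bound therefore works with the entropy of the whole fibre
  distribution, a function on the base: a few names that carry most of the mass have small entropy,
  which turns an entropy bound into a count. The upper bound needs single names to be cheap, and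
  there ergodicity of \<mu> enters. Since \<open>\<Theta> ^^ k\<close> may fail to be ergodic,
  Birkhoff's theorem is applied to \<Theta> itself and the k phases of the block decomposition are
  averaged. Null sets are the second concern, as partitions and radii form uncountable families.
  Each estimate is proved for one partition and one radius; a sequence of partitions whose entropies
  reach the supremum, and monotonicity in the radius, leave countably many exceptional sets. As
  \<Omega> carries no topology, the statement that nearby points of a fibre mostly share an atom is
  obtained by generating the product \<sigma>-algebra from rectangles.\<close>

lemma measure_preserving_map_funpow:
  assumes "measure_preserving_map M f"
  shows "measure_preserving_map M (f ^^ n)"
proof (induction n)
  case 0
  then show ?case by (simp add: measure_preserving_map_def id_def distr_id)
next
  case (Suc n)
  have "distr M M (f ^^ Suc n) = distr (distr M M (f ^^ n)) M f"
    using Suc assms by (subst distr_distr) (auto simp: measure_preserving_map_def comp_def)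
  also have "\<dots> = M"
    using Suc assms by (simp add: measure_preserving_map_def)
  finally have "distr M M (f ^^ Suc n) = M" .
  moreover have "f ^^ Suc n \<in> M \<rightarrow>\<^sub>M M"
    using Suc assms by (auto simp: measure_preserving_map_def intro: measurable_comp)
  ultimately show ?case unfolding measure_preserving_map_def by blast
qed

lemma measure_preserving_map_integral:
  fixes g :: "'a \<Rightarrow> real"
  assumes "measure_preserving_map M f" "g \<in> borel_measurable M"
  shows "(\<integral>x. g (f x) \<partial>M) = (\<integral>x. g x \<partial>M)"
  using integral_distr[of f M M g] assms by (simp add: measure_preserving_map_def)

lemma measure_preserving_map_AE:
  assumes "measure_preserving_map M f" "AE x in M. Q x"
  shows "AE x in M. Q (f x)"
proof -
  have "distr M M f = M" using assms(1) by (simp add: measure_preserving_map_def)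
  then have "AE x in distr M M f. Q x" using assms(2) by (simp only:)
  then show ?thesis
    using AE_distrD[of f M M] assms(1) by (simp add: measure_preserving_map_def)
qed

lemma measure_preserving_map_AE_funpow:
  assumes "measure_preserving_map M f" "AE x in M. Q x"
  shows "AE x in M. \<forall>i. Q ((f ^^ i) x)"
  using measure_preserving_map_AE[OF measure_preserving_map_funpow[OF assms(1)] assms(2)]
  by (simp add: AE_all_countable)

definition birkhoff_sum :: "('a \<Rightarrow> 'a) \<Rightarrow> ('a \<Rightarrow> real) \<Rightarrow> nat \<Rightarrow> 'a \<Rightarrow> real" where
  "birkhoff_sum f g n x = (\<Sum>i<n. g ((f ^^ i) x))"

lemma birkhoff_sum_0 [simp]: "birkhoff_sum f g 0 x = 0"
  by (simp add: birkhoff_sum_def)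

lemma birkhoff_sum_Suc_shift: "birkhoff_sum f g (Suc n) x = g x + birkhoff_sum f g n (f x)"
  unfolding birkhoff_sum_def by (subst sum.lessThan_Suc_shift) (simp add: funpow_swap1)

lemma birkhoff_sum_measurable:
  assumes "measure_preserving_map M f" "g \<in> borel_measurable M"
  shows "birkhoff_sum f g n \<in> borel_measurable M"
proof -
  have "(\<lambda>x. g ((f ^^ i) x)) \<in> borel_measurable M" for i
    using measure_preserving_map_funpow[OF assms(1), of i] assms(2)
    by (auto simp: measure_preserving_map_def intro: measurable_compose)
  then show ?thesis
    unfolding birkhoff_sum_def[abs_def] by (intro borel_measurable_sum)
qed

lemma funpow_in_space:
  assumes "f \<in> M \<rightarrow>\<^sub>M M" "x \<in> space M"
  shows "(f ^^ i) x \<in> space M"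
  using assms by (induction i) (auto dest: measurable_space)

text \<open>Garsia's proof of the maximal ergodic theorem.\<close>
lemma maximal_ergodic:
  fixes h :: "'a \<Rightarrow> real"
  assumes "prob_space M" and f: "measure_preserving_map M f"
    and h [measurable]: "h \<in> borel_measurable M"
    and B: "\<And>x. x \<in> space M \<Longrightarrow> \<bar>h x\<bar> \<le> B"
    and pos: "AE x in M. \<exists>n. birkhoff_sum f h n x > 0"
  shows "(\<integral>x. h x \<partial>M) \<ge> 0"
proof -
  interpret prob_space M by fact
  have fm [measurable]: "f \<in> M \<rightarrow>\<^sub>M M" using f by (simp add: measure_preserving_map_def)
  have Sm [measurable]: "birkhoff_sum f h n \<in> borel_measurable M" for n
    using birkhoff_sum_measurable[OF f h] .
  have hint: "integrable M h"
    using B by (intro integrable_const_bound[where B = B]) auto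
  \<comment> \<open>The sum of length 0 takes part in the maximum, so \<open>X n\<close> is
    nonnegative. Where \<open>X n x\<close> is positive, the maximum is attained at a length m' + 1,
    and there the sum is \<open>h x\<close> plus the sum of length m' at \<open>f x\<close>, which
    is at most \<open>X n (f x)\<close>.\<close>
  define X where "X n x = Max ((\<lambda>m. birkhoff_sum f h m x) ` {..n})" for n x
  have Xm [measurable]: "X n \<in> borel_measurable M" for n
    unfolding X_def[abs_def] by measurable
  have X_ge: "birkhoff_sum f h m x \<le> X n x" if "m \<le> n" for m n x
    unfolding X_def using that by (intro Max_ge) auto
  have X0: "0 \<le> X n x" for n x using X_ge[of 0 n x] by simp
  have S_le: "\<bar>birkhoff_sum f h m x\<bar> \<le> real m * B" if "x \<in> space M" for m x
  proof -
    have "\<bar>birkhoff_sum f h m x\<bar> \<le> (\<Sum>i<m. \<bar>h ((f ^^ i) x)\<bar>)"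
      unfolding birkhoff_sum_def by (rule sum_abs)
    also have "\<dots> \<le> (\<Sum>i<m. B)"
      by (intro sum_mono B funpow_in_space[OF fm that])
    finally show ?thesis by simp
  qed
  have Bx: "x \<in> space M \<Longrightarrow> 0 \<le> B" for x using B[of x] by linarith
  have X_le: "X n x \<le> real n * B" if "x \<in> space M" for n x
    unfolding X_def
  proof (rule Max.boundedI)
    fix s assume "s \<in> (\<lambda>m. birkhoff_sum f h m x) ` {..n}"
    then obtain m where "m \<le> n" "s = birkhoff_sum f h m x" by auto
    then show "s \<le> real n * B"
      using S_le[OF that, of m] Bx[OF that] mult_right_mono[of "real m" "real n" B] by linarith
  qed auto
  have Xint: "integrable M (X n)" for n
    using X_le X0 by (intro integrable_const_bound[where B = "real n * B"]) (auto simp: abs_of_nonneg)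
  have Xint': "integrable M (\<lambda>x. X n (f x))" for n
    using integrable_distr[OF fm, of "X n"] Xint[of n] f by (simp add: measure_preserving_map_def)
  have key: "X n x - X n (f x) \<le> indicator {x. X n x > 0} x * h x" for n x
  proof (cases "X n x > 0")
    case True
    have "X n x \<in> (\<lambda>m. birkhoff_sum f h m x) ` {..n}"
      unfolding X_def by (rule Max_in) auto
    then obtain m where m: "m \<le> n" "X n x = birkhoff_sum f h m x" by auto
    with True obtain m' where m': "m = Suc m'" by (cases m) auto
    have "X n x = h x + birkhoff_sum f h m' (f x)" using m m' birkhoff_sum_Suc_shift by metis
    also have "\<dots> \<le> h x + X n (f x)" using X_ge[of m' n "f x"] m m' by simp
    finally show ?thesis using True by simp
  next
    case False
    then have "X n x = 0" using X0[of n x] by linarith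
    then show ?thesis using X0[of n "f x"] by simp
  qed
  have ind_int: "integrable M (\<lambda>x. indicator {x. X n x > 0} x * h x)" for n
    using B by (intro integrable_const_bound[where B = B]) (auto simp: indicator_def Bx)
  have nonneg: "0 \<le> (\<integral>x. indicator {x. X n x > 0} x * h x \<partial>M)" for n
  proof -
    have "0 = (\<integral>x. X n x \<partial>M) - (\<integral>x. X n (f x) \<partial>M)"
      using measure_preserving_map_integral[OF f, of "X n"] by simp
    also have "\<dots> = (\<integral>x. X n x - X n (f x) \<partial>M)"
      using Xint Xint' by simp
    also have "\<dots> \<le> (\<integral>x. indicator {x. X n x > 0} x * h x \<partial>M)"
      using Xint Xint' ind_int key by (intro integral_mono) auto
    finally show ?thesis .
  qed
  have "(\<lambda>n. \<integral>x. indicator {x. X n x > 0} x * h x \<partial>M) \<longlonglongrightarrow> (\<integral>x. h x \<partial>M)"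
  proof (rule integral_dominated_convergence[where w = "\<lambda>_. B"])
    show "AE x in M. (\<lambda>n. indicator {x. X n x > 0} x * h x) \<longlonglongrightarrow> h x"
      using pos
    proof eventually_elim
      fix x assume "\<exists>n. birkhoff_sum f h n x > 0"
      then obtain m where m: "birkhoff_sum f h m x > 0" ..
      have "\<forall>\<^sub>F n in sequentially. indicator {x. X n x > 0} x * h x = h x"
        using eventually_ge_at_top[of m]
      proof eventually_elim
        fix n assume "m \<le> n"
        then have "X n x > 0" using X_ge[of m n x] m by linarith
        then show "indicator {x. X n x > 0} x * h x = h x" by simp
      qed
      then show "(\<lambda>n. indicator {x. X n x > 0} x * h x) \<longlonglongrightarrow> h x"
        by (rule tendsto_eventually)
    qed
    show "AE x in M. norm (indicator {x. X n x > 0} x * h x) \<le> B" for n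
      using B Bx by (auto simp: indicator_def)
  qed auto
  then show ?thesis using nonneg by (intro LIMSEQ_le_const) auto
qed

text \<open>The set where \<open>birkhoff_sum f g n x - b * n\<close> is unbounded above is strictly invariant, and by
  the maximal ergodic theorem it cannot have full measure if \<open>b\<close> exceeds the mean of \<open>g\<close>.\<close>
lemma birkhoff_upper:
  fixes g :: "'a \<Rightarrow> real"
  assumes "prob_space M" and erg: "ergodic_map M f"
    and g [measurable]: "g \<in> borel_measurable M"
    and B: "\<And>x. x \<in> space M \<Longrightarrow> \<bar>g x\<bar> \<le> B"
    and b: "(\<integral>x. g x \<partial>M) < b"
  shows "AE x in M. \<forall>\<^sub>F n in sequentially. birkhoff_sum f g n x \<le> b * real n"
proof -
  interpret prob_space M by fact
  have f: "measure_preserving_map M f" using erg by (simp add: ergodic_map_def)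
  have fm [measurable]: "f \<in> M \<rightarrow>\<^sub>M M" using f by (simp add: measure_preserving_map_def)
  \<comment> \<open>The gap between b' and b absorbs a constant: if the sums of g - b' stay below K,
    those of g are at most b * n once n exceeds K / (b - b').\<close>
  obtain b' where b': "(\<integral>x. g x \<partial>M) < b'" "b' < b" using dense[OF b] by auto
  define h where "h x = g x - b'" for x
  have hm [measurable]: "h \<in> borel_measurable M" unfolding h_def[abs_def] by measurable
  have Sm [measurable]: "birkhoff_sum f h n \<in> borel_measurable M" for n
    using birkhoff_sum_measurable[OF f hm] .
  have Sh: "birkhoff_sum f h n x = birkhoff_sum f g n x - b' * real n" for n x
    by (simp add: birkhoff_sum_def h_def sum_subtractf)
  \<comment> \<open>Sums at x and at \<open>f x\<close> differ by the single term
    \<open>h x\<close>, which does not affect unboundedness. Hence the preimage of U is exactly U,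
    as \<open>ergodic_map\<close> demands, and not merely up to a null set.\<close>
  define U where "U = {x \<in> space M. \<forall>K::nat. \<exists>n. birkhoff_sum f h n x > real K}"
  have Um: "U \<in> sets M" unfolding U_def by measurable
  have inv: "f -` U \<inter> space M = U"
  proof -
    have "(\<forall>K::nat. \<exists>n. birkhoff_sum f h n (f x) > real K) \<longleftrightarrow>
          (\<forall>K::nat. \<exists>n. birkhoff_sum f h n x > real K)" for x
    proof (intro iffI allI)
      fix K :: nat
      assume *: "\<forall>K::nat. \<exists>n. birkhoff_sum f h n (f x) > real K"
      obtain K' :: nat where K': "real K' \<ge> real K - h x" using real_arch_simple by blast
      obtain n where "birkhoff_sum f h n (f x) > real K'" using * by blast
      then have "birkhoff_sum f h (Suc n) x > real K"
        using K' by (simp add: birkhoff_sum_Suc_shift)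
      then show "\<exists>n. birkhoff_sum f h n x > real K" ..
    next
      fix K :: nat
      assume *: "\<forall>K::nat. \<exists>n. birkhoff_sum f h n x > real K"
      obtain K' :: nat where K': "real K' \<ge> \<bar>real K + h x\<bar>" using real_arch_simple by blast
      obtain n where n: "birkhoff_sum f h n x > real K'" using * by blast
      then obtain m where "n = Suc m" by (cases n) auto
      with n have "birkhoff_sum f h m (f x) > real K"
        using K' by (simp add: birkhoff_sum_Suc_shift)
      then show "\<exists>n. birkhoff_sum f h n (f x) > real K" ..
    qed
    then show ?thesis using measurable_space[OF fm] by (auto simp: U_def)
  qed
  have "measure M U \<noteq> 1"
  proof
    assume "measure M U = 1"
    then have "AE x in M. x \<in> U" using Um prob_eq_1[of U] by simp
    then have pos: "AE x in M. \<exists>n. birkhoff_sum f h n x > 0"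
      by eventually_elim (simp add: U_def, metis of_nat_0)
    have "(\<integral>x. h x \<partial>M) \<ge> 0"
      by (rule maximal_ergodic[OF \<open>prob_space M\<close> f hm _ pos, of "B + \<bar>b'\<bar>"])
        (use B in \<open>fastforce simp: h_def\<close>)
    moreover have "(\<integral>x. h x \<partial>M) = (\<integral>x. g x \<partial>M) - b'"
      unfolding h_def
      using B by (subst Bochner_Integration.integral_diff)
        (auto intro!: integrable_const_bound[where B = B] simp: prob_space)
    ultimately show False using b' by simp
  qed
  then have "measure M U = 0" using erg Um inv by (auto simp: ergodic_map_def)
  then have "AE x in M. x \<notin> U" using Um prob_eq_0 by blast
  then show ?thesis using AE_space
  proof eventually_elim
    fix x assume "x \<notin> U" "x \<in> space M"
    then obtain K :: nat where K: "\<And>n. birkhoff_sum f h n x \<le> real K"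
      by (auto simp: U_def not_less)
    obtain m :: nat where m: "real m > real K / (b - b')" using reals_Archimedean2 by blast
    show "\<forall>\<^sub>F n in sequentially. birkhoff_sum f g n x \<le> b * real n"
      using eventually_ge_at_top[of m]
    proof eventually_elim
      fix n assume "m \<le> n"
      then have "real K / (b - b') \<le> real n" using m by linarith
      then have "real K \<le> real n * (b - b')" using b' by (simp add: pos_divide_le_eq)
      then show "birkhoff_sum f g n x \<le> b * real n"
        using K[of n] Sh[of n x] by (simp add: algebra_simps)
    qed
  qed
qed

lemma birkhoff_lower:
  fixes g :: "'a \<Rightarrow> real"
  assumes "prob_space M" and erg: "ergodic_map M f"
    and g [measurable]: "g \<in> borel_measurable M"
    and B: "\<And>x. x \<in> space M \<Longrightarrow> \<bar>g x\<bar> \<le> B"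
    and b: "b < (\<integral>x. g x \<partial>M)"
  shows "AE x in M. \<forall>\<^sub>F n in sequentially. b * real n \<le> birkhoff_sum f g n x"
proof -
  have "AE x in M. \<forall>\<^sub>F n in sequentially. birkhoff_sum f (\<lambda>x. - g x) n x \<le> - b * real n"
    by (rule birkhoff_upper[OF assms(1) erg, where B = B]) (use B b in auto)
  then show ?thesis by (simp add: birkhoff_sum_def sum_negf)
qed

section \<open>Entropy of finite distributions\<close>

definition fin_entropy :: "'a set \<Rightarrow> ('a \<Rightarrow> real) \<Rightarrow> real" where
  "fin_entropy W p = - (\<Sum>w\<in>W. p w * ln (p w))"

lemma fin_entropy_reindex:
  assumes "bij_betw h A B"
  shows "fin_entropy B p = fin_entropy A (\<lambda>a. p (h a))"
  unfolding fin_entropy_def using sum.reindex_bij_betw[OF assms, of "\<lambda>w. p w * ln (p w)"] by simp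

lemma fin_entropy_cong:
  assumes "\<And>w. w \<in> W \<Longrightarrow> p w = q w"
  shows "fin_entropy W p = fin_entropy W q"
  unfolding fin_entropy_def using assms by simp

lemma fin_entropy_nonneg:
  assumes "\<And>w. w \<in> W \<Longrightarrow> 0 \<le> p w" "\<And>w. w \<in> W \<Longrightarrow> p w \<le> 1"
  shows "0 \<le> fin_entropy W p"
proof -
  have "p w * ln (p w) \<le> 0" if "w \<in> W" for w
  proof (cases "p w = 0")
    case False
    then have "ln (p w) \<le> 0" using assms[OF that] by simp
    then show ?thesis using assms(1)[OF that] by (rule mult_nonneg_nonpos[rotated])
  qed simp
  then show ?thesis unfolding fin_entropy_def by (simp add: sum_nonpos)
qed

text \<open>The inequality ln t \<le> t - 1 at t = q / p, multiplied by p. For p = 0 both products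
  vanish, whatever the logarithms are.\<close>

lemma mult_ln_diff_le:
  fixes p q :: real
  assumes "0 \<le> p" "0 \<le> q" "q = 0 \<Longrightarrow> p = 0"
  shows "p * ln q - p * ln p \<le> q - p"
proof (cases "p = 0")
  case False
  then have pq: "p > 0" "q > 0" using assms by (auto simp: order_less_le)
  have "ln (q / p) \<le> q / p - 1" using pq by (intro ln_le_minus_one) simp
  then have "p * ln (q / p) \<le> p * (q / p - 1)" using pq by (intro mult_left_mono) auto
  then show ?thesis using pq by (simp add: ln_div algebra_simps)
qed (use assms in auto)

text \<open>The right-hand side is the mean length of a code with lengths \<open>- ln (q w)\<close>,
  so every clever choice of q yields an upper bound for an entropy.\<close>

lemma gibbs_inequality:
  assumes "\<And>w. w \<in> W \<Longrightarrow> 0 \<le> p w" "\<And>w. w \<in> W \<Longrightarrow> 0 < q w"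
    and "(\<Sum>w\<in>W. q w) \<le> (\<Sum>w\<in>W. p w)"
  shows "fin_entropy W p \<le> - (\<Sum>w\<in>W. p w * ln (q w))"
proof -
  have "(\<Sum>w\<in>W. p w * ln (q w) - p w * ln (p w)) \<le> (\<Sum>w\<in>W. q w - p w)"
  proof (intro sum_mono mult_ln_diff_le)
    fix w assume "w \<in> W"
    then show "0 \<le> p w" "0 \<le> q w" "q w = 0 \<Longrightarrow> p w = 0"
      using assms(1)[of w] assms(2)[of w] by auto
  qed
  then show ?thesis using assms(3) by (simp add: fin_entropy_def sum_subtractf)
qed

lemma fin_entropy_le_ln_card:
  assumes "finite W" "\<And>w. w \<in> W \<Longrightarrow> 0 \<le> p w" "(\<Sum>w\<in>W. p w) = 1"
  shows "fin_entropy W p \<le> ln (card W)"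
proof -
  have W: "card W > 0" using assms by (auto simp: card_gt_0_iff)
  have "fin_entropy W p \<le> - (\<Sum>w\<in>W. p w * ln (1 / card W))"
    using assms W by (intro gibbs_inequality) auto
  also have "\<dots> = ln (card W)"
    using assms(3) W by (simp add: sum_distrib_right[symmetric] sum_negf ln_div)
  finally show ?thesis .
qed

text \<open>Gibbs' inequality for the mixture of the uniform distributions on \<open>A\<close> and on \<open>W\<close>.\<close>
lemma fin_entropy_concentrated:
  fixes M :: real
  assumes "finite W" "A \<subseteq> W" "\<And>w. w \<in> W \<Longrightarrow> 0 \<le> p w" "(\<Sum>w\<in>W. p w) = 1"
    and M: "card A \<le> M" "1 \<le> M"
  shows "fin_entropy W p \<le> ln 2 + ln M + (\<Sum>w\<in>W - A. p w) * ln (card W)"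
proof -
  have W: "real (card W) \<ge> 1" using assms by (auto simp: Suc_le_eq card_gt_0_iff)
  define K where "K = real (card W)"
  have K: "K \<ge> 1" using W by (simp add: K_def)
  \<comment> \<open>The uniform half on W keeps q positive everywhere and costs ln (2 * K) off A.
    The other half gives each element of A at least 1 / (2 * M), hence cost at most ln (2 * M); its
    total is at most 1 / 2 because A has at most M elements.\<close>
  define q where "q w = 1 / (2 * K) + (if w \<in> A then 1 / (2 * M) else 0)" for w
  have q0: "q w > 0" for w using K M by (auto simp: q_def intro!: add_pos_nonneg)
  have "(\<Sum>w\<in>W. q w) = card W / (2 * K) + card (W \<inter> A) / (2 * M)"
    unfolding q_def sum.distrib using assms(1)
    by (simp add: sum.If_cases)
  also have "\<dots> \<le> 1 / 2 + 1 / 2"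
  proof (intro add_mono)
    have "W \<inter> A = A" using assms by auto
    then show "card (W \<inter> A) / (2 * M) \<le> 1 / 2" using M by (simp add: divide_simps)
  qed (use K in \<open>simp add: K_def\<close>)
  finally have "(\<Sum>w\<in>W. q w) \<le> (\<Sum>w\<in>W. p w)" using assms by simp
  then have "fin_entropy W p \<le> - (\<Sum>w\<in>W. p w * ln (q w))"
    using assms q0 by (intro gibbs_inequality) auto
  also have "\<dots> = (\<Sum>w\<in>W. p w * - ln (q w))" by (simp add: sum_negf)
  also have "\<dots> \<le> (\<Sum>w\<in>W. p w * (ln 2 + ln M + (if w \<in> A then 0 else ln K)))"
  proof (intro sum_mono mult_left_mono)
    fix w assume "w \<in> W"
    have lnM: "ln M \<ge> 0" using M by simp
    show "- ln (q w) \<le> ln 2 + ln M + (if w \<in> A then 0 else ln K)"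
    proof (cases "w \<in> A")
      case True
      then have "q w \<ge> 1 / (2 * M)" using K by (simp add: q_def)
      then have "ln (q w) \<ge> ln (1 / (2 * M))" using M q0[of w] by (subst ln_le_cancel_iff) auto
      then show ?thesis using True M by (simp add: ln_div ln_mult)
    next
      case False
      then have "ln (q w) = - ln (2 * K)" using K by (simp add: q_def ln_div)
      then show ?thesis using False lnM K by (simp add: ln_mult)
    qed
  qed (use assms in auto)
  also have "\<dots> = (\<Sum>w\<in>W. p w * (ln 2 + ln M)) + (\<Sum>w\<in>W. if w \<in> A then 0 else p w * ln K)"
    by (simp add: sum.distrib[symmetric] distrib_left if_distrib cong: if_cong)
  also have "\<dots> = ln 2 + ln M + (\<Sum>w\<in>W - A. p w) * ln K"
    using assms by (simp add: sum_distrib_right[symmetric] sum.If_cases Diff_eq)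
  finally show ?thesis by (simp add: K_def)
qed

text \<open>Each \<open>p (a, b)\<close> is at most the marginal weight of b, and ln is
  monotone.\<close>

lemma fin_entropy_marginal_le:
  assumes "finite A" "\<And>a b. a \<in> A \<Longrightarrow> b \<in> B \<Longrightarrow> 0 \<le> p (a, b)"
  shows "fin_entropy B (\<lambda>b. \<Sum>a\<in>A. p (a, b)) \<le> fin_entropy (A \<times> B) p"
proof -
  define r where "r b = (\<Sum>a\<in>A. p (a, b))" for b
  have "(\<Sum>(a, b)\<in>A \<times> B. p (a, b) * ln (p (a, b))) \<le> (\<Sum>(a, b)\<in>A \<times> B. p (a, b) * ln (r b))"
  proof (intro sum_mono, clarsimp)
    fix a b assume ab: "a \<in> A" "b \<in> B"
    have le: "p (a, b) \<le> r b"
      unfolding r_def using assms ab by (intro member_le_sum) auto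
    show "p (a, b) * ln (p (a, b)) \<le> p (a, b) * ln (r b)"
    proof (cases "p (a, b) = 0")
      case False
      then have "0 < p (a, b)" using assms(2)[OF ab] by simp
      then show ?thesis using le by (intro mult_left_mono) auto
    qed simp
  qed
  also have "\<dots> = (\<Sum>b\<in>B. \<Sum>a\<in>A. p (a, b) * ln (r b))"
    by (subst sum.swap) (simp add: sum.cartesian_product)
  also have "\<dots> = (\<Sum>b\<in>B. r b * ln (r b))"
    by (simp add: r_def sum_distrib_right)
  finally show ?thesis by (simp add: fin_entropy_def r_def case_prod_beta)
qed

text \<open>Nonnegativity of the mutual information of A and C conditioned on B: p is compared with
  s * t / r, the weights that make A and C independent given B. Both have the same total mass, so
  summing \<open>mult_ln_diff_le\<close> leaves 0 on the right.\<close>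

lemma fin_entropy_strong_subadditive:
  assumes fin: "finite A" "finite B" "finite C"
    and nonneg: "\<And>a b c. a \<in> A \<Longrightarrow> b \<in> B \<Longrightarrow> c \<in> C \<Longrightarrow> 0 \<le> p (a, b, c)"
  shows "fin_entropy (A \<times> B \<times> C) p + fin_entropy B (\<lambda>b. \<Sum>a\<in>A. \<Sum>c\<in>C. p (a, b, c))
    \<le> fin_entropy (A \<times> B) (\<lambda>(a, b). \<Sum>c\<in>C. p (a, b, c))
      + fin_entropy (B \<times> C) (\<lambda>(b, c). \<Sum>a\<in>A. p (a, b, c))"
proof -
  define r where "r b = (\<Sum>a\<in>A. \<Sum>c\<in>C. p (a, b, c))" for b
  define s where "s a b = (\<Sum>c\<in>C. p (a, b, c))" for a b
  define t where "t b c = (\<Sum>a\<in>A. p (a, b, c))" for b c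
  have rs: "r b = (\<Sum>a\<in>A. s a b)" for b by (simp add: r_def s_def)
  have rt: "r b = (\<Sum>c\<in>C. t b c)" for b unfolding r_def t_def by (rule sum.swap)
  have s0: "0 \<le> s a b" if "a \<in> A" "b \<in> B" for a b
    unfolding s_def using nonneg that by (intro sum_nonneg) auto
  have t0: "0 \<le> t b c" if "b \<in> B" "c \<in> C" for b c
    unfolding t_def using nonneg that by (intro sum_nonneg) auto
  have r0: "0 \<le> r b" if "b \<in> B" for b
    unfolding rs using s0 that by (intro sum_nonneg) auto
  have pointwise: "p (a, b, c) * (ln (s a b) + ln (t b c) - ln (r b) - ln (p (a, b, c)))
      \<le> s a b * t b c / r b - p (a, b, c)"
    if abc: "a \<in> A" "b \<in> B" "c \<in> C" for a b c
  proof (cases "p (a, b, c) = 0")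
    case True
    then show ?thesis using s0 t0 r0 abc by simp
  next
    case False
    then have p0: "p (a, b, c) > 0" using nonneg[OF abc] by simp
    have "p (a, b, c) \<le> s a b" unfolding s_def using fin nonneg abc by (intro member_le_sum) auto
    moreover have "p (a, b, c) \<le> t b c"
      unfolding t_def using fin nonneg abc
      by (intro member_le_sum[of a A "\<lambda>a. p (a, b, c)"]) auto
    moreover have "s a b \<le> r b"
      unfolding rs using fin s0 abc by (intro member_le_sum[of a A "\<lambda>a. s a b"]) auto
    ultimately have pos: "s a b > 0" "t b c > 0" "r b > 0" using p0 by auto
    have "p (a, b, c) * ln (s a b * t b c / r b) - p (a, b, c) * ln (p (a, b, c))
      \<le> s a b * t b c / r b - p (a, b, c)"
      using pos p0 by (intro mult_ln_diff_le) auto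
    then show ?thesis using pos by (simp add: ln_mult ln_div algebra_simps)
  qed
  \<comment> \<open>Where \<open>r b\<close> is 0 the identity r * r / r = r still holds, since
    division by 0 gives 0.\<close>
  have tot: "(\<Sum>a\<in>A. \<Sum>b\<in>B. \<Sum>c\<in>C. s a b * t b c / r b) = (\<Sum>b\<in>B. r b)"
  proof -
    have "(\<Sum>a\<in>A. \<Sum>b\<in>B. \<Sum>c\<in>C. s a b * t b c / r b) = (\<Sum>b\<in>B. \<Sum>a\<in>A. \<Sum>c\<in>C. s a b * t b c / r b)"
      by (rule sum.swap)
    also have "\<dots> = (\<Sum>b\<in>B. r b)"
    proof (rule sum.cong[OF refl])
      fix b
      have "(\<Sum>a\<in>A. \<Sum>c\<in>C. s a b * t b c / r b) = (\<Sum>a\<in>A. s a b) * (\<Sum>c\<in>C. t b c) / r b"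
        by (simp add: sum_product sum_divide_distrib)
      then show "(\<Sum>a\<in>A. \<Sum>c\<in>C. s a b * t b c / r b) = r b"
        by (simp flip: rs rt)
    qed
    finally show ?thesis .
  qed
  have mass: "(\<Sum>a\<in>A. \<Sum>b\<in>B. \<Sum>c\<in>C. p (a, b, c)) = (\<Sum>b\<in>B. r b)"
    unfolding r_def by (rule sum.swap)
  have "(\<Sum>a\<in>A. \<Sum>b\<in>B. \<Sum>c\<in>C. p (a, b, c) * (ln (s a b) + ln (t b c) - ln (r b) - ln (p (a, b, c))))
      \<le> (\<Sum>a\<in>A. \<Sum>b\<in>B. \<Sum>c\<in>C. s a b * t b c / r b - p (a, b, c))"
    using pointwise by (intro sum_mono) auto
  also have "\<dots> = 0" by (simp add: sum_subtractf tot mass)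
  finally have main: "(\<Sum>a\<in>A. \<Sum>b\<in>B. \<Sum>c\<in>C. p (a, b, c) * ln (s a b))
     + (\<Sum>a\<in>A. \<Sum>b\<in>B. \<Sum>c\<in>C. p (a, b, c) * ln (t b c))
     - (\<Sum>a\<in>A. \<Sum>b\<in>B. \<Sum>c\<in>C. p (a, b, c) * ln (r b))
     - (\<Sum>a\<in>A. \<Sum>b\<in>B. \<Sum>c\<in>C. p (a, b, c) * ln (p (a, b, c))) \<le> 0"
    by (simp add: algebra_simps sum.distrib sum_subtractf)
  have e1: "fin_entropy (A \<times> B \<times> C) p
      = - (\<Sum>a\<in>A. \<Sum>b\<in>B. \<Sum>c\<in>C. p (a, b, c) * ln (p (a, b, c)))"
    by (simp add: fin_entropy_def sum.cartesian_product split_def)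
  have e2: "fin_entropy (A \<times> B) (\<lambda>(a, b). s a b)
      = - (\<Sum>a\<in>A. \<Sum>b\<in>B. \<Sum>c\<in>C. p (a, b, c) * ln (s a b))"
    by (simp add: fin_entropy_def sum.cartesian_product[symmetric] split_def s_def
        sum_distrib_right[symmetric])
      (simp add: sum.cartesian_product split_def)
  have e3: "fin_entropy (B \<times> C) (\<lambda>(b, c). t b c)
      = - (\<Sum>a\<in>A. \<Sum>b\<in>B. \<Sum>c\<in>C. p (a, b, c) * ln (t b c))"
  proof -
    have "(\<Sum>a\<in>A. \<Sum>b\<in>B. \<Sum>c\<in>C. p (a, b, c) * ln (t b c))
      = (\<Sum>b\<in>B. \<Sum>c\<in>C. \<Sum>a\<in>A. p (a, b, c) * ln (t b c))"
      by (subst sum.swap, rule sum.cong[OF refl], rule sum.swap)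
    also have "\<dots> = (\<Sum>b\<in>B. \<Sum>c\<in>C. t b c * ln (t b c))"
      by (simp add: t_def sum_distrib_right)
    also have "\<dots> = (\<Sum>(b, c)\<in>B \<times> C. t b c * ln (t b c))"
      by (rule sum.cartesian_product)
    finally show ?thesis by (simp add: fin_entropy_def split_def)
  qed
  have e4: "fin_entropy B r = - (\<Sum>a\<in>A. \<Sum>b\<in>B. \<Sum>c\<in>C. p (a, b, c) * ln (r b))"
  proof -
    have "(\<Sum>a\<in>A. \<Sum>b\<in>B. \<Sum>c\<in>C. p (a, b, c) * ln (r b)) = (\<Sum>b\<in>B. r b * ln (r b))"
      by (subst sum.swap) (simp add: r_def sum_distrib_right)
    then show ?thesis by (simp add: fin_entropy_def)
  qed
  show ?thesis
    using main e1 e2 e3 e4 unfolding r_def[abs_def] s_def t_def by linarith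
qed

section \<open>Disintegrated invariant measures\<close>

locale invariant_disintegration = continuous_bundle_rds P \<theta> T
  for P :: "'w measure" and \<theta> :: "'w \<Rightarrow> 'w" and T :: "'w \<Rightarrow> 'x::metric_space \<Rightarrow> 'x" +
  fixes \<mu> :: "('w \<times> 'x) measure" and \<kappa> :: "'w \<Rightarrow> 'x measure"
  assumes invariant: "\<mu> \<in> invariant_measures P \<theta> T"
    and disintegration: "disintegration P \<mu> \<kappa>"
begin

abbreviation PX :: "('w \<times> 'x) measure" where "PX \<equiv> P \<Otimes>\<^sub>M borel"

abbreviation \<Theta> :: "'w \<times> 'x \<Rightarrow> 'w \<times> 'x" where "\<Theta> \<equiv> skew_product \<theta> T"

lemma base_preserving: "measure_preserving_map P \<theta>"
  using base_ergodic by (simp add: ergodic_map_def)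

lemma base_measurable [measurable]: "\<theta> \<in> P \<rightarrow>\<^sub>M P"
  using base_preserving by (simp add: measure_preserving_map_def)

lemma base_funpow_measurable [measurable]: "(\<theta> ^^ i) \<in> P \<rightarrow>\<^sub>M P"
  using measure_preserving_map_funpow[OF base_preserving] by (simp add: measure_preserving_map_def)

lemma base_in_space [simp]: "\<omega> \<in> space P \<Longrightarrow> \<theta> \<omega> \<in> space P"
  using measurable_space[OF base_measurable] .

lemma base_funpow_in_space [simp]: "\<omega> \<in> space P \<Longrightarrow> (\<theta> ^^ i) \<omega> \<in> space P"
  using measurable_space[OF base_funpow_measurable] .

lemma sets_\<mu> [measurable_cong]: "sets \<mu> = sets PX"
  using invariant by (simp add: invariant_measures_def)

lemma space_\<mu>: "space \<mu> = space P \<times> UNIV"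
  using sets_eq_imp_space_eq[OF sets_\<mu>] by (simp add: space_pair_measure)

lemma prob_space_\<mu>: "prob_space \<mu>"
  using invariant by (simp add: invariant_measures_def)

lemma skew_preserving: "measure_preserving_map \<mu> \<Theta>"
  using invariant by (simp add: invariant_measures_def)

lemma skew_measurable [measurable]: "\<Theta> \<in> PX \<rightarrow>\<^sub>M PX"
  using skew_preserving measurable_cong_sets[OF sets_\<mu> sets_\<mu>]
  by (simp add: measure_preserving_map_def)

lemma skew_funpow_measurable [measurable]: "(\<Theta> ^^ i) \<in> PX \<rightarrow>\<^sub>M PX"
  using measure_preserving_map_funpow[OF skew_preserving, of i] measurable_cong_sets[OF sets_\<mu> sets_\<mu>]
  by (simp add: measure_preserving_map_def)

lemma skew_funpow: "(\<Theta> ^^ i) (\<omega>, x) = ((\<theta> ^^ i) \<omega>, rds_iter \<theta> T i \<omega> x)"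
  by (induction i) (auto simp: skew_product_def)

lemma kernel_measurable [measurable]: "\<kappa> \<in> P \<rightarrow>\<^sub>M subprob_algebra borel"
  using disintegration by (auto simp: disintegration_def intro: measurable_prob_algebraD)

lemma kernel_prob: "\<omega> \<in> space P \<Longrightarrow> prob_space (\<kappa> \<omega>)"
  using disintegration measurable_space[of \<kappa> P "prob_algebra borel"]
  by (auto simp: disintegration_def space_prob_algebra)

lemma kernel_sets: "\<omega> \<in> space P \<Longrightarrow> sets (\<kappa> \<omega>) = sets borel"
  using disintegration measurable_space[of \<kappa> P "prob_algebra borel"]
  by (auto simp: disintegration_def space_prob_algebra)

lemma kernel_space: "\<omega> \<in> space P \<Longrightarrow> space (\<kappa> \<omega>) = UNIV"
  using sets_eq_imp_space_eq[OF kernel_sets] by simp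

lemma emeasure_\<mu>: "S \<in> sets PX \<Longrightarrow> emeasure \<mu> S = (\<integral>\<^sup>+\<omega>. emeasure (\<kappa> \<omega>) (Pair \<omega> -` S) \<partial>P)"
  using disintegration by (simp add: disintegration_def)

lemma section_in_sets:
  "S \<in> sets PX \<Longrightarrow> \<omega> \<in> space P \<Longrightarrow> Pair \<omega> -` S \<in> sets (\<kappa> \<omega>)"
  by (simp add: kernel_sets)

lemma Sigma_sections: "S \<in> sets PX \<Longrightarrow> (SIGMA \<omega>:space P. Pair \<omega> -` S) = S"
  using sets.sets_into_space[of S PX] by (auto simp: space_pair_measure)

lemma emeasure_section_measurable [measurable]:
  assumes "S \<in> sets PX"
  shows "(\<lambda>\<omega>. emeasure (\<kappa> \<omega>) (Pair \<omega> -` S)) \<in> borel_measurable P"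
  using assms by (intro emeasure_measurable_subprob_algebra2[OF _ kernel_measurable])
    (simp add: Sigma_sections)

lemma measure_section_measurable [measurable]:
  assumes "S \<in> sets PX"
  shows "(\<lambda>\<omega>. measure (\<kappa> \<omega>) (Pair \<omega> -` S)) \<in> borel_measurable P"
  unfolding measure_def using emeasure_section_measurable[OF assms] by measurable

lemma measure_\<mu>:
  assumes "S \<in> sets PX"
  shows "measure \<mu> S = (\<integral>\<omega>. measure (\<kappa> \<omega>) (Pair \<omega> -` S) \<partial>P)"
proof -
  have "emeasure \<mu> S = (\<integral>\<^sup>+\<omega>. ennreal (measure (\<kappa> \<omega>) (Pair \<omega> -` S)) \<partial>P)"
    unfolding emeasure_\<mu>[OF assms]
    by (intro nn_integral_cong) (simp add: kernel_prob finite_measure.emeasure_eq_measure prob_space.finite_measure)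
  moreover have "(\<integral>\<omega>. measure (\<kappa> \<omega>) (Pair \<omega> -` S) \<partial>P)
      = enn2real (\<integral>\<^sup>+\<omega>. ennreal (measure (\<kappa> \<omega>) (Pair \<omega> -` S)) \<partial>P)"
    using assms by (intro integral_eq_nn_integral) auto
  ultimately show ?thesis by (simp add: measure_def)
qed

lemma AE_fibres:
  assumes "AE p in \<mu>. Q p"
  shows "AE \<omega> in P. AE x in \<kappa> \<omega>. Q (\<omega>, x)"
proof -
  obtain N where N: "{p \<in> space \<mu>. \<not> Q p} \<subseteq> N" "emeasure \<mu> N = 0" "N \<in> sets \<mu>"
    using AE_E[OF assms] by blast
  have NP: "N \<in> sets PX" using N sets_\<mu> by simp
  have "AE \<omega> in P. emeasure (\<kappa> \<omega>) (Pair \<omega> -` N) = 0"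
    using N(2) NP by (simp add: emeasure_\<mu> nn_integral_0_iff_AE)
  then show ?thesis using AE_space
  proof eventually_elim
    case (elim \<omega>)
    show ?case
    proof (rule AE_I)
      show "{x \<in> space (\<kappa> \<omega>). \<not> Q (\<omega>, x)} \<subseteq> Pair \<omega> -` N"
        using N(1) elim by (auto simp: space_\<mu>)
    qed (use elim section_in_sets[OF NP] in auto)
  qed
qed

lemma skew_vimage_in_sets: "S \<in> sets PX \<Longrightarrow> (\<Theta> ^^ i) -` S \<inter> space PX \<in> sets PX"
  using measurable_sets[OF skew_funpow_measurable] .

text \<open>For one set \<open>S\<close> at a time no countable generator of the Borel sets of the fibre enters.  The map \<open>\<theta>\<close> is inverted to
  test against an arbitrary measurable set of base points.\<close>
lemma kernel_equivariant_step:
  assumes S: "S \<in> sets PX"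
  shows "AE \<omega> in P. emeasure (\<kappa> \<omega>) {x. \<Theta> (\<omega>, x) \<in> S} = emeasure (\<kappa> (\<theta> \<omega>)) (Pair (\<theta> \<omega>) -` S)"
proof -
  define S' where "S' = \<Theta> -` S \<inter> space PX"
  have S' [measurable]: "S' \<in> sets PX"
    unfolding S'_def using S by measurable
  have sec: "{x. \<Theta> (\<omega>, x) \<in> S} = Pair \<omega> -` S'" if "\<omega> \<in> space P" for \<omega>
    using that by (auto simp: S'_def space_pair_measure)
  have "AE \<omega> in P. emeasure (\<kappa> \<omega>) (Pair \<omega> -` S') = emeasure (\<kappa> (\<theta> \<omega>)) (Pair (\<theta> \<omega>) -` S)"
  proof (rule density_unique_finite_measure)
    show "(\<lambda>\<omega>. emeasure (\<kappa> \<omega>) (Pair \<omega> -` S')) \<in> borel_measurable P" by measurable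
    show "(\<lambda>\<omega>. emeasure (\<kappa> (\<theta> \<omega>)) (Pair (\<theta> \<omega>) -` S)) \<in> borel_measurable P"
      using measurable_compose[OF base_measurable emeasure_section_measurable[OF S]] .
    fix A assume A [measurable]: "A \<in> sets P"
    define \<psi> where "\<psi> = the_inv_into (space P) \<theta>"
    have \<psi> [measurable]: "\<psi> \<in> P \<rightarrow>\<^sub>M P" unfolding \<psi>_def by (rule base_inv_measurable)
    have \<psi>\<theta>: "\<psi> (\<theta> \<omega>) = \<omega>" if "\<omega> \<in> space P" for \<omega>
      using that base_bij unfolding \<psi>_def by (intro the_inv_into_f_f) (auto simp: bij_betw_def)
    \<comment> \<open>This is the image of A under \<theta>, written as a preimage under the inverse
      to make it measurable.\<close>
    define A' where "A' = \<psi> -` A \<inter> space P"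
    have A' [measurable]: "A' \<in> sets P" unfolding A'_def by measurable
    have A'iff: "\<theta> \<omega> \<in> A' \<longleftrightarrow> \<omega> \<in> A" if "\<omega> \<in> space P" for \<omega>
      using that \<psi>\<theta> by (simp add: A'_def)
    have "(\<integral>\<^sup>+\<omega>. emeasure (\<kappa> \<omega>) (Pair \<omega> -` S') * indicator A \<omega> \<partial>P)
        = (\<integral>\<^sup>+\<omega>. emeasure (\<kappa> \<omega>) (Pair \<omega> -` (S' \<inter> A \<times> UNIV)) \<partial>P)"
      by (intro nn_integral_cong) (auto simp: indicator_def)
    also have "\<dots> = emeasure \<mu> (S' \<inter> A \<times> UNIV)"
      by (intro emeasure_\<mu>[symmetric] sets.Int S' pair_measureI) auto
    also have "S' \<inter> A \<times> UNIV = \<Theta> -` (S \<inter> A' \<times> UNIV) \<inter> space \<mu>"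
      using A'iff sets.sets_into_space[OF A]
      by (auto simp: S'_def space_\<mu> space_pair_measure skew_product_def)
    also have "emeasure \<mu> \<dots> = emeasure (distr \<mu> \<mu> \<Theta>) (S \<inter> A' \<times> UNIV)"
      using S skew_preserving
      by (intro emeasure_distr[symmetric])
        (auto simp: measure_preserving_map_def sets_\<mu> intro!: sets.Int pair_measureI)
    also have "distr \<mu> \<mu> \<Theta> = \<mu>" using skew_preserving by (simp add: measure_preserving_map_def)
    also have "emeasure \<mu> (S \<inter> A' \<times> UNIV)
        = (\<integral>\<^sup>+\<omega>. emeasure (\<kappa> \<omega>) (Pair \<omega> -` (S \<inter> A' \<times> UNIV)) \<partial>P)"
      using S by (intro emeasure_\<mu> sets.Int pair_measureI) auto
    also have "\<dots> = (\<integral>\<^sup>+\<omega>. emeasure (\<kappa> \<omega>) (Pair \<omega> -` S) * indicator A' \<omega> \<partial>P)"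
      by (intro nn_integral_cong) (auto simp: indicator_def)
    also have "\<dots> = (\<integral>\<^sup>+\<omega>. emeasure (\<kappa> \<omega>) (Pair \<omega> -` S) * indicator A' \<omega> \<partial>distr P P \<theta>)"
      using base_preserving by (simp add: measure_preserving_map_def)
    also have "\<dots> = (\<integral>\<^sup>+\<omega>. emeasure (\<kappa> (\<theta> \<omega>)) (Pair (\<theta> \<omega>) -` S) * indicator A' (\<theta> \<omega>) \<partial>P)"
      by (intro nn_integral_distr base_measurable)
        (unfold measurable_distr_eq1,
          intro borel_measurable_times_ennreal borel_measurable_indicator emeasure_section_measurable S A')
    also have "\<dots> = (\<integral>\<^sup>+\<omega>. emeasure (\<kappa> (\<theta> \<omega>)) (Pair (\<theta> \<omega>) -` S) * indicator A \<omega> \<partial>P)"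
      by (intro nn_integral_cong) (simp add: A'iff indicator_def)
    finally show "(\<integral>\<^sup>+\<omega>. emeasure (\<kappa> \<omega>) (Pair \<omega> -` S') * indicator A \<omega> \<partial>P)
      = (\<integral>\<^sup>+\<omega>. emeasure (\<kappa> (\<theta> \<omega>)) (Pair (\<theta> \<omega>) -` S) * indicator A \<omega> \<partial>P)" .
  qed auto
  then show ?thesis using AE_space by eventually_elim (simp add: sec)
qed

text \<open>The first step of the orbit is split off: the one-step case is applied to the preimage
  of S under \<open>\<Theta> ^^ i\<close>, and the null set of the induction hypothesis is pulled
  back along \<theta>, which preserves P.\<close>

lemma kernel_equivariant:
  assumes S: "S \<in> sets PX"
  shows "AE \<omega> in P. measure (\<kappa> \<omega>) {x. (\<Theta> ^^ i) (\<omega>, x) \<in> S}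
    = measure (\<kappa> ((\<theta> ^^ i) \<omega>)) (Pair ((\<theta> ^^ i) \<omega>) -` S)"
proof (induction i)
  case 0
  then show ?case by (simp add: vimage_def)
next
  case (Suc i)
  define S' where "S' = (\<Theta> ^^ i) -` S \<inter> space PX"
  have S': "S' \<in> sets PX" unfolding S'_def by (rule skew_vimage_in_sets[OF S])
  show ?case
    using kernel_equivariant_step[OF S'] measure_preserving_map_AE[OF base_preserving Suc] AE_space
  proof eventually_elim
    case (elim \<omega>)
    have "{x. (\<Theta> ^^ Suc i) (\<omega>, x) \<in> S} = {x. \<Theta> (\<omega>, x) \<in> S'}"
      using elim(3) by (auto simp: S'_def space_pair_measure funpow_swap1 skew_product_def)
    moreover have "Pair (\<theta> \<omega>) -` S' = {x. (\<Theta> ^^ i) (\<theta> \<omega>, x) \<in> S}"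
      using elim(3) by (auto simp: S'_def space_pair_measure)
    ultimately show ?case using elim by (simp add: measure_def funpow_swap1)
  qed
qed

end

section \<open>Names of orbits and their fibrewise entropies\<close>

definition words :: "'b set \<Rightarrow> nat \<Rightarrow> 'b list set" where
  "words Z n = {w. set w \<subseteq> Z \<and> length w = n}"

lemma finite_words: "finite Z \<Longrightarrow> finite (words Z n)"
  unfolding words_def by (rule finite_lists_length_eq)

lemma card_words: "finite Z \<Longrightarrow> card (words Z n) = card Z ^ n"
  unfolding words_def by (rule card_lists_length_eq)

lemma bij_betw_words_Cons: "bij_betw (\<lambda>(a, w). a # w) (Z \<times> words Z n) (words Z (Suc n))"
  by (rule bij_betwI[where g = "\<lambda>w. (hd w, tl w)"]) (auto simp: words_def length_Suc_conv)

lemma bij_betw_words_snoc: "bij_betw (\<lambda>(w, a). w @ [a]) (words Z n \<times> Z) (words Z (Suc n))"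
  by (rule bij_betwI[where g = "\<lambda>w. (butlast w, last w)"])
    (auto simp: words_def length_Suc_conv_rev)

lemma bij_betw_words_append:
  "bij_betw (\<lambda>(v, w). v @ w) (words Z m \<times> words Z n) (words Z (m + n))"
  by (rule bij_betwI[where g = "\<lambda>w. (take m w, drop m w)"])
    (auto simp: words_def dest: in_set_takeD in_set_dropD)

text \<open>A partition enters as the code \<open>atom \<zeta>\<close> with alphabet \<zeta>. Names
  are then lists over a fixed finite set, and the joins of sections with their dropped empty cells
  occur only in \<open>fibre_entropy_partition_eq_rate\<close>.\<close>

locale coded_disintegration = invariant_disintegration P \<theta> T \<mu> \<kappa>
  for P :: "'w measure" and \<theta> :: "'w \<Rightarrow> 'w" and T :: "'w \<Rightarrow> 'x::metric_space \<Rightarrow> 'x"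
    and \<mu> :: "('w \<times> 'x) measure" and \<kappa> :: "'w \<Rightarrow> 'x measure" +
  fixes c :: "'w \<times> 'x \<Rightarrow> 'b" and Z :: "'b set"
  assumes finite_Z [simp]: "finite Z"
    and code_measurable [measurable]: "c \<in> P \<Otimes>\<^sub>M borel \<rightarrow>\<^sub>M count_space Z"
begin

definition name :: "nat \<Rightarrow> 'w \<times> 'x \<Rightarrow> 'b list" where
  "name n p = map (\<lambda>i. c ((\<Theta> ^^ i) p)) [0..<n]"

lemma name_0 [simp]: "name 0 p = []"
  by (simp add: name_def)

lemma length_name [simp]: "length (name n p) = n"
  by (simp add: name_def)

lemma nth_name [simp]: "i < n \<Longrightarrow> name n p ! i = c ((\<Theta> ^^ i) p)"
  by (simp add: name_def)

lemma name_Suc: "name (Suc n) p = c p # name n (\<Theta> p)"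
  by (rule nth_equalityI) (auto simp: nth_Cons funpow_swap1 split: nat.splits)

lemma name_snoc: "name (Suc n) p = name n p @ [c ((\<Theta> ^^ n) p)]"
  by (simp add: name_def)

lemma name_append: "name (m + n) p = name m p @ name n ((\<Theta> ^^ m) p)"
  by (rule nth_equalityI) (auto simp: nth_append funpow_add[symmetric, THEN fun_cong, simplified])

lemma code_in_Z: "p \<in> space PX \<Longrightarrow> c p \<in> Z"
  using measurable_space[OF code_measurable] by simp

lemma name_in_words: "p \<in> space PX \<Longrightarrow> name n p \<in> words Z n"
proof -
  assume p: "p \<in> space PX"
  have "c ((\<Theta> ^^ i) p) \<in> Z" for i by (intro code_in_Z measurable_space[OF skew_funpow_measurable p])
  then show ?thesis by (auto simp: words_def name_def)
qed

lemma name_measurable [measurable]: "name n \<in> PX \<rightarrow>\<^sub>M count_space UNIV"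
proof (induction n)
  case (Suc n)
  have "name (Suc n) = (\<lambda>p. c p # name n (\<Theta> p))" by (simp add: name_Suc fun_eq_iff)
  moreover have "(\<lambda>p. (\<lambda>a p. a # name n (\<Theta> p)) (c p) p) \<in> PX \<rightarrow>\<^sub>M count_space UNIV"
  proof (rule measurable_compose_countable'[OF _ code_measurable])
    show "countable Z" by (simp add: countable_finite)
    show "(\<lambda>p. a # name n (\<Theta> p)) \<in> PX \<rightarrow>\<^sub>M count_space UNIV" for a
      using measurable_compose[OF measurable_compose[OF skew_measurable Suc], of "(#) a"] by simp
  qed
  ultimately show ?case by simp
qed (simp add: name_def[abs_def])

lemma name_set: "{p \<in> space PX. name n p = w} \<in> sets PX"
  by measurable

definition name_prob :: "nat \<Rightarrow> 'w \<Rightarrow> 'b list \<Rightarrow> real" where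
  "name_prob n \<omega> w = measure (\<kappa> \<omega>) {x. name n (\<omega>, x) = w}"

definition name_entropy :: "nat \<Rightarrow> 'w \<Rightarrow> real" where
  "name_entropy n \<omega> = fin_entropy (words Z n) (name_prob n \<omega>)"

lemma fibre_set_in_sets:
  assumes "\<omega> \<in> space P" "{p \<in> space PX. Q p} \<in> sets PX"
  shows "{x. Q (\<omega>, x)} \<in> sets (\<kappa> \<omega>)"
proof -
  have "Pair \<omega> -` {p \<in> space PX. Q p} = {x. Q (\<omega>, x)}"
    using assms(1) by (auto simp: space_pair_measure)
  then show ?thesis using section_in_sets[OF assms(2,1)] by simp
qed

lemma name_prob_measurable [measurable]: "(\<lambda>\<omega>. name_prob n \<omega> w) \<in> borel_measurable P"
proof (rule measurable_cong[THEN iffD1, rotated])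
  show "(\<lambda>\<omega>. measure (\<kappa> \<omega>) (Pair \<omega> -` {p \<in> space PX. name n p = w})) \<in> borel_measurable P"
    by (rule measure_section_measurable[OF name_set])
  show "measure (\<kappa> \<omega>) (Pair \<omega> -` {p \<in> space PX. name n p = w}) = name_prob n \<omega> w"
    if "\<omega> \<in> space P" for \<omega>
    using that by (simp add: name_prob_def vimage_def space_pair_measure)
qed

lemma name_entropy_measurable [measurable]: "name_entropy n \<in> borel_measurable P"
  unfolding name_entropy_def[abs_def] fin_entropy_def by measurable

lemma name_prob_nonneg: "0 \<le> name_prob n \<omega> w"
  by (simp add: name_prob_def)

lemma name_prob_le_1: "\<omega> \<in> space P \<Longrightarrow> name_prob n \<omega> w \<le> 1"
  unfolding name_prob_def by (intro prob_space.prob_le_1 kernel_prob)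

text \<open>Finite additivity in one fibre, phrased with predicates on the product space: their
  measurability there passes to all sections. It supplies every marginalisation of name
  probabilities below.\<close>

lemma sum_fibre_prob:
  assumes \<omega>: "\<omega> \<in> space P" and I: "finite I"
    and R: "\<And>i. i \<in> I \<Longrightarrow> {p \<in> space PX. R i p} \<in> sets PX" "{p \<in> space PX. Q p} \<in> sets PX"
    and ex1: "\<And>p i. p \<in> space PX \<Longrightarrow> i \<in> I \<Longrightarrow> R i p \<Longrightarrow> Q p"
      "\<And>p. p \<in> space PX \<Longrightarrow> Q p \<Longrightarrow> \<exists>!i\<in>I. R i p"
  shows "(\<Sum>i\<in>I. measure (\<kappa> \<omega>) {x. R i (\<omega>, x)}) = measure (\<kappa> \<omega>) {x. Q (\<omega>, x)}"
proof -
  interpret K: prob_space "\<kappa> \<omega>" by (rule kernel_prob[OF \<omega>])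
  have "K.prob {x \<in> space (\<kappa> \<omega>). Q (\<omega>, x)} = (\<Sum>i\<in>I. K.prob {x \<in> space (\<kappa> \<omega>). R i (\<omega>, x)})"
  proof (rule K.prob_sum[OF I])
    show "{x \<in> space (\<kappa> \<omega>). R i (\<omega>, x)} \<in> K.events" if "i \<in> I" for i
      using fibre_set_in_sets[OF \<omega> R(1)[OF that]] by (simp add: kernel_space \<omega>)
    show "{x \<in> space (\<kappa> \<omega>). Q (\<omega>, x)} \<in> K.events"
      using fibre_set_in_sets[OF \<omega> R(2)] by (simp add: kernel_space \<omega>)
    have "(\<omega>, x) \<in> space PX" for x using \<omega> by (simp add: space_pair_measure)
    then show "AE x in \<kappa> \<omega>. (\<forall>i\<in>I. R i (\<omega>, x) \<longrightarrow> Q (\<omega>, x)) \<and> (Q (\<omega>, x) \<longrightarrow> (\<exists>!i\<in>I. R i (\<omega>, x)))"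
      using ex1 by (intro AE_I2) blast
  qed
  then show ?thesis by (simp add: kernel_space \<omega>)
qed

lemma sum_name_prob: "\<omega> \<in> space P \<Longrightarrow> (\<Sum>w\<in>words Z n. name_prob n \<omega> w) = 1"
  using sum_fibre_prob[of \<omega> "words Z n" "\<lambda>w p. name n p = w" "\<lambda>_. True"] name_in_words[of _ n]
    prob_space.prob_space[OF kernel_prob, of \<omega>]
  by (auto simp: name_prob_def finite_words name_set kernel_space)

lemma name_entropy_nonneg: "\<omega> \<in> space P \<Longrightarrow> 0 \<le> name_entropy n \<omega>"
  unfolding name_entropy_def by (intro fin_entropy_nonneg) (auto simp: name_prob_nonneg name_prob_le_1)

lemma name_entropy_le: "\<omega> \<in> space P \<Longrightarrow> name_entropy n \<omega> \<le> n * ln (card Z)"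
proof -
  assume \<omega>: "\<omega> \<in> space P"
  have "name_entropy n \<omega> \<le> ln (card (words Z n))"
    unfolding name_entropy_def
    by (intro fin_entropy_le_ln_card) (auto simp: finite_words name_prob_nonneg sum_name_prob \<omega>)
  also have "(\<omega>, undefined) \<in> space PX" using \<omega> by (simp add: space_pair_measure)
  then have "card Z > 0" using code_in_Z by (auto simp: card_gt_0_iff)
  then have "ln (real (card (words Z n))) = n * ln (card Z)"
    by (simp add: card_words ln_realpow)
  finally show ?thesis .
qed

lemma name_entropy_0 [simp]: "\<omega> \<in> space P \<Longrightarrow> name_entropy 0 \<omega> = 0"
  using name_entropy_le[of \<omega> 0] name_entropy_nonneg[of \<omega> 0] by simp

lemma shifted_name_prob:
  "AE \<omega> in P. measure (\<kappa> \<omega>) {x. name n (\<Theta> (\<omega>, x)) = w} = name_prob n (\<theta> \<omega>) w"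
  using kernel_equivariant[OF name_set, of 1 n w] AE_space
proof eventually_elim
  case (elim \<omega>)
  have "\<Theta> (\<omega>, x) \<in> space PX" for x using elim(2) by (simp add: skew_product_def space_pair_measure)
  then show ?case using elim
    by (simp add: name_prob_def vimage_def space_pair_measure)
qed

lemma shifted_name_prob_all:
  "AE \<omega> in P. \<forall>n. \<forall>w\<in>words Z n.
    measure (\<kappa> \<omega>) {x. name n (\<Theta> (\<omega>, x)) = w} = name_prob n (\<theta> \<omega>) w"
  unfolding AE_all_countable
  by (intro allI AE_finite_allI finite_words finite_Z shifted_name_prob)

text \<open>Conditional entropy of the first letter given the following \<open>k\<close> letters.\<close>
definition entropy_increment :: "nat \<Rightarrow> 'w \<Rightarrow> real" where
  "entropy_increment k \<omega> = name_entropy (Suc k) \<omega> - name_entropy k (\<theta> \<omega>)"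

text \<open>Almost surely the letters after the first are distributed under
  \<open>\<kappa> \<omega>\<close> as names at \<open>\<theta> \<omega>\<close>. So
  \<open>name_entropy k (\<theta> \<omega>)\<close> is the entropy of a marginal of the first k + 1
  letters, which gives nonnegativity. Monotonicity says that conditioning on one more letter lowers
  entropy: strong subadditivity for the first letter, the k middle letters and the last letter of
  words of length k + 2.\<close>

lemma entropy_increment_bounds:
  "AE \<omega> in P. \<forall>k. 0 \<le> entropy_increment k \<omega> \<and> entropy_increment (Suc k) \<omega> \<le> entropy_increment k \<omega>"
  using shifted_name_prob_all AE_space
proof eventually_elim
  case (elim \<omega>)
  note \<omega> = elim(2)
  have shift: "measure (\<kappa> \<omega>) {x. name n (\<Theta> (\<omega>, x)) = w} = name_prob n (\<theta> \<omega>) w"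
    if "w \<in> words Z n" for n w using elim(1) that by blast
  have first_letter: "(\<Sum>a\<in>Z. name_prob (Suc n) \<omega> (a # w)) = name_prob n (\<theta> \<omega>) w" if "w \<in> words Z n" for n w
  proof -
    have "(\<Sum>a\<in>Z. measure (\<kappa> \<omega>) {x. name (Suc n) (\<omega>, x) = a # w})
      = measure (\<kappa> \<omega>) {x. name n (\<Theta> (\<omega>, x)) = w}"
    proof (rule sum_fibre_prob[OF \<omega> finite_Z name_set, where Q = "\<lambda>p. name n (\<Theta> p) = w"])
      show "{p \<in> space PX. name n (\<Theta> p) = w} \<in> sets PX" by measurable
    qed (auto simp: name_Suc code_in_Z)
    then show ?thesis using shift[OF that] by (simp add: name_prob_def)
  qed
  have last_letter: "(\<Sum>a\<in>Z. name_prob (Suc n) \<omega> (w @ [a])) = name_prob n \<omega> w" for n w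
    unfolding name_prob_def
  proof (rule sum_fibre_prob[OF \<omega> finite_Z name_set name_set])
    fix p assume "p \<in> space PX" "name n p = w"
    then show "\<exists>!i\<in>Z. name (Suc n) p = w @ [i]"
      using measurable_space[OF skew_funpow_measurable, of p n] by (auto simp: name_snoc code_in_Z)
  qed (auto simp: name_snoc)
  show ?case
  proof (intro allI conjI)
    fix k
    have "fin_entropy (words Z k) (name_prob k (\<theta> \<omega>))
      = fin_entropy (words Z k) (\<lambda>w. \<Sum>a\<in>Z. (\<lambda>(a, w). name_prob (Suc k) \<omega> (a # w)) (a, w))"
      by (intro fin_entropy_cong) (simp add: first_letter)
    also have "\<dots> \<le> fin_entropy (Z \<times> words Z k) (\<lambda>(a, w). name_prob (Suc k) \<omega> (a # w))"
      by (intro fin_entropy_marginal_le) (auto simp: name_prob_nonneg)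
    also have "\<dots> = fin_entropy (words Z (Suc k)) (name_prob (Suc k) \<omega>)"
      by (subst fin_entropy_reindex[OF bij_betw_words_Cons]) (simp add: case_prod_unfold)
    finally show "0 \<le> entropy_increment k \<omega>"
      by (simp add: entropy_increment_def name_entropy_def)
    define p where "p = (\<lambda>(a, w, b). name_prob (Suc (Suc k)) \<omega> (a # w @ [b]))"
    have bij3: "bij_betw (\<lambda>(a, w, b). a # w @ [b]) (Z \<times> words Z k \<times> Z) (words Z (Suc (Suc k)))"
      unfolding bij_betw_def
    proof (intro conjI equalityI subsetI)
      fix v assume "v \<in> words Z (Suc (Suc k))"
      then obtain a u where u: "v = a # u" "a \<in> Z" "u \<in> words Z (Suc k)"
        by (auto simp: words_def length_Suc_conv)
      then obtain w b where "u = w @ [b]" "b \<in> Z" "w \<in> words Z k"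
        by (auto simp: words_def length_Suc_conv_rev)
      with u show "v \<in> (\<lambda>(a, w, b). a # w @ [b]) ` (Z \<times> words Z k \<times> Z)"
        by force
    qed (auto simp: inj_on_def words_def)
    have "fin_entropy (Z \<times> words Z k \<times> Z) p + fin_entropy (words Z k) (\<lambda>w. \<Sum>a\<in>Z. \<Sum>b\<in>Z. p (a, w, b))
        \<le> fin_entropy (Z \<times> words Z k) (\<lambda>(a, w). \<Sum>b\<in>Z. p (a, w, b))
          + fin_entropy (words Z k \<times> Z) (\<lambda>(w, b). \<Sum>a\<in>Z. p (a, w, b))"
      by (intro fin_entropy_strong_subadditive) (auto simp: p_def name_prob_nonneg finite_words)
    moreover have "fin_entropy (Z \<times> words Z k \<times> Z) p = name_entropy (Suc (Suc k)) \<omega>"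
      unfolding name_entropy_def fin_entropy_reindex[OF bij3] p_def by (simp add: case_prod_unfold)
    moreover have "fin_entropy (words Z k) (\<lambda>w. \<Sum>a\<in>Z. \<Sum>b\<in>Z. p (a, w, b)) = name_entropy k (\<theta> \<omega>)"
      unfolding name_entropy_def
    proof (rule fin_entropy_cong)
      fix w assume w: "w \<in> words Z k"
      have "(\<Sum>b\<in>Z. p (a, w, b)) = name_prob (Suc k) \<omega> (a # w)" for a
        using last_letter[of "Suc k" "a # w"] by (simp add: p_def)
      then show "(\<Sum>a\<in>Z. \<Sum>b\<in>Z. p (a, w, b)) = name_prob k (\<theta> \<omega>) w"
        using first_letter[OF w] by simp
    qed
    moreover have "fin_entropy (Z \<times> words Z k) (\<lambda>(a, w). \<Sum>b\<in>Z. p (a, w, b)) = name_entropy (Suc k) \<omega>"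
      unfolding name_entropy_def fin_entropy_reindex[OF bij_betw_words_Cons]
      using last_letter[of "Suc k" "_ # _"] by (simp add: p_def case_prod_unfold)
    moreover have "fin_entropy (words Z k \<times> Z) (\<lambda>(w, b). \<Sum>a\<in>Z. p (a, w, b))
        = name_entropy (Suc k) (\<theta> \<omega>)"
      unfolding name_entropy_def fin_entropy_reindex[OF bij_betw_words_snoc]
    proof (rule fin_entropy_cong, clarify)
      fix w b assume "w \<in> words Z k" "b \<in> Z"
      then have "w @ [b] \<in> words Z (Suc k)" by (simp add: words_def)
      then show "(\<Sum>a\<in>Z. p (a, w, b)) = name_prob (Suc k) (\<theta> \<omega>) (w @ [b])"
        using first_letter by (simp add: p_def)
    qed
    ultimately show "entropy_increment (Suc k) \<omega> \<le> entropy_increment k \<omega>"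
      by (simp add: entropy_increment_def)
  qed
qed

end

section \<open>The entropy rate\<close>

lemma Cesaro_mean_tendsto:
  fixes u :: "nat \<Rightarrow> real"
  assumes "u \<longlonglongrightarrow> L"
  shows "(\<lambda>n. 1 / real n * (\<Sum>k<n. u k)) \<longlonglongrightarrow> L"
proof (rule LIMSEQ_I)
  fix e :: real assume e: "e > 0"
  obtain N where N: "\<And>k. k \<ge> N \<Longrightarrow> norm (u k - L) < e / 2"
    using LIMSEQ_D[OF assms, of "e / 2"] e by auto
  define C where "C = (\<Sum>k<N. \<bar>u k - L\<bar>)"
  obtain m :: nat where m: "real m > 2 * C / e" using reals_Archimedean2 by blast
  show "\<exists>n0. \<forall>n\<ge>n0. norm (1 / real n * (\<Sum>k<n. u k) - L) < e"
  proof (intro exI[of _ "max (max N m) 1"] allI impI)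
    fix n assume n: "max (max N m) 1 \<le> n"
    have "\<bar>\<Sum>k<n. u k - L\<bar> \<le> (\<Sum>k<n. \<bar>u k - L\<bar>)" by (rule sum_abs)
    also have "\<dots> = C + (\<Sum>k\<in>{N..<n}. \<bar>u k - L\<bar>)"
      unfolding C_def using n
      by (subst sum.union_disjoint[symmetric]) (auto intro!: sum.cong)
    also have "\<dots> \<le> C + (\<Sum>k\<in>{N..<n}. e / 2)"
      using N by (intro add_left_mono sum_mono) (auto intro: less_imp_le)
    also have "\<dots> \<le> C + real n * (e / 2)" using e by (simp add: mult_right_mono)
    also have "C < real n * (e / 2)"
    proof -
      have "2 * C / e < real n" using m n by linarith
      then show ?thesis using e by (simp add: divide_simps)
    qed
    finally have "\<bar>\<Sum>k<n. u k - L\<bar> < e * real n" by (simp add: mult.commute)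
    moreover have "1 / real n * (\<Sum>k<n. u k) - L = (\<Sum>k<n. u k - L) / real n"
      using n by (simp add: sum_subtractf divide_simps)
    ultimately show "norm (1 / real n * (\<Sum>k<n. u k) - L) < e"
      using n by (simp add: divide_simps)
  qed
qed

context coded_disintegration
begin

text \<open>The rate is read off from the conditional entropies, since their pointwise limit is the
  function to which the ergodic theorem is applied. \<open>mean_name_entropy_tendsto\<close>
  recovers the usual normalised limit.\<close>

definition entropy_rate :: real where
  "entropy_rate = lim (\<lambda>k. \<integral>\<omega>. entropy_increment k \<omega> \<partial>P)"

lemma entropy_increment_measurable [measurable]: "entropy_increment k \<in> borel_measurable P"
  unfolding entropy_increment_def[abs_def] by measurable

lemma name_entropy_integrable: "integrable P (name_entropy n)"
  using name_entropy_nonneg name_entropy_le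
  by (intro integrable_const_bound[where B = "n * ln (card Z)"]) (auto simp: abs_of_nonneg)

lemma shifted_name_entropy_integrable: "integrable P (\<lambda>\<omega>. name_entropy n (\<theta> \<omega>))"
  using name_entropy_nonneg name_entropy_le
  by (intro integrable_const_bound[where B = "n * ln (card Z)"])
    (auto simp: abs_of_nonneg intro: measurable_compose)

lemma integral_entropy_increment:
  "(\<integral>\<omega>. entropy_increment k \<omega> \<partial>P) = (\<integral>\<omega>. name_entropy (Suc k) \<omega> \<partial>P) - (\<integral>\<omega>. name_entropy k \<omega> \<partial>P)"
  unfolding entropy_increment_def
  by (simp add: name_entropy_integrable shifted_name_entropy_integrable
      measure_preserving_map_integral[OF base_preserving])

lemma entropy_increment_le:
  "AE \<omega> in P. \<forall>k. entropy_increment k \<omega> \<le> ln (card Z)"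
  using entropy_increment_bounds AE_space
proof eventually_elim
  case (elim \<omega>)
  have "entropy_increment k \<omega> \<le> entropy_increment 0 \<omega>" for k
    using elim(1) by (induction k) (auto intro: order_trans)
  moreover have "entropy_increment 0 \<omega> \<le> ln (card Z)"
    using name_entropy_le[of \<omega> 1] elim(2) by (simp add: entropy_increment_def)
  ultimately show ?case by (auto intro: order_trans)
qed

lemma entropy_increment_lim:
  "AE \<omega> in P. (\<lambda>k. entropy_increment k \<omega>) \<longlonglongrightarrow> lim (\<lambda>k. entropy_increment k \<omega>) \<and>
     (\<forall>k. lim (\<lambda>k. entropy_increment k \<omega>) \<le> entropy_increment k \<omega>)"
  using entropy_increment_bounds
proof eventually_elim
  case (elim \<omega>)
  have dec: "decseq (\<lambda>k. entropy_increment k \<omega>)"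
    using elim by (intro decseq_SucI) auto
  obtain L where L: "(\<lambda>k. entropy_increment k \<omega>) \<longlonglongrightarrow> L"
    using decseq_convergent[OF dec, of 0] elim by metis
  then show ?case using decseq_ge[OF dec L] limI[OF L] by auto
qed

lemma integral_entropy_increment_tendsto:
  "(\<lambda>k. \<integral>\<omega>. entropy_increment k \<omega> \<partial>P) \<longlonglongrightarrow> (\<integral>\<omega>. lim (\<lambda>k. entropy_increment k \<omega>) \<partial>P)"
proof (rule integral_dominated_convergence[where w = "\<lambda>_. ln (card Z)"])
  show "AE \<omega> in P. norm (entropy_increment k \<omega>) \<le> ln (card Z)" for k
    using entropy_increment_le entropy_increment_bounds by eventually_elim auto
  show "AE \<omega> in P. (\<lambda>k. entropy_increment k \<omega>) \<longlonglongrightarrow> lim (\<lambda>k. entropy_increment k \<omega>)"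
    using entropy_increment_lim by eventually_elim auto
qed (auto intro: borel_measurable_lim_metric)

lemma entropy_rate_eq: "entropy_rate = (\<integral>\<omega>. lim (\<lambda>k. entropy_increment k \<omega>) \<partial>P)"
  unfolding entropy_rate_def by (rule limI[OF integral_entropy_increment_tendsto])

text \<open>As \<theta> preserves P, the means of the increments are differences of successive mean
  entropies. They telescope, and the normalised entropies are Cesaro means of a convergent
  sequence.\<close>

lemma mean_name_entropy_tendsto:
  "(\<lambda>n. 1 / real n * (\<integral>\<omega>. name_entropy n \<omega> \<partial>P)) \<longlonglongrightarrow> entropy_rate"
proof -
  have "(\<integral>\<omega>. name_entropy n \<omega> \<partial>P) = (\<Sum>k<n. \<integral>\<omega>. entropy_increment k \<omega> \<partial>P)" for n
  proof (induction n)
    case 0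
    have "(\<integral>\<omega>. name_entropy 0 \<omega> \<partial>P) = (\<integral>\<omega>. 0 \<partial>P)"
      by (rule Bochner_Integration.integral_cong) simp_all
    then show ?case by simp
  qed (simp add: integral_entropy_increment)
  then show ?thesis
    using Cesaro_mean_tendsto[OF integral_entropy_increment_tendsto] by (simp add: entropy_rate_eq)
qed

text \<open>Unfolding the increments writes \<open>name_entropy n \<omega>\<close> as the sum over i
  < n of the increment of order n - 1 - i at \<open>(\<theta> ^^ i) \<omega>\<close>. The order
  varies with i, so this is no Birkhoff sum; but each increment is at least its limit g at that
  point, and the sum of g is one. The inequality needed here is the one that decreasing increments
  provide.\<close>

lemma name_entropy_eventually_ge:
  assumes "b < entropy_rate"
  shows "AE \<omega> in P. \<forall>\<^sub>F n in sequentially. b * real n \<le> name_entropy n \<omega>"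
proof -
  \<comment> \<open>The limit lies between 0 and ln (card Z) only almost everywhere, whereas
    \<open>birkhoff_lower\<close> asks for a bound at every point; hence the truncation.\<close>
  define g where "g \<omega> = max 0 (min (ln (card Z)) (lim (\<lambda>k. entropy_increment k \<omega>)))" for \<omega>
  have lim_m [measurable]: "(\<lambda>\<omega>. lim (\<lambda>k. entropy_increment k \<omega>)) \<in> borel_measurable P"
    by (intro borel_measurable_lim_metric) measurable
  have gm [measurable]: "g \<in> borel_measurable P"
    unfolding g_def[abs_def] by measurable
  have g_lim: "AE \<omega> in P. g \<omega> = lim (\<lambda>k. entropy_increment k \<omega>)"
    using entropy_increment_lim entropy_increment_bounds entropy_increment_le
  proof eventually_elim
    case (elim \<omega>)
    have "0 \<le> lim (\<lambda>k. entropy_increment k \<omega>)"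
      using elim by (intro LIMSEQ_le_const[OF conjunct1[OF elim(1)]]) auto
    moreover have "lim (\<lambda>k. entropy_increment k \<omega>) \<le> ln (card Z)"
      using elim by (meson order_trans)
    ultimately show ?case by (simp add: g_def)
  qed
  have "(\<integral>\<omega>. g \<omega> \<partial>P) = entropy_rate"
    unfolding entropy_rate_eq by (intro integral_cong_AE g_lim) measurable
  then have "AE \<omega> in P. \<forall>\<^sub>F n in sequentially. b * real n \<le> birkhoff_sum \<theta> g n \<omega>"
    using assms by (intro birkhoff_lower[OF prob_space_axioms base_ergodic gm, where B = "\<bar>ln (card Z)\<bar>"])
      (auto simp: g_def)
  moreover have "AE \<omega> in P. \<forall>k. g \<omega> \<le> entropy_increment k \<omega>"
    using entropy_increment_lim g_lim by eventually_elim auto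
  note measure_preserving_map_AE_funpow[OF base_preserving this]
  ultimately show ?thesis using AE_space
  proof eventually_elim
    case (elim \<omega>)
    have "birkhoff_sum \<theta> g n \<omega>' \<le> name_entropy n \<omega>'"
      if "\<omega>' \<in> space P" "\<forall>i k. g ((\<theta> ^^ i) \<omega>') \<le> entropy_increment k ((\<theta> ^^ i) \<omega>')" for n \<omega>'
      using that
    proof (induction n arbitrary: \<omega>')
      case (Suc n)
      have "\<forall>i k. g ((\<theta> ^^ i) (\<theta> \<omega>')) \<le> entropy_increment k ((\<theta> ^^ i) (\<theta> \<omega>'))"
      proof (intro allI)
        fix i k
        show "g ((\<theta> ^^ i) (\<theta> \<omega>')) \<le> entropy_increment k ((\<theta> ^^ i) (\<theta> \<omega>'))"
          using Suc.prems(2)[rule_format, of "Suc i" k] by (simp add: funpow_swap1)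
      qed
      then have "birkhoff_sum \<theta> g n (\<theta> \<omega>') \<le> name_entropy n (\<theta> \<omega>')"
        using Suc by simp
      moreover have "g \<omega>' \<le> entropy_increment n \<omega>'"
        using Suc.prems(2)[rule_format, of 0 n] by simp
      ultimately show ?case by (simp add: birkhoff_sum_Suc_shift entropy_increment_def)
    qed simp
    then show ?case
      using elim by (auto elim!: eventually_mono intro: order_trans)
  qed
qed

end

section \<open>Finite partitions as codes\<close>

definition atom :: "'a set set \<Rightarrow> 'a \<Rightarrow> 'a set" where
  "atom \<zeta> p = (THE A. A \<in> \<zeta> \<and> p \<in> A)"

lemma atom_eqI:
  assumes "partition_on S \<zeta>" "A \<in> \<zeta>" "p \<in> A"
  shows "atom \<zeta> p = A"
  unfolding atom_def
  using assms by (intro the_equality) (auto simp: partition_on_def disjoint_def)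

lemma atom_in:
  assumes "partition_on S \<zeta>" "p \<in> S"
  shows "atom \<zeta> p \<in> \<zeta>" "p \<in> atom \<zeta> p"
proof -
  obtain A where "A \<in> \<zeta>" "p \<in> A" using assms by (auto simp: partition_on_def)
  then show "atom \<zeta> p \<in> \<zeta>" "p \<in> atom \<zeta> p" using atom_eqI[OF assms(1)] by auto
qed

context invariant_disintegration
begin

lemma coded_disintegration_atom:
  assumes "finite_measurable_partition PX \<zeta>"
  shows "coded_disintegration P \<theta> T \<mu> \<kappa> (atom \<zeta>) \<zeta>"
proof unfold_locales
  have part: "finite \<zeta>" "\<zeta> \<subseteq> sets PX" "partition_on (space PX) \<zeta>"
    using assms by (auto simp: finite_measurable_partition_def)
  then show "finite \<zeta>" by simp
  show "atom \<zeta> \<in> PX \<rightarrow>\<^sub>M count_space \<zeta>"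
    unfolding measurable_count_space_eq2[OF part(1)]
  proof (intro conjI ballI)
    show "atom \<zeta> \<in> space PX \<rightarrow> \<zeta>" using atom_in(1)[OF part(3)] by blast
    fix A assume A: "A \<in> \<zeta>"
    have "A \<subseteq> space PX" using A part(3) by (auto simp: partition_on_def)
    then have "p \<in> atom \<zeta> -` {A} \<inter> space PX \<longleftrightarrow> p \<in> A" for p
      using atom_in(2)[OF part(3), of p] atom_eqI[OF part(3) A, of p] by blast
    then have "atom \<zeta> -` {A} \<inter> space PX = A" by blast
    then show "atom \<zeta> -` {A} \<inter> space PX \<in> sets PX" using A part(2) by auto
  qed
qed

text \<open>The cells of the join are exactly the nonempty name classes \<open>L w\<close>: a cell
  is the class of the name of any of its points. Different words have disjoint classes, so no two
  nonempty ones coincide, and words with empty class contribute 0 to the entropy.\<close>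

lemma fibre_entropy_partition_eq_rate:
  assumes \<zeta>: "finite_measurable_partition PX \<zeta>"
  shows "fibre_entropy_partition P \<theta> T \<kappa> \<zeta>
    = coded_disintegration.entropy_rate P \<theta> T \<kappa> (atom \<zeta>) \<zeta>"
proof -
  interpret coded_disintegration P \<theta> T \<mu> \<kappa> "atom \<zeta>" \<zeta>
    by (rule coded_disintegration_atom[OF \<zeta>])
  have part: "partition_on (space PX) \<zeta>" using \<zeta> by (simp add: finite_measurable_partition_def)
  have eq: "partition_entropy (\<kappa> \<omega>)
      (partition_join n (\<lambda>i. partition_vimage (rds_iter \<theta> T i \<omega>) (partition_section \<zeta> ((\<theta> ^^ i) \<omega>))))
      = name_entropy n \<omega>" (is "partition_entropy _ ?J = _") if \<omega>: "\<omega> \<in> space P" for n \<omega>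
  proof -
    define L where "L w = {x. name n (\<omega>, x) = w}" for w
    have sp: "(\<Theta> ^^ i) (\<omega>, x) \<in> space PX" for i x
      using \<omega> by (intro measurable_space[OF skew_funpow_measurable]) (simp add: space_pair_measure)
    have iff: "(\<Theta> ^^ i) (\<omega>, x) \<in> A \<longleftrightarrow> atom \<zeta> ((\<Theta> ^^ i) (\<omega>, x)) = A" if "A \<in> \<zeta>" for i x A
      using atom_in(2)[OF part sp[of i x]] atom_eqI[OF part that, of "(\<Theta> ^^ i) (\<omega>, x)"] by metis
    have L_iff: "x \<in> L (name n (\<omega>, x0)) \<longleftrightarrow>
        (\<forall>i<n. atom \<zeta> ((\<Theta> ^^ i) (\<omega>, x)) = atom \<zeta> ((\<Theta> ^^ i) (\<omega>, x0)))" for x x0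
      unfolding L_def by (auto simp: list_eq_iff_nth_eq)
    have J: "?J = L ` {w \<in> words \<zeta> n. L w \<noteq> {}}"
    proof (intro equalityI subsetI)
      fix B assume "B \<in> ?J"
      then obtain g where B: "B = (\<Inter>i<n. g i)" "B \<noteq> {}"
        and g: "\<forall>i<n. g i \<in> partition_vimage (rds_iter \<theta> T i \<omega>) (partition_section \<zeta> ((\<theta> ^^ i) \<omega>))"
        unfolding partition_join_def by (elim DiffE CollectE exE conjE) simp
      have "\<exists>A\<in>\<zeta>. g i = {x. (\<Theta> ^^ i) (\<omega>, x) \<in> A}" if i: "i < n" for i
      proof -
        obtain S where S: "S \<in> partition_section \<zeta> ((\<theta> ^^ i) \<omega>)" "g i = rds_iter \<theta> T i \<omega> -` S"
          using g[rule_format, OF i] unfolding partition_vimage_def by (elim DiffE imageE)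
        moreover obtain A where "A \<in> \<zeta>" "S = Pair ((\<theta> ^^ i) \<omega>) -` A"
          using S(1) unfolding partition_section_def by (elim DiffE imageE)
        ultimately have "A \<in> \<zeta>" "g i = {x. (\<Theta> ^^ i) (\<omega>, x) \<in> A}"
          by (simp_all add: skew_funpow vimage_def)
        then show ?thesis by blast
      qed
      then obtain A where A: "\<forall>i<n. A i \<in> \<zeta> \<and> g i = {x. (\<Theta> ^^ i) (\<omega>, x) \<in> A i}"
        by metis
      have memB: "x \<in> B \<longleftrightarrow> (\<forall>i<n. atom \<zeta> ((\<Theta> ^^ i) (\<omega>, x)) = A i)" for x
      proof -
        have "x \<in> g i \<longleftrightarrow> atom \<zeta> ((\<Theta> ^^ i) (\<omega>, x)) = A i" if "i < n" for i
          using A[rule_format, OF that] iff[of "A i" i x] by (simp only: mem_Collect_eq)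
        moreover have "x \<in> B \<longleftrightarrow> (\<forall>i<n. x \<in> g i)" unfolding B(1) by blast
        ultimately show ?thesis by simp
      qed
      obtain x0 where x0: "x0 \<in> B" using B(2) by blast
      have "x \<in> B \<longleftrightarrow> x \<in> L (name n (\<omega>, x0))" for x
        using L_iff[of x x0] memB[of x] memB[of x0] x0 by metis
      then have "B = L (name n (\<omega>, x0))" by blast
      moreover have "name n (\<omega>, x0) \<in> words \<zeta> n"
        using \<omega> by (intro name_in_words) (simp add: space_pair_measure)
      ultimately show "B \<in> L ` {w \<in> words \<zeta> n. L w \<noteq> {}}"
        using B(2) by (intro image_eqI[of B L "name n (\<omega>, x0)"]) simp_all
    next
      fix B assume "B \<in> L ` {w \<in> words \<zeta> n. L w \<noteq> {}}"
      then obtain x0 where x0: "B = L (name n (\<omega>, x0))" unfolding L_def by auto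
      define g where "g i = {x. (\<Theta> ^^ i) (\<omega>, x) \<in> atom \<zeta> ((\<Theta> ^^ i) (\<omega>, x0))}" for i
      have at: "atom \<zeta> ((\<Theta> ^^ i) (\<omega>, x0)) \<in> \<zeta>" "(\<Theta> ^^ i) (\<omega>, x0) \<in> atom \<zeta> ((\<Theta> ^^ i) (\<omega>, x0))" for i
        using atom_in[OF part sp] by auto
      have "g i \<in> partition_vimage (rds_iter \<theta> T i \<omega>) (partition_section \<zeta> ((\<theta> ^^ i) \<omega>))" for i
      proof -
        define S where "S = Pair ((\<theta> ^^ i) \<omega>) -` atom \<zeta> ((\<Theta> ^^ i) (\<omega>, x0))"
        have "g i = rds_iter \<theta> T i \<omega> -` S" by (auto simp: g_def S_def skew_funpow)
        moreover have "x0 \<in> g i" using at by (simp add: g_def)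
        moreover have "S \<in> (\<lambda>A. Pair ((\<theta> ^^ i) \<omega>) -` A) ` \<zeta>" using at(1) by (auto simp: S_def)
        ultimately show ?thesis unfolding partition_vimage_def partition_section_def by auto
      qed
      moreover have "B = (\<Inter>i<n. g i)"
      proof (rule set_eqI)
        fix x
        have "x \<in> g i \<longleftrightarrow> atom \<zeta> ((\<Theta> ^^ i) (\<omega>, x)) = atom \<zeta> ((\<Theta> ^^ i) (\<omega>, x0))" for i
          unfolding g_def mem_Collect_eq by (rule iff[OF at(1)])
        then show "x \<in> B \<longleftrightarrow> x \<in> (\<Inter>i<n. g i)"
          unfolding x0 L_iff by auto
      qed
      moreover have "x0 \<in> B" by (simp add: x0 L_def)
      ultimately show "B \<in> ?J" unfolding partition_join_def by blast
    qed
    have "partition_entropy (\<kappa> \<omega>) ?J = - (\<Sum>w\<in>{w \<in> words \<zeta> n. L w \<noteq> {}}. measure (\<kappa> \<omega>) (L w) * ln (measure (\<kappa> \<omega>) (L w)))"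
      unfolding J partition_entropy_def
      by (subst sum.reindex) (auto simp: inj_on_def L_def)
    also have "\<dots> = - (\<Sum>w\<in>words \<zeta> n. measure (\<kappa> \<omega>) (L w) * ln (measure (\<kappa> \<omega>) (L w)))"
      by (intro arg_cong[of _ _ uminus] sum.mono_neutral_left) (auto simp: finite_words)
    finally show ?thesis by (simp add: name_entropy_def fin_entropy_def name_prob_def L_def)
  qed
  have "(\<integral>\<omega>. partition_entropy (\<kappa> \<omega>)
      (partition_join n (\<lambda>i. partition_vimage (rds_iter \<theta> T i \<omega>) (partition_section \<zeta> ((\<theta> ^^ i) \<omega>)))) \<partial>P)
      = (\<integral>\<omega>. name_entropy n \<omega> \<partial>P)" for n
    by (intro Bochner_Integration.integral_cong eq) auto
  then show ?thesis
    unfolding fibre_entropy_partition_def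
    using limI[OF mean_name_entropy_tendsto] by simp
qed

end

section \<open>Feldman-Katok balls\<close>

text \<open>Removes the infimum and the maximum from the metric: an infimum is below \<epsilon> iff
  some admissible e is, and a maximum exceeds a number iff some match does. Later arguments see the
  metric only in this form.\<close>

lemma fk_dist_less_iff:
  assumes "n > 0"
  shows "fk_dist \<theta> T \<omega> n x y < \<epsilon> \<longleftrightarrow>
    (\<exists>e D \<pi>. 0 < e \<and> e < \<epsilon> \<and> fk_match \<theta> T \<omega> n e x y D \<pi> \<and> real n * (1 - e) < real (card D))"
proof -
  define C where "C e = {card D | D \<pi>. fk_match \<theta> T \<omega> n e x y D \<pi>}" for e
  have "C e \<subseteq> {..n}" for e
    using card_mono[of "{..<n}"] by (auto simp: C_def fk_match_def)
  then have fin: "finite (C e)" for e by (rule finite_subset) simp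
  have "fk_match \<theta> T \<omega> n e x y {} id" for e by (simp add: fk_match_def strict_mono_on_def)
  then have "C e \<noteq> {}" for e by (auto simp: C_def)
  then have Max_iff: "r < real (Max (C e)) \<longleftrightarrow> (\<exists>k\<in>C e. r < real k)" for r e
    using Max_in[OF fin, of e] Max_ge[OF fin, of _ e] by (meson less_le_trans of_nat_le_iff)
  have bar: "fk_bar \<theta> T \<omega> n e x y < e \<longleftrightarrow>
      (\<exists>D \<pi>. fk_match \<theta> T \<omega> n e x y D \<pi> \<and> real n * (1 - e) < real (card D))" for e
  proof -
    have "fk_bar \<theta> T \<omega> n e x y < e \<longleftrightarrow> real n * (1 - e) < real (Max (C e))"
      unfolding fk_bar_def C_def using assms by (simp add: field_simps)
    also have "\<dots> \<longleftrightarrow> (\<exists>D \<pi>. fk_match \<theta> T \<omega> n e x y D \<pi> \<and> real n * (1 - e) < real (card D))"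
      unfolding Max_iff by (auto simp: C_def)
    finally show ?thesis .
  qed
  \<comment> \<open>\<open>fk_bar\<close> is at most 1, so 2 is admissible and the infimum runs over
    a nonempty set.\<close>
  have "fk_bar \<theta> T \<omega> n 2 x y < 2"
    unfolding fk_bar_def using assms
    by (smt (verit) mult_nonneg_nonneg of_nat_0_le_iff divide_nonneg_nonneg)
  then have "{\<epsilon>. \<epsilon> > 0 \<and> fk_bar \<theta> T \<omega> n \<epsilon> x y < \<epsilon>} \<noteq> {}" by force
  moreover have "bdd_below {\<epsilon>. \<epsilon> > 0 \<and> fk_bar \<theta> T \<omega> n \<epsilon> x y < \<epsilon>}"
    by (rule bdd_belowI[of _ 0]) auto
  ultimately show ?thesis
    unfolding fk_dist_def by (subst cInf_less_iff) (auto simp: bar)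
qed

lemma fk_ball_mono: "\<epsilon> \<le> \<epsilon>' \<Longrightarrow> fk_ball \<theta> T \<omega> n x \<epsilon> \<subseteq> fk_ball \<theta> T \<omega> n x \<epsilon>'"
  by (auto simp: fk_ball_def)

text \<open>For a fixed match (e, D, \<pi>) the condition on y is a finite intersection of open
  conditions, and the ball is the union over all matches that are long enough. Openness makes balls
  Borel and permits the use of compactness.\<close>

lemma fk_ball_open:
  assumes "n > 0" and cont: "\<And>i. continuous_on UNIV (rds_iter \<theta> T i \<omega>)"
  shows "open (fk_ball \<theta> T \<omega> n x \<epsilon>)"
proof -
  define M where "M e D \<pi> = {y. \<forall>i\<in>D. dist (rds_iter \<theta> T i \<omega> x) (rds_iter \<theta> T (\<pi> i) \<omega> y) < e}"
    for e and D :: "nat set" and \<pi> :: "nat \<Rightarrow> nat"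
  define A where "A = {(e, D, \<pi>). 0 < e \<and> e < \<epsilon> \<and> D \<subseteq> {..<n} \<and> \<pi> ` D \<subseteq> {..<n} \<and>
    strict_mono_on D \<pi> \<and> real n * (1 - e) < real (card D)}"
  have "open (M e D \<pi>)" if "finite D" for e D \<pi>
  proof -
    have "open {y. dist (rds_iter \<theta> T i \<omega> x) (rds_iter \<theta> T (\<pi> i) \<omega> y) < e}" for i
      using cont by (intro open_Collect_less continuous_intros)
    then have "open (\<Inter>i\<in>D. {y. dist (rds_iter \<theta> T i \<omega> x) (rds_iter \<theta> T (\<pi> i) \<omega> y) < e})"
      using that by (intro open_INT) auto
    moreover have "M e D \<pi> = (\<Inter>i\<in>D. {y. dist (rds_iter \<theta> T i \<omega> x) (rds_iter \<theta> T (\<pi> i) \<omega> y) < e})"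
      by (auto simp: M_def)
    ultimately show ?thesis by simp
  qed
  then have "open (\<Union>(e, D, \<pi>)\<in>A. M e D \<pi>)"
    by (intro open_UN) (auto simp: A_def intro: finite_subset[OF _ finite_lessThan])
  moreover have "fk_ball \<theta> T \<omega> n x \<epsilon> = (\<Union>(e, D, \<pi>)\<in>A. M e D \<pi>)"
    unfolding fk_ball_def fk_dist_less_iff[OF \<open>n > 0\<close>] fk_match_def A_def M_def by blast
  ultimately show ?thesis by simp
qed

text \<open>The identity on all n times is a match. The room between e and \<epsilon> is needed
  because the metric is an infimum.\<close>

lemma bowen_ball_subset_fk_ball:
  assumes "n > 0" "0 < e" "e < \<epsilon>"
    and "\<And>i. i < n \<Longrightarrow> dist (rds_iter \<theta> T i \<omega> x) (rds_iter \<theta> T i \<omega> y) < e"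
  shows "y \<in> fk_ball \<theta> T \<omega> n x \<epsilon>"
proof -
  have "fk_match \<theta> T \<omega> n e x y {..<n} id"
    using assms by (auto simp: fk_match_def strict_mono_on_def)
  moreover have "real n * (1 - e) < real (card {..<n})" using assms by (simp add: algebra_simps)
  ultimately show ?thesis
    unfolding fk_ball_def mem_Collect_eq fk_dist_less_iff[OF \<open>n > 0\<close>] using assms(2,3) by blast
qed

text \<open>The balls are open and contain their centres. This makes the minimum in
  \<open>sp_fk\<close> range over a nonempty set.\<close>

lemma finite_fk_cover:
  fixes T :: "'w \<Rightarrow> 'x::metric_space \<Rightarrow> 'x"
  assumes "compact (UNIV :: 'x set)" "n > 0" "0 < \<epsilon>"
    and cont: "\<And>i. continuous_on UNIV (rds_iter \<theta> T i \<omega>)"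
  shows "\<exists>F. finite F \<and> (\<Union>x\<in>F. fk_ball \<theta> T \<omega> n x \<epsilon>) = UNIV"
proof -
  have "x \<in> fk_ball \<theta> T \<omega> n x \<epsilon>" for x
    using assms by (intro bowen_ball_subset_fk_ball[of n "\<epsilon> / 2"]) auto
  then have cover: "UNIV \<subseteq> (\<Union>x\<in>UNIV. fk_ball \<theta> T \<omega> n x \<epsilon>)" by blast
  obtain F where "finite F" "UNIV \<subseteq> (\<Union>x\<in>F. fk_ball \<theta> T \<omega> n x \<epsilon>)"
    by (rule compactE_image[OF assms(1) fk_ball_open[OF \<open>n > 0\<close> cont] cover])
  then show ?thesis by (intro exI[of _ F]) auto
qed

text \<open>A strictly increasing map preserves the number of predecessors, so a match is determined
  by its domain and its range. When matches are counted, these two sets are all that has to be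
  recorded.\<close>

lemma strict_mono_on_unique:
  fixes \<pi> \<pi>' :: "nat \<Rightarrow> nat"
  assumes "finite D" "strict_mono_on D \<pi>" "strict_mono_on D \<pi>'" "\<pi> ` D = \<pi>' ` D"
    and "i \<in> D" "i' \<in> D" "\<pi> i = \<pi>' i'"
  shows "i = i'"
proof -
  have card_below: "card {j\<in>\<rho> ` D. j < \<rho> k} = card {j\<in>D. j < k}"
    if \<rho>: "strict_mono_on D \<rho>" "k \<in> D" for \<rho> :: "nat \<Rightarrow> nat" and k
  proof -
    have "\<rho> j < \<rho> k \<longleftrightarrow> j < k" if "j \<in> D" for j
      using strict_mono_on_less[OF \<rho>(1) that \<rho>(2)] .
    then have "{j\<in>\<rho> ` D. j < \<rho> k} = \<rho> ` {j\<in>D. j < k}" by auto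
    moreover have "inj_on \<rho> {j\<in>D. j < k}"
      using strict_mono_on_imp_inj_on[OF \<rho>(1)] by (rule inj_on_subset) auto
    ultimately show ?thesis by (simp add: card_image)
  qed
  have eq: "card {j\<in>D. j < i} = card {j\<in>D. j < i'}"
    using card_below[OF assms(2,5)] card_below[OF assms(3,6)] assms(4,7) by simp
  have less: "card {j\<in>D. j < a} < card {j\<in>D. j < b}" if "a < b" "a \<in> D" for a b
    using that \<open>finite D\<close> by (intro psubset_card_mono) auto
  show ?thesis
    using less[of i i'] less[of i' i] eq assms(5,6) by (cases i i' rule: linorder_cases) auto
qed

lemma card_image_le_of_factor:
  assumes "finite (g ` G)" "\<And>x y. x \<in> G \<Longrightarrow> y \<in> G \<Longrightarrow> g x = g y \<Longrightarrow> f x = f y"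
  shows "card (f ` G) \<le> card (g ` G)"
proof -
  define s where "s q = (SOME x. x \<in> G \<and> g x = q)" for q
  have s: "s (g x) \<in> G \<and> g (s (g x)) = g x" if "x \<in> G" for x
    unfolding s_def by (rule someI[of _ x]) (use that in auto)
  have "f ` G \<subseteq> (\<lambda>q. f (s q)) ` (g ` G)"
  proof (rule image_subsetI)
    fix x assume x: "x \<in> G"
    have "f x = f (s (g x))" using s[OF x] x by (intro assms(2)) auto
    then show "f x \<in> (\<lambda>q. f (s q)) ` (g ` G)" using x by blast
  qed
  then have "card (f ` G) \<le> card ((\<lambda>q. f (s q)) ` (g ` G))"
    using assms(1) by (intro card_mono) auto
  also have "\<dots> \<le> card (g ` G)" by (rule card_image_le[OF assms(1)])
  finally show ?thesis .
qed

text \<open>Each set of size at most \<open>a * n\<close> has weight at least \<open>a powr (a * n)\<close> in the expansion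
  of \<open>(1 + a) ^ n\<close>.\<close>
lemma card_small_subsets:
  fixes a :: real and n :: nat
  assumes "0 < a" "a \<le> 1"
  shows "real (card {D. D \<subseteq> {..<n} \<and> real (card D) \<le> a * n}) \<le> exp (n * (a - a * ln a))"
proof -
  let ?S = "{D. D \<subseteq> {..<n} \<and> real (card D) \<le> a * n}"
  have fin: "finite ?S" by (rule finite_subset[of _ "Pow {..<n}"]) auto
  have "real (card ?S) * a powr (a * n) = (\<Sum>D\<in>?S. a powr (a * n))" by simp
  also have "\<dots> \<le> (\<Sum>D\<in>?S. a ^ card D)"
  proof (intro sum_mono)
    fix D assume "D \<in> ?S"
    then have "a powr (a * n) \<le> a powr (card D)" using assms by (intro powr_mono') auto
    then show "a powr (a * n) \<le> a ^ card D" using assms by (simp add: powr_realpow)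
  qed
  also have "\<dots> \<le> (\<Sum>D\<in>Pow {..<n}. a ^ card D)"
    using assms by (intro sum_mono2) auto
  also have "\<dots> = (1 + a) ^ n"
    using prod_add[of "{..<n}" "\<lambda>_. a" "\<lambda>_. 1"] by (simp add: add.commute)
  also have "\<dots> \<le> exp a ^ n"
    using assms exp_ge_add_one_self[of a] by (intro power_mono) auto
  also have "\<dots> = exp (n * a)" by (simp add: exp_of_nat_mult)
  finally have "real (card ?S) * exp (a * n * ln a) \<le> exp (n * a)"
    using assms by (simp add: powr_def)
  then have "real (card ?S) \<le> exp (n * a) / exp (a * n * ln a)"
    by (simp add: pos_le_divide_eq)
  also have "\<dots> = exp (n * (a - a * ln a))"
    by (simp add: exp_diff[symmetric] algebra_simps)
  finally show ?thesis .
qed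

section \<open>The spanning numbers \<open>sp_fk\<close> and their dependence on the radius\<close>

context invariant_disintegration
begin

text \<open>Continuity of all iterates is what makes the FK balls of the fibre open, hence
  measurable.\<close>

definition regular :: "'w \<Rightarrow> bool" where
  "regular \<omega> \<longleftrightarrow> \<omega> \<in> space P \<and> (\<forall>i. continuous_on UNIV (rds_iter \<theta> T i \<omega>))"

lemma AE_regular: "AE \<omega> in P. regular \<omega>"
  using measure_preserving_map_AE_funpow[OF base_preserving fibre_continuous] AE_space
proof eventually_elim
  case (elim \<omega>)
  have "continuous_on UNIV (rds_iter \<theta> T i \<omega>)" for i
  proof (induction i)
    case (Suc i)
    show ?case
      using continuous_on_compose2[OF elim(1)[rule_format, of i] Suc] by (simp add: o_def)
  qed (simp add: continuous_on_id')
  then show ?case using elim by (simp add: regular_def)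
qed

lemma fk_balls_in_sets:
  assumes "regular \<omega>" "n > 0"
  shows "(\<Union>x\<in>F. fk_ball \<theta> T \<omega> n x \<epsilon>) \<in> sets (\<kappa> \<omega>)"
proof -
  have "open (fk_ball \<theta> T \<omega> n x \<epsilon>)" for x
    using assms by (intro fk_ball_open) (auto simp: regular_def)
  then have "open (\<Union>x\<in>F. fk_ball \<theta> T \<omega> n x \<epsilon>)" by blast
  then show ?thesis using assms(1) by (simp add: regular_def kernel_sets borel_open)
qed

lemma sp_fk_witness:
  assumes "regular \<omega>" "n > 0" "0 < \<epsilon>"
  shows "\<exists>F. finite F \<and> card F = sp_fk \<theta> T \<kappa> \<omega> n \<epsilon> \<and>
    measure (\<kappa> \<omega>) (\<Union>x\<in>F. fk_ball \<theta> T \<omega> n x \<epsilon>) > 1 - \<epsilon>"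
proof -
  have \<omega>: "\<omega> \<in> space P" using assms by (simp add: regular_def)
  have "continuous_on UNIV (rds_iter \<theta> T i \<omega>)" for i using assms(1) by (simp add: regular_def)
  then obtain F where F: "finite F" "(\<Union>x\<in>F. fk_ball \<theta> T \<omega> n x \<epsilon>) = UNIV"
    using finite_fk_cover[OF fibre_compact assms(2,3), of \<theta> T \<omega>] by blast
  have "measure (\<kappa> \<omega>) UNIV = 1"
    using prob_space.prob_space[OF kernel_prob[OF \<omega>]] by (simp add: kernel_space[OF \<omega>])
  then have "measure (\<kappa> \<omega>) (\<Union>x\<in>F. fk_ball \<theta> T \<omega> n x \<epsilon>) > 1 - \<epsilon>"
    using assms(3) unfolding F(2) by simp
  then have "\<exists>k F. finite F \<and> card F = k \<and> measure (\<kappa> \<omega>) (\<Union>x\<in>F. fk_ball \<theta> T \<omega> n x \<epsilon>) > 1 - \<epsilon>"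
    using F(1) by blast
  then show ?thesis unfolding sp_fk_def by (rule LeastI_ex)
qed

lemma sp_fk_le:
  assumes "finite F" "measure (\<kappa> \<omega>) (\<Union>x\<in>F. fk_ball \<theta> T \<omega> n x \<epsilon>) > 1 - \<epsilon>"
  shows "sp_fk \<theta> T \<kappa> \<omega> n \<epsilon> \<le> card F"
  unfolding sp_fk_def using assms by (intro Least_le exI[of _ F] conjI refl)

text \<open>For \<epsilon> < 1 the empty family covers too little. Positivity makes the logarithm of
  \<open>sp_fk\<close> monotone and nonnegative.\<close>

lemma sp_fk_pos:
  assumes "regular \<omega>" "n > 0" "0 < \<epsilon>" "\<epsilon> < 1"
  shows "sp_fk \<theta> T \<kappa> \<omega> n \<epsilon> > 0"
proof -
  obtain F where F: "finite F" "card F = sp_fk \<theta> T \<kappa> \<omega> n \<epsilon>"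
    "measure (\<kappa> \<omega>) (\<Union>x\<in>F. fk_ball \<theta> T \<omega> n x \<epsilon>) > 1 - \<epsilon>"
    using sp_fk_witness[OF assms(1-3)] by blast
  have "F \<noteq> {}" using F(3) assms(4) by auto
  then show ?thesis using F(1,2) card_gt_0_iff[of F] by simp
qed

text \<open>A larger radius helps twice: the balls grow and the mass to be covered shrinks.\<close>

lemma sp_fk_antimono:
  assumes "regular \<omega>" "n > 0" "0 < \<epsilon>" "\<epsilon> \<le> \<epsilon>'"
  shows "sp_fk \<theta> T \<kappa> \<omega> n \<epsilon>' \<le> sp_fk \<theta> T \<kappa> \<omega> n \<epsilon>"
proof -
  obtain F where F: "finite F" "card F = sp_fk \<theta> T \<kappa> \<omega> n \<epsilon>"
    "measure (\<kappa> \<omega>) (\<Union>x\<in>F. fk_ball \<theta> T \<omega> n x \<epsilon>) > 1 - \<epsilon>"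
    using sp_fk_witness[OF assms(1-3)] by blast
  have \<omega>: "\<omega> \<in> space P" using assms by (simp add: regular_def)
  interpret K: prob_space "\<kappa> \<omega>" by (rule kernel_prob[OF \<omega>])
  have "measure (\<kappa> \<omega>) (\<Union>x\<in>F. fk_ball \<theta> T \<omega> n x \<epsilon>) \<le> measure (\<kappa> \<omega>) (\<Union>x\<in>F. fk_ball \<theta> T \<omega> n x \<epsilon>')"
    by (rule K.finite_measure_mono[OF UN_mono fk_balls_in_sets])
      (simp_all add: fk_ball_mono assms)
  then have "measure (\<kappa> \<omega>) (\<Union>x\<in>F. fk_ball \<theta> T \<omega> n x \<epsilon>') > 1 - \<epsilon>'"
    using F(3) assms(4) by linarith
  then have "sp_fk \<theta> T \<kappa> \<omega> n \<epsilon>' \<le> card F" by (rule sp_fk_le[OF F(1)])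
  then show ?thesis using F(2) by simp
qed

definition sp_rate :: "'w \<Rightarrow> real \<Rightarrow> nat \<Rightarrow> ereal" where
  "sp_rate \<omega> \<epsilon> n = ereal (1 / real n * ln (real (sp_fk \<theta> T \<kappa> \<omega> n \<epsilon>)))"

lemma sp_rate_antimono:
  assumes "regular \<omega>" "n > 0" "0 < \<epsilon>" "\<epsilon> \<le> \<epsilon>'" "\<epsilon>' < 1"
  shows "sp_rate \<omega> \<epsilon>' n \<le> sp_rate \<omega> \<epsilon> n"
proof -
  have "ln (real (sp_fk \<theta> T \<kappa> \<omega> n \<epsilon>')) \<le> ln (real (sp_fk \<theta> T \<kappa> \<omega> n \<epsilon>))"
    using sp_fk_antimono[OF assms(1-4)] sp_fk_pos[of \<omega> n \<epsilon>'] assms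
    by (subst ln_le_cancel_iff) auto
  then show ?thesis using assms(2) by (simp add: sp_rate_def divide_right_mono)
qed

section \<open>Separating the atoms of a partition off a small set\<close>

text \<open>Exchanging x and x' gives the reverse implication, so close points of one fibre outside
  N lie on the same side of S. Distances are measured within a fibre, and
  \<open>Pair \<omega>\<close> is common to both points.\<close>

definition separates_off :: "('w \<times> 'x) set \<Rightarrow> ('w \<times> 'x) set \<Rightarrow> real \<Rightarrow> bool" where
  "separates_off S N r \<longleftrightarrow> (\<forall>\<omega>\<in>space P. \<forall>x x'. (\<omega>, x) \<notin> N \<longrightarrow> (\<omega>, x') \<notin> N \<longrightarrow>
     dist x x' < r \<longrightarrow> (\<omega>, x) \<in> S \<longrightarrow> (\<omega>, x') \<in> S)"

lemma separates_offI:
  assumes "\<And>\<omega> x x'. \<omega> \<in> space P \<Longrightarrow> (\<omega>, x) \<notin> N \<Longrightarrow> (\<omega>, x') \<notin> N \<Longrightarrow> dist x x' < r \<Longrightarrow>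
    (\<omega>, x) \<in> S \<Longrightarrow> (\<omega>, x') \<in> S"
  shows "separates_off S N r"
  using assms unfolding separates_off_def by blast

lemma separates_offD:
  assumes "separates_off S N r" "\<omega> \<in> space P" "(\<omega>, x) \<notin> N" "(\<omega>, x') \<notin> N" "dist x x' < r"
    "(\<omega>, x) \<in> S"
  shows "(\<omega>, x') \<in> S"
  using assms unfolding separates_off_def by blast

text \<open>A form of Lusin's theorem along the fibres. The sets with this property are closed under
  complements and countable unions and contain all rectangles, hence all measurable sets.\<close>

definition separable_off :: "('w \<times> 'x) set \<Rightarrow> bool" where
  "separable_off S \<longleftrightarrow> (\<forall>\<delta>>0. \<exists>N r. N \<in> sets PX \<and> 0 < r \<and> measure \<mu> N < \<delta> \<and> separates_off S N r)"

lemma separable_offE: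
  assumes "separable_off S" "\<delta> > 0"
  obtains N r where "N \<in> sets PX" "r > 0" "measure \<mu> N < \<delta>" "separates_off S N r"
  using assms unfolding separable_off_def by blast

lemma separable_offI:
  assumes "\<And>\<delta>::real. \<delta> > 0 \<Longrightarrow> \<exists>N r. N \<in> sets PX \<and> 0 < r \<and> measure \<mu> N < \<delta> \<and> separates_off S N r"
  shows "separable_off S"
  using assms unfolding separable_off_def by blast

lemma finite_measure_\<mu>: "finite_measure \<mu>"
  using prob_space_\<mu> by (rule prob_space.finite_measure)

lemma separable_off_Compl:
  assumes "separable_off S"
  shows "separable_off (space PX - S)"
proof (rule separable_offI)
  fix \<delta> :: real assume "\<delta> > 0"
  then obtain N r where N: "N \<in> sets PX" "r > 0" "measure \<mu> N < \<delta>" "separates_off S N r"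
    using separable_offE[OF assms] by blast
  have "separates_off (space PX - S) N r"
  proof (rule separates_offI)
    fix \<omega> x x'
    assume *: "\<omega> \<in> space P" "(\<omega>, x) \<notin> N" "(\<omega>, x') \<notin> N" "dist x x' < r" "(\<omega>, x) \<in> space PX - S"
    then have "(\<omega>, x') \<notin> S"
      using separates_offD[OF N(4), of \<omega> x' x] by (auto simp: dist_commute)
    then show "(\<omega>, x') \<in> space PX - S" using *(1) by (simp add: space_pair_measure)
  qed
  then show "\<exists>N r. N \<in> sets PX \<and> 0 < r \<and> measure \<mu> N < \<delta> \<and> separates_off (space PX - S) N r"
    using N by blast
qed

text \<open>Up to a set \<open>U m\<close> of small measure the union equals the union of its first
  m members, and finitely many radii have a positive minimum.\<close>

lemma separable_off_Union:
  assumes sets: "\<And>i::nat. S i \<in> sets PX" and sep: "\<And>i. separable_off (S i)"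
  shows "separable_off (\<Union>i. S i)"
proof (rule separable_offI)
  fix \<delta> :: real assume \<delta>: "\<delta> > 0"
  interpret M: finite_measure \<mu> by (rule finite_measure_\<mu>)
  define U where "U m = (\<Union>i. S i) - (\<Union>i<m. S i)" for m
  have Um: "U m \<in> sets PX" for m unfolding U_def using sets by auto
  have "U (Suc m) \<subseteq> U m" for m unfolding U_def by auto
  then have "(\<lambda>m. measure \<mu> (U m)) \<longlonglongrightarrow> measure \<mu> (\<Inter>m. U m)"
    by (intro M.finite_Lim_measure_decseq decseq_SucI) (auto simp: sets_\<mu> Um)
  moreover have "(\<Inter>m. U m) = {}" by (auto simp: U_def)
  ultimately have "(\<lambda>m. measure \<mu> (U m)) \<longlonglongrightarrow> 0" by simp
  then have "\<forall>\<^sub>F m in sequentially. measure \<mu> (U m) < \<delta> / 2"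
    using \<delta> by (intro order_tendstoD) auto
  then obtain m where m: "measure \<mu> (U m) < \<delta> / 2" by (auto simp: eventually_sequentially)
  \<comment> \<open>The m exceptional sets together get at most \<delta> / 2, the other half being
    spent on \<open>U m\<close>. The summand 1 covers the case m = 0.\<close>
  have "\<delta> / (2 * (real m + 1)) > 0" using \<delta> by simp
  then have "\<exists>N r. N \<in> sets PX \<and> 0 < r \<and> measure \<mu> N < \<delta> / (2 * (real m + 1)) \<and> separates_off (S i) N r" for i
    using separable_offE[OF sep[of i]] by metis
  then obtain N r where Nr: "\<And>i. N i \<in> sets PX" "\<And>i. r i > (0::real)"
    "\<And>i. measure \<mu> (N i) < \<delta> / (2 * (real m + 1))" "\<And>i. separates_off (S i) (N i) (r i)"
    by metis
  define B where "B = U m \<union> (\<Union>i<m. N i)"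
  \<comment> \<open>Inserting 1 keeps the minimum meaningful for m = 0.\<close>
  define \<rho> where "\<rho> = Min (insert 1 (r ` {..<m}))"
  have \<rho>: "\<rho> > 0" "\<And>i. i < m \<Longrightarrow> \<rho> \<le> r i" unfolding \<rho>_def using Nr by auto
  have Bm: "B \<in> sets PX" unfolding B_def using Um Nr by auto
  have "measure \<mu> B \<le> measure \<mu> (U m) + measure \<mu> (\<Union>i<m. N i)"
    unfolding B_def using Um Nr by (intro measure_Un_le) (auto simp: sets_\<mu>)
  also have "measure \<mu> (\<Union>i<m. N i) \<le> (\<Sum>i<m. measure \<mu> (N i))"
    using Nr by (intro measure_UNION_le) (auto simp: sets_\<mu>)
  also have "\<dots> \<le> (\<Sum>i<m. \<delta> / (2 * (real m + 1)))"
    using Nr by (intro sum_mono) (auto intro: less_imp_le)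
  also have "\<dots> \<le> \<delta> / 2" using \<delta> by (simp add: divide_simps)
  finally have "measure \<mu> B < \<delta>" using m by linarith
  moreover have "separates_off (\<Union>i. S i) B \<rho>"
  proof (rule separates_offI)
    fix \<omega> x x'
    assume *: "\<omega> \<in> space P" "(\<omega>, x) \<notin> B" "(\<omega>, x') \<notin> B" "dist x x' < \<rho>" "(\<omega>, x) \<in> (\<Union>i. S i)"
    obtain i where i: "i < m" "(\<omega>, x) \<in> S i" using *(2,5) by (auto simp: B_def U_def)
    have "(\<omega>, x) \<notin> N i" "(\<omega>, x') \<notin> N i" "dist x x' < r i"
      using *(2-4) i(1) \<rho>(2)[OF i(1)] by (auto simp: B_def)
    then have "(\<omega>, x') \<in> S i" using separates_offD[OF Nr(4) *(1)] i(2) by blast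
    then show "(\<omega>, x') \<in> (\<Union>i. S i)" by blast
  qed
  ultimately show "\<exists>N r. N \<in> sets PX \<and> 0 < r \<and> measure \<mu> N < \<delta> \<and> separates_off (\<Union>i. S i) N r"
    using Bm \<rho>(1) by blast
qed

text \<open>For open \<open>U\<close> the points of \<open>U\<close> that are close to its complement have small measure.\<close>
lemma separable_off_open:
  assumes "open U"
  shows "separable_off (space P \<times> U)"
proof (rule separable_offI)
  fix \<delta> :: real assume \<delta>: "\<delta> > 0"
  interpret M: finite_measure \<mu> by (rule finite_measure_\<mu>)
  define V where "V m = {x \<in> U. \<exists>y. y \<notin> U \<and> dist x y < 1 / real (Suc m)}" for m
  have "V m = U \<inter> (\<Union>y\<in>- U. ball y (1 / real (Suc m)))" for m
    by (auto simp: V_def dist_commute)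
  then have "open (V m)" for m using assms by auto
  then have Vm: "space P \<times> V m \<in> sets PX" for m by (intro pair_measureI) auto
  have V0: "(\<Inter>m. V m) = {}"
  proof (rule equals0I)
    fix x assume x: "x \<in> (\<Inter>m. V m)"
    then have "x \<in> U" by (auto simp: V_def)
    then obtain e where e: "e > 0" "\<And>y. dist y x < e \<Longrightarrow> y \<in> U"
      using assms unfolding open_dist by meson
    obtain m where m: "1 / real (Suc m) < e" using nat_approx_posE[OF e(1)] by metis
    obtain y where "y \<notin> U" "dist x y < 1 / real (Suc m)" using x by (auto simp: V_def)
    then show False using e(2)[of y] m by (simp add: dist_commute)
  qed
  have "V (Suc m) \<subseteq> V m" for m
  proof -
    have "1 / real (Suc (Suc m)) \<le> 1 / real (Suc m)" by (simp add: divide_simps)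
    then show ?thesis unfolding V_def by (auto intro: less_le_trans)
  qed
  then have "(\<lambda>m. measure \<mu> (space P \<times> V m)) \<longlonglongrightarrow> measure \<mu> (\<Inter>m. space P \<times> V m)"
    by (intro M.finite_Lim_measure_decseq decseq_SucI) (auto simp: sets_\<mu> Vm)
  moreover have "(\<Inter>m. space P \<times> V m) = {}" using V0 by blast
  ultimately have "(\<lambda>m. measure \<mu> (space P \<times> V m)) \<longlonglongrightarrow> 0" by simp
  then have "\<forall>\<^sub>F m in sequentially. measure \<mu> (space P \<times> V m) < \<delta>"
    using \<delta> by (intro order_tendstoD) auto
  then obtain m where m: "measure \<mu> (space P \<times> V m) < \<delta>" by (auto simp: eventually_sequentially)
  have "separates_off (space P \<times> U) (space P \<times> V m) (1 / real (Suc m))"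
    by (rule separates_offI) (auto simp: V_def)
  then show "\<exists>N r. N \<in> sets PX \<and> 0 < r \<and> measure \<mu> N < \<delta> \<and> separates_off (space P \<times> U) N r"
    using m Vm[of m] by (intro exI[of _ "space P \<times> V m"] exI[of _ "1 / real (Suc m)"]) simp
qed

lemma separable_off_borel:
  assumes "B \<in> sets borel"
  shows "separable_off (space P \<times> B)"
  using assms unfolding sets_borel
proof (induction rule: sigma_sets.induct)
  case (Basic U)
  then show ?case by (simp add: separable_off_open)
next
  case Empty
  show ?case using separable_off_open[of "{}"] by simp
next
  case (Compl B)
  have "space P \<times> (UNIV - B) = space PX - space P \<times> B" by (auto simp: space_pair_measure)
  then show ?case using separable_off_Compl[OF Compl.IH] by simp
next
  case (Union B)
  have "space P \<times> (\<Union>i. B i) = (\<Union>i. space P \<times> B i)" by auto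
  moreover have "space P \<times> B i \<in> sets PX" for i
    using Union.hyps[of i] by (intro pair_measureI) (auto simp: sets_borel)
  ultimately show ?case using separable_off_Union[of "\<lambda>i. space P \<times> B i"] Union.IH by simp
qed

lemma separable_off_measurable:
  assumes "S \<in> sets PX"
  shows "separable_off S"
  using assms unfolding sets_pair_measure
proof (induction rule: sigma_sets.induct)
  case (Basic S)
  then obtain A B where S: "S = A \<times> B" "A \<in> sets P" "B \<in> sets borel" by auto
  show ?case
  proof (rule separable_offI)
    fix \<delta> :: real assume "\<delta> > 0"
    then obtain N r where N: "N \<in> sets PX" "r > 0" "measure \<mu> N < \<delta>" "separates_off (space P \<times> B) N r"
      using separable_offE[OF separable_off_borel[OF S(3)]] by blast
    \<comment> \<open>Both points have the same base point, so the factor A holds for both or for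
      neither.\<close>
    have "separates_off S N r"
      using separates_offD[OF N(4)] unfolding S(1) by (intro separates_offI) blast
    then show "\<exists>N r. N \<in> sets PX \<and> 0 < r \<and> measure \<mu> N < \<delta> \<and> separates_off S N r"
      using N by blast
  qed
next
  case Empty
  show ?case using separable_off_open[of "{}"] by simp
next
  case (Compl S)
  have "space P \<times> space borel - S = space PX - S" by (simp add: space_pair_measure)
  then show ?case using separable_off_Compl[OF Compl.IH] by simp
next
  case (Union S)
  have "S i \<in> sets PX" for i using Union.hyps[of i] by (simp add: sets_pair_measure)
  then show ?case using separable_off_Union[of S] Union.IH by simp
qed

end

section \<open>The lower bound\<close>

text \<open>The expression tends to 0 with a. Its constants are those of
  \<open>name_entropy_le_sp_fk\<close>: three sets of times are chosen, and the alphabet is paid for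
  at up to 2 * a * n times and once more on a set of mass 2 * a.\<close>

lemma small_error_term:
  fixes L \<eta> :: real
  assumes "L \<ge> 0" "\<eta> > 0"
  obtains a where "0 < a" "a < 1" "3 * (a - a * ln a) + 4 * a * L < \<eta>"
proof -
  \<comment> \<open>The witness is a = b * b, since ln t \<le> t - 1 at t = 1 / b gives - b * b * ln
    b \<le> b. The three terms are then at most 3 * b, 6 * b and 4 * b * L, and 10 instead of 9
    makes the inequality strict.\<close>
  define b where "b = min (1 / 2) (\<eta> / (10 + 4 * L))"
  have b: "0 < b" "b \<le> 1 / 2" "b * (10 + 4 * L) \<le> \<eta>"
    using assms by (auto simp: b_def min_def divide_simps add_pos_nonneg)
  have "ln (1 / b) \<le> 1 / b - 1" using b by (intro ln_le_minus_one) simp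
  then have "(b * b) * ln (1 / b) \<le> (b * b) * (1 / b - 1)"
    by (intro mult_left_mono) auto
  then have "- (b * b) * ln b \<le> (b * b) * (1 / b - 1)"
    using b by (simp add: ln_div)
  also have "\<dots> \<le> b" using b by (simp add: algebra_simps)
  finally have *: "- (b * b) * ln b \<le> b" .
  have bb: "b * b \<le> b" using b mult_left_mono[of b 1 b] by simp
  have bbL: "(b * b) * L \<le> b * L" using bb assms by (intro mult_right_mono) auto
  have "ln (b * b) = 2 * ln b" using b by (simp add: ln_mult)
  then have "3 * (b * b - b * b * ln (b * b)) + 4 * (b * b) * L \<le> 3 * b + 6 * b + 4 * b * L"
    using * bb bbL by (simp add: algebra_simps)
  also have "\<dots> < b * (10 + 4 * L)" using b by (simp add: algebra_simps)
  also have "\<dots> \<le> \<eta>" by (rule b(3))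
  finally have "3 * (b * b - b * b * ln (b * b)) + 4 * (b * b) * L < \<eta>" .
  moreover have "0 < b * b" using b by simp
  moreover have "b * b < 1" using b bb by linarith
  ultimately show ?thesis using that by blast
qed

context coded_disintegration
begin

lemma card_Z_pos: "card Z > 0"
proof -
  obtain \<omega> where "\<omega> \<in> space P" using not_empty by blast
  then have "c (\<omega>, undefined) \<in> Z" by (intro code_in_Z) (simp add: space_pair_measure)
  then show ?thesis by (auto simp: card_gt_0_iff)
qed

text \<open>Fibrewise separation of all level sets of the code at once, with the share \<delta> /
  card Z for each letter.\<close>

lemma code_separated:
  assumes "\<delta> > 0"
  obtains N r where "N \<in> sets PX" "r > 0" "measure \<mu> N < \<delta>"
    "\<And>\<omega> x x'. \<omega> \<in> space P \<Longrightarrow> (\<omega>, x) \<notin> N \<Longrightarrow> (\<omega>, x') \<notin> N \<Longrightarrow> dist x x' < r \<Longrightarrow> c (\<omega>, x) = c (\<omega>, x')"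
proof -
  define S where "S z = {p \<in> space PX. c p = z}" for z
  have "S z \<in> sets PX" if "z \<in> Z" for z
  proof -
    have "S z = c -` {z} \<inter> space PX" by (auto simp: S_def)
    then show ?thesis using measurable_sets[OF code_measurable, of "{z}"] that by simp
  qed
  then have sep: "separable_off (S z)" if "z \<in> Z" for z using separable_off_measurable that by blast
  have "\<delta> / card Z > 0" using assms card_Z_pos by simp
  then have "\<forall>z\<in>Z. \<exists>N r. N \<in> sets PX \<and> 0 < r \<and> measure \<mu> N < \<delta> / card Z \<and> separates_off (S z) N r"
    using separable_offE[OF sep] by metis
  then obtain N r where Nr: "\<And>z. z \<in> Z \<Longrightarrow> N z \<in> sets PX" "\<And>z. z \<in> Z \<Longrightarrow> r z > (0::real)"
    "\<And>z. z \<in> Z \<Longrightarrow> measure \<mu> (N z) < \<delta> / card Z" "\<And>z. z \<in> Z \<Longrightarrow> separates_off (S z) (N z) (r z)"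
    by metis
  define B where "B = (\<Union>z\<in>Z. N z)"
  define \<rho> where "\<rho> = Min (insert 1 (r ` Z))"
  have \<rho>: "\<rho> > 0" "\<And>z. z \<in> Z \<Longrightarrow> \<rho> \<le> r z" unfolding \<rho>_def using Nr(2) by auto
  have Bm: "B \<in> sets PX" unfolding B_def using Nr(1) by auto
  have Zne: "Z \<noteq> {}" using card_Z_pos by auto
  interpret M: finite_measure \<mu> by (rule finite_measure_\<mu>)
  have "measure \<mu> B \<le> (\<Sum>z\<in>Z. measure \<mu> (N z))"
    unfolding B_def using Nr(1) by (intro measure_UNION_le) (auto simp: sets_\<mu>)
  also have "\<dots> < (\<Sum>z\<in>Z. \<delta> / card Z)"
    using Nr(3) Zne by (intro sum_strict_mono) auto
  also have "\<dots> = \<delta>" using card_Z_pos Zne by simp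
  finally have "measure \<mu> B < \<delta>" .
  moreover have "c (\<omega>, x) = c (\<omega>, x')"
    if *: "\<omega> \<in> space P" "(\<omega>, x) \<notin> B" "(\<omega>, x') \<notin> B" "dist x x' < \<rho>" for \<omega> x x'
  proof -
    define z where "z = c (\<omega>, x)"
    have sp: "(\<omega>, x) \<in> space PX" using *(1) by (simp add: space_pair_measure)
    then have z: "z \<in> Z" unfolding z_def by (rule code_in_Z)
    have "(\<omega>, x) \<notin> N z" "(\<omega>, x') \<notin> N z" "dist x x' < r z"
      using *(2-4) z \<rho>(2)[OF z] by (auto simp: B_def)
    moreover have "(\<omega>, x) \<in> S z" using sp by (simp add: S_def z_def)
    ultimately have "(\<omega>, x') \<in> S z" using separates_offD[OF Nr(4)[OF z] *(1)] by blast
    then show ?thesis by (simp add: S_def z_def)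
  qed
  ultimately show ?thesis using that[OF Bm \<rho>(1)] by blast
qed

text \<open>Outside a set of fibre measure \<open>2 * a\<close>, the name of \<open>x\<close> is determined by the centre \<open>y\<close> of an
  FK ball containing \<open>x\<close>, the complements of the domain and of the range of the match, the set of
  visits to the exceptional set \<open>N\<close>, and the letters at the unmatched times and the visits.\<close>
lemma name_entropy_le_sp_fk:
  assumes reg: "regular \<omega>" and n: "n > 0" and \<epsilon>: "0 < \<epsilon>" "\<epsilon> \<le> a" "2 * \<epsilon> \<le> r" and a: "a < 1"
    and N: "N \<in> sets PX"
    and sep: "\<And>\<omega> x x'. \<omega> \<in> space P \<Longrightarrow> (\<omega>, x) \<notin> N \<Longrightarrow> (\<omega>, x') \<notin> N \<Longrightarrow> dist x x' < r \<Longrightarrow>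
      c (\<omega>, x) = c (\<omega>, x')"
    and visits: "(\<Sum>i<n. measure (\<kappa> \<omega>) {x. (\<Theta> ^^ i) (\<omega>, x) \<in> N}) \<le> a * a * real n"
  shows "name_entropy n \<omega> \<le> ln 2 + ln (sp_fk \<theta> T \<kappa> \<omega> n \<epsilon>) + n * (3 * (a - a * ln a) + 4 * a * ln (card Z))"
proof -
  have \<omega>: "\<omega> \<in> space P" using reg by (simp add: regular_def)
  have a0: "a > 0" using \<epsilon> by linarith
  interpret K: prob_space "\<kappa> \<omega>" by (rule kernel_prob[OF \<omega>])
  have Ksp: "space (\<kappa> \<omega>) = UNIV" by (rule kernel_space[OF \<omega>])
  define A where "A i = {x. (\<Theta> ^^ i) (\<omega>, x) \<in> N}" for i
  have Am [measurable]: "A i \<in> sets (\<kappa> \<omega>)" for i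
  proof -
    have "{p \<in> space PX. (\<Theta> ^^ i) p \<in> N} = (\<Theta> ^^ i) -` N \<inter> space PX" by auto
    then show ?thesis
      unfolding A_def using fibre_set_in_sets[OF \<omega>, of "\<lambda>p. (\<Theta> ^^ i) p \<in> N"] skew_vimage_in_sets[OF N] by simp
  qed
  define V where "V x = {i\<in>{..<n}. x \<in> A i}" for x
  define u where "u x = (\<Sum>i<n. indicator (A i) x :: real)" for x
  have uV: "u x = card (V x)" for x
    unfolding u_def V_def by (simp add: indicator_def sum.If_cases Int_def)
  have um [measurable]: "u \<in> borel_measurable (\<kappa> \<omega>)"
    unfolding u_def[abs_def] by measurable
  have indI: "integrable (\<kappa> \<omega>) (indicator (A i) :: _ \<Rightarrow> real)" for i
    by (intro integrable_real_indicator Am) (simp add: K.emeasure_eq_measure)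
  have u_int: "(\<integral>x. u x \<partial>\<kappa> \<omega>) = (\<Sum>i<n. measure (\<kappa> \<omega>) (A i))"
    unfolding u_def using indI by (simp add: Ksp)
  have uI: "integrable (\<kappa> \<omega>) u"
    unfolding u_def[abs_def] by (intro Bochner_Integration.integrable_sum indI)
  define G2 where "G2 = {x. u x \<ge> a * n}"
  have G2m: "G2 \<in> sets (\<kappa> \<omega>)"
  proof -
    have "{x \<in> space (\<kappa> \<omega>). u x \<ge> a * n} \<in> sets (\<kappa> \<omega>)" by measurable
    then show ?thesis by (simp add: G2_def Ksp)
  qed
  have G2: "measure (\<kappa> \<omega>) G2 \<le> a"
  proof -
    have "measure (\<kappa> \<omega>) {x \<in> space (\<kappa> \<omega>). u x \<ge> a * n} \<le> (\<integral>x. u x \<partial>\<kappa> \<omega>) / (a * n)"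
      using a0 n by (intro integral_Markov_inequality_measure[OF uI, where A = "{}"]) (auto simp: uV)
    also have "\<dots> \<le> a * a * n / (a * n)"
      using visits a0 n unfolding u_int A_def by (intro divide_right_mono) auto
    finally show ?thesis using a0 n by (simp add: G2_def Ksp)
  qed
  obtain F where F: "finite F" "card F = sp_fk \<theta> T \<kappa> \<omega> n \<epsilon>"
    "measure (\<kappa> \<omega>) (\<Union>y\<in>F. fk_ball \<theta> T \<omega> n y \<epsilon>) > 1 - \<epsilon>"
    using sp_fk_witness[OF reg n \<epsilon>(1)] by blast
  define G1 where "G1 = (\<Union>y\<in>F. fk_ball \<theta> T \<omega> n y \<epsilon>)"
  have G1m: "G1 \<in> sets (\<kappa> \<omega>)" unfolding G1_def by (rule fk_balls_in_sets[OF reg n])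
  define G where "G = G1 - G2"
  have G_compl: "measure (\<kappa> \<omega>) (UNIV - G) \<le> 2 * a"
  proof -
    have "UNIV - G = (space (\<kappa> \<omega>) - G1) \<union> G2" by (auto simp: G_def Ksp)
    then have "measure (\<kappa> \<omega>) (UNIV - G) \<le> measure (\<kappa> \<omega>) (space (\<kappa> \<omega>) - G1) + measure (\<kappa> \<omega>) G2"
      using G1m G2m by (simp only:) (intro measure_Un_le; auto)
    then show ?thesis
      using K.prob_compl[OF G1m] F(3) G2 \<epsilon>(2) unfolding G1_def by linarith
  qed
  \<comment> \<open>The tolerance e of the match depends on x; relaxing it to \<epsilon> gives all
    points the same tolerance and fewer than \<epsilon> * n unmatched times.\<close>
  have "\<exists>y D \<pi>. y \<in> F \<and> D \<subseteq> {..<n} \<and> \<pi> ` D \<subseteq> {..<n} \<and> strict_mono_on D \<pi> \<and>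
      (\<forall>i\<in>D. dist (rds_iter \<theta> T i \<omega> y) (rds_iter \<theta> T (\<pi> i) \<omega> x) < \<epsilon>) \<and> real n * (1 - \<epsilon>) < real (card D)"
    if x: "x \<in> G1" for x
  proof -
    obtain y where y: "y \<in> F" "fk_dist \<theta> T \<omega> n y x < \<epsilon>"
      using x by (auto simp: G1_def fk_ball_def)
    then obtain e D \<pi> where e: "e < \<epsilon>" "fk_match \<theta> T \<omega> n e y x D \<pi>" "real n * (1 - e) < real (card D)"
      unfolding fk_dist_less_iff[OF n] by blast
    have "real n * (1 - \<epsilon>) \<le> real n * (1 - e)" using e(1) by (intro mult_left_mono) auto
    then have "real n * (1 - \<epsilon>) < real (card D)" using e(3) by linarith
    moreover have "\<forall>i\<in>D. dist (rds_iter \<theta> T i \<omega> y) (rds_iter \<theta> T (\<pi> i) \<omega> x) < \<epsilon>"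
      using e(1,2) unfolding fk_match_def by force
    ultimately show ?thesis using e(2) y(1) unfolding fk_match_def by blast
  qed
  then obtain y D \<pi> where m: "\<And>x. x \<in> G1 \<Longrightarrow> y x \<in> F \<and> D x \<subseteq> {..<n} \<and> \<pi> x ` D x \<subseteq> {..<n} \<and>
      strict_mono_on (D x) (\<pi> x) \<and>
      (\<forall>i\<in>D x. dist (rds_iter \<theta> T i \<omega> (y x)) (rds_iter \<theta> T (\<pi> x i) \<omega> x) < \<epsilon>) \<and>
      real n * (1 - \<epsilon>) < real (card (D x))"
    by metis
  define R where "R x = {..<n} - \<pi> x ` D x" for x
  define nm where "nm x = name n (\<omega>, x)" for x
  \<comment> \<open>The complement of \<open>D x\<close> consists of times of the centre, while
    \<open>R x\<close> and \<open>V x\<close> are times of x; so letters are recorded on the latter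
    two only. The three sets have at most a * n elements each.\<close>
  define g where "g x = (y x, {..<n} - D x, R x, V x, restrict (\<lambda>i. nm x ! i) (R x \<union> V x))" for x
  define \<S> where "\<S> = {D. D \<subseteq> {..<n} \<and> real (card D) \<le> a * n}"
  have fin\<S>: "finite \<S>" unfolding \<S>_def by (rule finite_subset[of _ "Pow {..<n}"]) auto
  have fin_mem: "finite E" if "E \<in> \<S>" for E
    using that unfolding \<S>_def by (auto intro: finite_subset[OF _ finite_lessThan])
  define Q where "Q = F \<times> \<S> \<times> (SIGMA E:\<S>. SIGMA E':\<S>. (E \<union> E') \<rightarrow>\<^sub>E Z)"
  have finQ: "finite Q"
    unfolding Q_def using F(1) fin\<S> fin_mem
    by (intro finite_cartesian_product finite_SigmaI finite_PiE) auto
  have gQ: "g ` G \<subseteq> Q"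
  proof (rule image_subsetI)
    fix x assume "x \<in> G"
    then have x: "x \<in> G1" "u x < a * n" by (auto simp: G_def G2_def)
    note mx = m[OF x(1)]
    have Dsub: "D x \<subseteq> {..<n}" and Rsub: "\<pi> x ` D x \<subseteq> {..<n}" using mx by blast+
    have cD: "real n * (1 - \<epsilon>) < real (card (D x))" using mx by blast
    have inj: "inj_on (\<pi> x) (D x)" using mx strict_mono_on_imp_inj_on by blast
    have "real n * \<epsilon> \<le> a * n" using \<epsilon>(2) by (simp add: mult.commute mult_right_mono)
    then have cDn: "real n - real (card (D x)) \<le> a * n" using cD by (simp add: algebra_simps)
    have "card ({..<n} - D x) = n - card (D x)"
      using Dsub by (simp add: card_Diff_subset finite_subset[OF Dsub])
    moreover have "card (R x) = n - card (D x)"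
      unfolding R_def using Rsub inj
      by (simp add: card_Diff_subset finite_subset[OF Dsub] finite_subset[OF Rsub] card_image)
    moreover have "card (D x) \<le> n" using card_mono[OF _ Dsub] by simp
    ultimately have "{..<n} - D x \<in> \<S>" "R x \<in> \<S>"
      using cDn by (auto simp: \<S>_def R_def)
    moreover have V: "V x \<in> \<S>" using x(2) by (auto simp: \<S>_def uV V_def)
    moreover have "restrict (\<lambda>i. nm x ! i) (R x \<union> V x) \<in> (R x \<union> V x) \<rightarrow>\<^sub>E Z"
    proof (intro restrict_PiE_iff[THEN iffD2] ballI)
      fix i assume "i \<in> R x \<union> V x"
      then have "i < n" by (auto simp: R_def V_def)
      moreover have "nm x \<in> words Z n"
        unfolding nm_def using \<omega> by (intro name_in_words) (simp add: space_pair_measure)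
      ultimately show "nm x ! i \<in> Z" by (auto simp: words_def)
    qed
    ultimately show "g x \<in> Q" using mx unfolding g_def Q_def by blast
  qed
  have g_inj: "nm x = nm x'" if x: "x \<in> G" "x' \<in> G" and eq: "g x = g x'" for x x'
  proof (rule nth_equalityI)
    show "length (nm x) = length (nm x')" by (simp add: nm_def)
    fix j assume "j < length (nm x)"
    then have j: "j < n" by (simp add: nm_def)
    have G1x: "x \<in> G1" "x' \<in> G1" using x by (auto simp: G_def)
    note mx = m[OF G1x(1)] m[OF G1x(2)]
    have yy: "y x = y x'" and RR: "R x = R x'" and VV: "V x = V x'"
      and DDc: "{..<n} - D x = {..<n} - D x'"
      and nn: "restrict (\<lambda>i. nm x ! i) (R x \<union> V x) = restrict (\<lambda>i. nm x' ! i) (R x' \<union> V x')"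
      using eq unfolding g_def prod.inject by blast+
    have sub: "D x \<subseteq> {..<n}" "D x' \<subseteq> {..<n}" "\<pi> x ` D x \<subseteq> {..<n}" "\<pi> x' ` D x' \<subseteq> {..<n}"
      using mx by simp_all
    have close: "\<forall>i\<in>D x. dist (rds_iter \<theta> T i \<omega> (y x)) (rds_iter \<theta> T (\<pi> x i) \<omega> x) < \<epsilon>"
      "\<forall>i\<in>D x'. dist (rds_iter \<theta> T i \<omega> (y x')) (rds_iter \<theta> T (\<pi> x' i) \<omega> x') < \<epsilon>"
      using mx by simp_all
    have DD: "D x = D x'"
      using arg_cong[OF DDc, of "(-) {..<n}"] sub(1,2) by (simp add: double_diff)
    have im: "\<pi> x ` D x = \<pi> x' ` D x'"
      using arg_cong[OF RR, of "(-) {..<n}"] sub(3,4) unfolding R_def by (simp only: double_diff)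
    show "nm x ! j = nm x' ! j"
    proof (cases "j \<in> R x \<union> V x")
      case True
      then have True': "j \<in> R x' \<union> V x'" unfolding RR VV .
      have "restrict (\<lambda>i. nm x ! i) (R x \<union> V x) j = nm x ! j" by (rule restrict_apply'[OF True])
      moreover have "restrict (\<lambda>i. nm x' ! i) (R x' \<union> V x') j = nm x' ! j"
        by (rule restrict_apply'[OF True'])
      ultimately show ?thesis using fun_cong[OF nn, of j] by argo
    next
      case False
      then have jR: "j \<in> \<pi> x ` D x" using j unfolding R_def by blast
      then obtain i where i: "i \<in> D x" "j = \<pi> x i" by (elim imageE)
      from jR obtain i' where i': "i' \<in> D x'" "j = \<pi> x' i'" unfolding im by (elim imageE)
      have fD: "finite (D x)" using sub(1) by (rule finite_subset) simp
      have sm: "strict_mono_on (D x) (\<pi> x)" using mx(1) by (elim conjE)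
      have "strict_mono_on (D x') (\<pi> x')" using mx(2) by (elim conjE)
      then have sm': "strict_mono_on (D x) (\<pi> x')" unfolding DD .
      have im': "\<pi> x ` D x = \<pi> x' ` D x" using im unfolding DD .
      have "i' \<in> D x" using i'(1) unfolding DD .
      \<comment> \<open>Equal domains and ranges give time j the same partner i in both matches.
        Hence both orbits at time j are within \<epsilon> of one point of the orbit of the centre,
        and 2 * \<epsilon> \<le> r lets \<open>sep\<close> compare them in the fibre over
        \<open>(\<theta> ^^ j) \<omega>\<close>.\<close>
      then have ii: "i = i'"
        using i(2) i'(2) by (intro strict_mono_on_unique[OF fD sm sm' im' i(1)]) argo+
      have "dist (rds_iter \<theta> T i \<omega> (y x)) (rds_iter \<theta> T j \<omega> x) < \<epsilon>"
        using close(1) i by simp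
      moreover have "dist (rds_iter \<theta> T i \<omega> (y x)) (rds_iter \<theta> T j \<omega> x') < \<epsilon>"
        using close(2) i' unfolding yy ii by simp
      ultimately have "dist (rds_iter \<theta> T j \<omega> x) (rds_iter \<theta> T j \<omega> x') < r"
        using \<epsilon>(3) dist_triangle3[of "rds_iter \<theta> T j \<omega> x" "rds_iter \<theta> T j \<omega> x'" "rds_iter \<theta> T i \<omega> (y x)"]
        by linarith
      moreover have "((\<theta> ^^ j) \<omega>, rds_iter \<theta> T j \<omega> x) \<notin> N" "((\<theta> ^^ j) \<omega>, rds_iter \<theta> T j \<omega> x') \<notin> N"
      proof -
        have "j \<notin> V x" "j \<notin> V x'" using False VV by auto
        then show "((\<theta> ^^ j) \<omega>, rds_iter \<theta> T j \<omega> x) \<notin> N" "((\<theta> ^^ j) \<omega>, rds_iter \<theta> T j \<omega> x') \<notin> N"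
          using j by (simp_all add: V_def A_def skew_funpow)
      qed
      ultimately have "c ((\<theta> ^^ j) \<omega>, rds_iter \<theta> T j \<omega> x) = c ((\<theta> ^^ j) \<omega>, rds_iter \<theta> T j \<omega> x')"
        using \<omega> by (intro sep) auto
      then show ?thesis using j by (simp add: nm_def skew_funpow)
    qed
  qed
  define s where "s = real (card \<S>)"
  define k where "k = real (card Z)"
  have k1: "k \<ge> 1" using card_Z_pos by (simp add: k_def)
  have s1: "s \<ge> 1"
  proof -
    have "{} \<in> \<S>" using a0 by (simp add: \<S>_def)
    then have "card \<S> > 0" using fin\<S> by (auto simp: card_gt_0_iff)
    then show ?thesis by (simp add: s_def)
  qed
  have lns: "ln s \<le> n * (a - a * ln a)"
  proof -
    have "s \<le> exp (n * (a - a * ln a))"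
      using card_small_subsets[of a n] a0 a unfolding s_def \<S>_def by simp
    then have "ln s \<le> ln (exp (n * (a - a * ln a)))" using s1 by (subst ln_le_cancel_iff) auto
    then show ?thesis by simp
  qed
  define sp where "sp = real (sp_fk \<theta> T \<kappa> \<omega> n \<epsilon>)"
  have sp1: "sp \<ge> 1" using sp_fk_pos[OF reg n \<epsilon>(1)] \<epsilon> a by (simp add: sp_def)
  \<comment> \<open>The factors count the centres, the three sets of times, and the letters at no
    more than 2 * a * n times.\<close>
  define M where "M = sp * (s * (s * (s * k powr (2 * a * n))))"
  have "real (card (nm ` G)) \<le> real (card Q)"
  proof -
    have "finite (g ` G)" using gQ finQ by (rule finite_subset)
    then have "card (nm ` G) \<le> card (g ` G)" by (rule card_image_le_of_factor) (rule g_inj)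
    also have "\<dots> \<le> card Q" by (rule card_mono[OF finQ gQ])
    finally show ?thesis by simp
  qed
  also have "real (card Q) = sp * (s * (\<Sum>E\<in>\<S>. \<Sum>E'\<in>\<S>. k ^ card (E \<union> E')))"
    unfolding Q_def using fin\<S> fin_mem
    by (simp add: card_cartesian_product card_SigmaI card_PiE finite_PiE F(2) sp_def s_def k_def)
  also have "\<dots> \<le> sp * (s * (\<Sum>E\<in>\<S>. \<Sum>E'\<in>\<S>. k powr (2 * a * n)))"
  proof (intro mult_left_mono sum_mono)
    fix E E' assume E: "E \<in> \<S>" "E' \<in> \<S>"
    have "real (card (E \<union> E')) \<le> real (card E) + real (card E')"
      using card_Un_le[of E E'] by linarith
    also have "\<dots> \<le> 2 * a * n" using E by (simp add: \<S>_def)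
    finally have "k powr real (card (E \<union> E')) \<le> k powr (2 * a * n)"
      using k1 by (intro powr_mono) auto
    then show "k ^ card (E \<union> E') \<le> k powr (2 * a * n)" using k1 by (simp add: powr_realpow)
  qed (use s1 sp1 in auto)
  also have "\<dots> = M" by (simp add: M_def s_def)
  finally have cardM: "real (card (nm ` G)) \<le> M" .
  have kp: "k powr (2 * a * n) \<ge> 1" using k1 a0 by (intro ge_one_powr_ge_zero) auto
  have M1: "M \<ge> 1"
  proof -
    have "1 \<le> x * z" if "1 \<le> x" "1 \<le> z" for x z :: real
      using mult_mono[of 1 x 1 z] that by simp
    then show ?thesis unfolding M_def using s1 sp1 kp by blast
  qed
  have lnM: "ln M = ln sp + 3 * ln s + 2 * a * n * ln k"
  proof -
    have "s \<noteq> 0" "sp \<noteq> 0" "k powr (2 * a * n) \<noteq> 0" using s1 sp1 kp by auto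
    then have "ln M = ln sp + (ln s + (ln s + (ln s + ln (k powr (2 * a * n)))))"
      using s1 sp1 kp unfolding M_def by (simp add: ln_mult)
    then show ?thesis using k1 by (simp add: ln_powr)
  qed
  have nmW: "nm ` G \<subseteq> words Z n"
    unfolding nm_def using \<omega> by (auto intro!: name_in_words simp: space_pair_measure)
  have "name_entropy n \<omega> \<le> ln 2 + ln M + (\<Sum>w\<in>words Z n - nm ` G. name_prob n \<omega> w) * ln (card (words Z n))"
    unfolding name_entropy_def
    using nmW cardM M1
    by (intro fin_entropy_concentrated) (auto simp: finite_words name_prob_nonneg sum_name_prob \<omega>)
  also have "(\<Sum>w\<in>words Z n - nm ` G. name_prob n \<omega> w) * ln (card (words Z n)) \<le> 2 * a * (n * ln k)"
  proof (rule mult_mono)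
    have "(\<Sum>w\<in>words Z n - nm ` G. measure (\<kappa> \<omega>) {x. name n (\<omega>, x) = w})
        = measure (\<kappa> \<omega>) {x. name n (\<omega>, x) \<notin> nm ` G}"
    proof (rule sum_fibre_prob[OF \<omega>, where R = "\<lambda>w p. name n p = w" and Q = "\<lambda>p. name n p \<notin> nm ` G"])
      show "finite (words Z n - nm ` G)" by (simp add: finite_words)
      have "{p \<in> space PX. name n p \<notin> nm ` G} = name n -` (- (nm ` G)) \<inter> space PX" by blast
      then show "{p \<in> space PX. name n p \<notin> nm ` G} \<in> sets PX"
        using measurable_sets[OF name_measurable, of "- (nm ` G)"] by simp
      fix p assume "p \<in> space PX" "name n p \<notin> nm ` G"
      then have "name n p \<in> words Z n - nm ` G" by (simp add: name_in_words)
      then show "\<exists>!w\<in>words Z n - nm ` G. name n p = w" by metis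
    qed (simp_all add: name_set)
    then have "(\<Sum>w\<in>words Z n - nm ` G. name_prob n \<omega> w) = measure (\<kappa> \<omega>) {x. nm x \<notin> nm ` G}"
      by (simp add: name_prob_def nm_def)
    also have "\<dots> \<le> measure (\<kappa> \<omega>) (UNIV - G)"
    proof (rule K.finite_measure_mono)
      have "space (\<kappa> \<omega>) - G \<in> sets (\<kappa> \<omega>)"
        unfolding G_def using G1m G2m by (intro sets.compl_sets sets.Diff)
      then show "UNIV - G \<in> sets (\<kappa> \<omega>)" by (simp add: Ksp)
    qed auto
    finally show "(\<Sum>w\<in>words Z n - nm ` G. name_prob n \<omega> w) \<le> 2 * a" using G_compl by linarith
    show "ln (real (card (words Z n))) \<le> n * ln k"
      using card_Z_pos by (simp add: card_words ln_realpow k_def)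
    show "0 \<le> ln (real (card (words Z n)))"
      using card_Z_pos by (simp add: card_words)
  qed (use a0 in auto)
  also have "ln M \<le> ln sp + 3 * (n * (a - a * ln a)) + 2 * a * n * ln k"
    using lns lnM by linarith
  finally show ?thesis by (simp add: sp_def k_def algebra_simps)
qed

text \<open>The radius depends on \<eta> alone, through a and the separation distance r, and not on
  \<omega>. Birkhoff's theorem for the fibre measures of N supplies the hypothesis on visits for all
  large n, by equivariance of the kernel.\<close>

lemma liminf_sp_rate_ge:
  assumes "\<eta> > 0"
  obtains \<epsilon> where "0 < \<epsilon>" "\<epsilon> < 1" "AE \<omega> in P. ereal (entropy_rate - \<eta>) \<le> liminf (sp_rate \<omega> \<epsilon>)"
proof -
  have "ln (card Z) \<ge> 0" using card_Z_pos by simp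
  then obtain a where a: "0 < a" "a < 1" "3 * (a - a * ln a) + 4 * a * ln (card Z) < \<eta> / 2"
    using small_error_term[of "ln (card Z)" "\<eta> / 2"] assms by auto
  have "a * a > 0" using a by simp
  then obtain N r where N: "N \<in> sets PX" "r > 0" "measure \<mu> N < a * a"
    and sep: "\<And>\<omega> x x'. \<omega> \<in> space P \<Longrightarrow> (\<omega>, x) \<notin> N \<Longrightarrow> (\<omega>, x') \<notin> N \<Longrightarrow> dist x x' < r \<Longrightarrow>
      c (\<omega>, x) = c (\<omega>, x')"
    using code_separated by metis
  \<comment> \<open>The bound a limits the unmatched times, and r / 2 makes two points that are
    \<epsilon>-close to a third one r-close.\<close>
  define \<epsilon> where "\<epsilon> = min a (r / 2)"
  have \<epsilon>: "0 < \<epsilon>" "\<epsilon> \<le> a" "2 * \<epsilon> \<le> r" using a N(2) by (auto simp: \<epsilon>_def)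
  define v where "v \<omega> = min 1 (measure (\<kappa> \<omega>) (Pair \<omega> -` N))" for \<omega>
  have v: "v \<omega> = measure (\<kappa> \<omega>) (Pair \<omega> -` N)" if "\<omega> \<in> space P" for \<omega>
    using prob_space.prob_le_1[OF kernel_prob[OF that]] by (simp add: v_def)
  have vm: "v \<in> borel_measurable P"
    unfolding v_def[abs_def] using measure_section_measurable[OF N(1)] by measurable
  have "(\<integral>\<omega>. v \<omega> \<partial>P) = measure \<mu> N"
    unfolding measure_\<mu>[OF N(1)] by (intro Bochner_Integration.integral_cong refl v)
  then have visits: "AE \<omega> in P. \<forall>\<^sub>F n in sequentially. birkhoff_sum \<theta> v n \<omega> \<le> a * a * real n"
    using N(3) by (intro birkhoff_upper[OF prob_space_axioms base_ergodic vm, where B = 1])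
      (auto simp: v_def)
  have "AE \<omega> in P. \<forall>i. measure (\<kappa> \<omega>) {x. (\<Theta> ^^ i) (\<omega>, x) \<in> N}
    = measure (\<kappa> ((\<theta> ^^ i) \<omega>)) (Pair ((\<theta> ^^ i) \<omega>) -` N)"
    unfolding AE_all_countable using kernel_equivariant[OF N(1)] by blast
  moreover have "AE \<omega> in P. \<forall>\<^sub>F n in sequentially. (entropy_rate - \<eta> / 4) * real n \<le> name_entropy n \<omega>"
    using assms by (intro name_entropy_eventually_ge) simp
  ultimately have "AE \<omega> in P. ereal (entropy_rate - \<eta>) \<le> liminf (sp_rate \<omega> \<epsilon>)"
    using visits AE_regular
  proof eventually_elim
    case (elim \<omega>)
    have \<omega>: "\<omega> \<in> space P" using elim(4) by (simp add: regular_def)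
    \<comment> \<open>The loss \<eta> is shared out: \<eta> / 4 for the ergodic theorem, \<eta> / 4
      for the constant ln 2, and \<eta> / 2 for the error term.\<close>
    obtain m :: nat where m: "real m \<ge> 4 * ln 2 / \<eta>" using real_arch_simple by blast
    have "\<forall>\<^sub>F n in sequentially. ereal (entropy_rate - \<eta>) \<le> sp_rate \<omega> \<epsilon> n"
      using elim(2,3) eventually_gt_at_top[of 0] eventually_ge_at_top[of m]
    proof eventually_elim
      case (elim n)
      have "birkhoff_sum \<theta> v n \<omega> = (\<Sum>i<n. measure (\<kappa> \<omega>) {x. (\<Theta> ^^ i) (\<omega>, x) \<in> N})"
        unfolding birkhoff_sum_def
        using \<open>\<forall>i. measure (\<kappa> \<omega>) {x. (\<Theta> ^^ i) (\<omega>, x) \<in> N} = _ i\<close> \<omega> by (intro sum.cong) (simp_all add: v)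
      then have "name_entropy n \<omega> \<le> ln 2 + ln (sp_fk \<theta> T \<kappa> \<omega> n \<epsilon>)
          + n * (3 * (a - a * ln a) + 4 * a * ln (card Z))"
        using elim by (intro name_entropy_le_sp_fk[OF \<open>regular \<omega>\<close> _ \<epsilon> a(2) N(1) sep]) auto
      also have "n * (3 * (a - a * ln a) + 4 * a * ln (card Z)) \<le> n * (\<eta> / 2)"
        using a(3) by (intro mult_left_mono) auto
      also have "ln 2 \<le> n * (\<eta> / 4)"
      proof -
        have "4 * ln 2 / \<eta> \<le> n" using m elim by linarith
        then show ?thesis using assms by (simp add: divide_simps mult.commute)
      qed
      finally have "(entropy_rate - \<eta>) * n \<le> ln (sp_fk \<theta> T \<kappa> \<omega> n \<epsilon>)"
        using elim(1) by (simp add: algebra_simps)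
      then show ?case using elim by (simp add: sp_rate_def pos_le_divide_eq)
    qed
    then show ?case by (rule Liminf_bounded)
  qed
  then show ?thesis using that \<epsilon> a by force
qed

end

section \<open>The upper bound\<close>

context coded_disintegration
begin

section \<open>Code lengths of blocks of k letters\<close>

lemma name_measurable_words: "name n \<in> PX \<rightarrow>\<^sub>M count_space (words Z n)"
proof (subst measurable_count_space_eq2[OF finite_words[OF finite_Z]], intro conjI ballI)
  show "name n \<in> space PX \<rightarrow> words Z n" by (intro funcsetI name_in_words)
  show "name n -` {w} \<inter> space PX \<in> sets PX" for w
    using measurable_sets[OF name_measurable, of "{w}"] by simp
qed

lemma Z_nonempty: "Z \<noteq> {}"
  using card_Z_pos by auto

text \<open>Mixing with the uniform distribution keeps the code length \<open>- ln (word_weight k \<omega> w)\<close> bounded.\<close>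
definition word_weight :: "nat \<Rightarrow> 'w \<Rightarrow> 'b list \<Rightarrow> real" where
  "word_weight k \<omega> w = (name_prob k \<omega> w + 1 / real (card Z) ^ k) / 2"

definition code_length :: "nat \<Rightarrow> 'w \<times> 'x \<Rightarrow> real" where
  "code_length k p = - ln (word_weight k (fst p) (name k p))"

lemma word_weight_measurable [measurable]: "(\<lambda>\<omega>. word_weight k \<omega> w) \<in> borel_measurable P"
  unfolding word_weight_def by measurable

lemma word_weight_pos: "word_weight k \<omega> w > 0"
proof -
  have "1 / real (card Z) ^ k > 0" using card_Z_pos by simp
  then show ?thesis using name_prob_nonneg[of k \<omega> w] by (simp add: word_weight_def add_nonneg_pos)
qed

lemma word_weight_le_1: "\<omega> \<in> space P \<Longrightarrow> word_weight k \<omega> w \<le> 1"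
proof -
  assume "\<omega> \<in> space P"
  moreover have "1 / real (card Z) ^ k \<le> 1" using card_Z_pos by (simp add: divide_simps)
  ultimately show ?thesis using name_prob_le_1[of \<omega> k w] by (simp add: word_weight_def)
qed

lemma sum_word_weight: "\<omega> \<in> space P \<Longrightarrow> (\<Sum>w\<in>words Z k. word_weight k \<omega> w) = 1"
  using card_Z_pos Z_nonempty unfolding word_weight_def
  by (simp add: sum_divide_distrib[symmetric] sum.distrib sum_name_prob card_words)

lemma code_length_nonneg: "p \<in> space PX \<Longrightarrow> 0 \<le> code_length k p"
  using word_weight_le_1[of "fst p" k "name k p"] word_weight_pos[of k "fst p" "name k p"]
  by (auto simp: code_length_def space_pair_measure)

lemma neg_ln_word_weight_le: "- ln (word_weight k \<omega> w) \<le> ln 2 + k * ln (card Z)"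
proof -
  have "1 / (2 * real (card Z) ^ k) \<le> word_weight k \<omega> w"
    using name_prob_nonneg[of k \<omega> w] by (simp add: word_weight_def)
  then have "ln (1 / (2 * real (card Z) ^ k)) \<le> ln (word_weight k \<omega> w)"
    using card_Z_pos word_weight_pos[of k \<omega> w] by (subst ln_le_cancel_iff) auto
  then show ?thesis using card_Z_pos Z_nonempty by (simp add: ln_div ln_mult ln_realpow)
qed

lemma code_length_bound:
  assumes "p \<in> space PX"
  shows "\<bar>code_length k p\<bar> \<le> ln 2 + k * ln (card Z)"
  using code_length_nonneg[OF assms, of k] neg_ln_word_weight_le[of k "fst p" "name k p"]
  by (simp add: code_length_def)

lemma code_length_measurable [measurable]: "code_length k \<in> borel_measurable PX"
proof -
  have "(\<lambda>p. (\<lambda>w p. - ln (word_weight k (fst p) w)) (name k p) p) \<in> borel_measurable PX"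
  proof (rule measurable_compose_countable'[OF _ name_measurable_words])
    show "countable (words Z k)" by (simp add: countable_finite finite_words)
    have "(\<lambda>p. word_weight k (fst p) w) \<in> borel_measurable PX" for w
      using measurable_compose[OF measurable_fst word_weight_measurable] .
    then show "(\<lambda>p. - ln (word_weight k (fst p) w)) \<in> borel_measurable PX" for w
      by measurable
  qed
  then show ?thesis by (simp add: code_length_def[abs_def])
qed

lemma nn_integral_indicator_fst:
  assumes S: "S \<in> sets PX" and h: "h \<in> borel_measurable P"
  shows "(\<integral>\<^sup>+p. indicator S p * h (fst p) \<partial>\<mu>) = (\<integral>\<^sup>+\<omega>. emeasure (\<kappa> \<omega>) (Pair \<omega> -` S) * h \<omega> \<partial>P)"
proof -
  have fstm: "fst \<in> \<mu> \<rightarrow>\<^sub>M P"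
    using measurable_fst[of P "borel :: 'x measure"] measurable_cong_sets[OF sets_\<mu> refl] by simp
  have S\<mu>: "S \<in> sets \<mu>" using S sets_\<mu> by simp
  have "distr (density \<mu> (indicator S)) P fst = density P (\<lambda>\<omega>. emeasure (\<kappa> \<omega>) (Pair \<omega> -` S))"
  proof (rule measure_eqI)
    fix A assume "A \<in> sets (distr (density \<mu> (indicator S)) P fst)"
    then have A: "A \<in> sets P" by simp
    have AP: "fst -` A \<inter> space \<mu> = A \<times> UNIV"
      using sets.sets_into_space[OF A] by (auto simp: space_\<mu>)
    have AU: "A \<times> UNIV \<in> sets PX" using A by (intro pair_measureI) auto
    have "emeasure (distr (density \<mu> (indicator S)) P fst) A = emeasure (density \<mu> (indicator S)) (A \<times> UNIV)"
      using A fstm by (subst emeasure_distr) (auto simp: AP)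
    also have "\<dots> = (\<integral>\<^sup>+p. indicator S p * indicator (A \<times> UNIV) p \<partial>\<mu>)"
      using S\<mu> AU by (subst emeasure_density) (auto simp: sets_\<mu>)
    also have "\<dots> = (\<integral>\<^sup>+p. indicator (S \<inter> A \<times> UNIV) p \<partial>\<mu>)"
      by (intro nn_integral_cong) (auto simp: indicator_def)
    also have "\<dots> = emeasure \<mu> (S \<inter> A \<times> UNIV)"
      using S AU by (intro nn_integral_indicator) (auto simp: sets_\<mu>)
    also have "\<dots> = (\<integral>\<^sup>+\<omega>. emeasure (\<kappa> \<omega>) (Pair \<omega> -` (S \<inter> A \<times> UNIV)) \<partial>P)"
      using S AU by (intro emeasure_\<mu>) auto
    also have "\<dots> = (\<integral>\<^sup>+\<omega>. emeasure (\<kappa> \<omega>) (Pair \<omega> -` S) * indicator A \<omega> \<partial>P)"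
      by (intro nn_integral_cong) (auto simp: indicator_def)
    also have "\<dots> = emeasure (density P (\<lambda>\<omega>. emeasure (\<kappa> \<omega>) (Pair \<omega> -` S))) A"
      using A S by (intro emeasure_density[symmetric] emeasure_section_measurable)
    finally show "emeasure (distr (density \<mu> (indicator S)) P fst) A
        = emeasure (density P (\<lambda>\<omega>. emeasure (\<kappa> \<omega>) (Pair \<omega> -` S))) A" .
  qed simp
  note eq = this
  have "(\<integral>\<^sup>+p. indicator S p * h (fst p) \<partial>\<mu>) = (\<integral>\<^sup>+p. h (fst p) \<partial>density \<mu> (indicator S))"
    using S\<mu> h measurable_compose[OF fstm h] by (subst nn_integral_density) auto
  also have "\<dots> = (\<integral>\<^sup>+\<omega>. h \<omega> \<partial>distr (density \<mu> (indicator S)) P fst)"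
    using fstm h by (subst nn_integral_distr) auto
  also have "\<dots> = (\<integral>\<^sup>+\<omega>. emeasure (\<kappa> \<omega>) (Pair \<omega> -` S) * h \<omega> \<partial>P)"
    unfolding eq using h S by (intro nn_integral_density emeasure_section_measurable)
  finally show ?thesis .
qed

text \<open>A word weighs at least half its probability, so its code is at most ln 2 longer than the
  ideal one, whose mean in a fibre is the entropy.\<close>

lemma mean_code_length_le:
  "(\<integral>p. code_length k p \<partial>\<mu>) \<le> ln 2 + (\<integral>\<omega>. name_entropy k \<omega> \<partial>P)"
proof -
  define S where "S w = {p \<in> space PX. name k p = w}" for w
  have Sm: "S w \<in> sets PX" for w unfolding S_def by (rule name_set)
  \<comment> \<open>On the space this agrees with the code length; the maximum makes it nonnegative
    for every \<omega>, as the nonnegative integral requires.\<close>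
  define l where "l w \<omega> = max 0 (- ln (word_weight k \<omega> w))" for w \<omega>
  have lm [measurable]: "l w \<in> borel_measurable P" for w unfolding l_def[abs_def] by measurable
  have l0: "0 \<le> l w \<omega>" for w \<omega> by (simp add: l_def)
  have sec: "emeasure (\<kappa> \<omega>) (Pair \<omega> -` S w) = ennreal (name_prob k \<omega> w)" if "\<omega> \<in> space P" for w \<omega>
  proof -
    have "Pair \<omega> -` S w = {x. name k (\<omega>, x) = w}"
      using that by (auto simp: S_def space_pair_measure)
    then show ?thesis
      by (simp add: name_prob_def finite_measure.emeasure_eq_measure[OF prob_space.finite_measure[OF kernel_prob[OF that]]])
  qed
  have cJ: "ennreal (code_length k p) = (\<Sum>w\<in>words Z k. indicator (S w) p * ennreal (l w (fst p)))"
    if p: "p \<in> space PX" for p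
  proof -
    have "(\<Sum>w\<in>words Z k. indicator (S w) p * ennreal (l w (fst p)))
        = (\<Sum>w\<in>words Z k. if name k p = w then ennreal (l w (fst p)) else 0)"
      using p by (intro sum.cong refl) (auto simp: S_def indicator_def)
    also have "\<dots> = ennreal (l (name k p) (fst p))"
      using name_in_words[OF p, of k] finite_words[OF finite_Z, of k] by simp
    also have "l (name k p) (fst p) = code_length k p"
      using code_length_nonneg[OF p, of k] by (simp add: l_def code_length_def)
    finally show ?thesis by simp
  qed
  have ent: "(\<Sum>w\<in>words Z k. name_prob k \<omega> w * l w \<omega>) \<le> ln 2 + name_entropy k \<omega>"
    if \<omega>: "\<omega> \<in> space P" for \<omega>
  proof -
    have "name_prob k \<omega> w * l w \<omega> \<le> name_prob k \<omega> w * ln 2 - name_prob k \<omega> w * ln (name_prob k \<omega> w)" for w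
    proof (cases "name_prob k \<omega> w = 0")
      case False
      then have p0: "name_prob k \<omega> w > 0" using name_prob_nonneg[of k \<omega> w] by simp
      have "name_prob k \<omega> w / 2 \<le> word_weight k \<omega> w" by (simp add: word_weight_def)
      then have "ln (name_prob k \<omega> w / 2) \<le> ln (word_weight k \<omega> w)"
        using p0 word_weight_pos[of k \<omega> w] by (subst ln_le_cancel_iff) auto
      then have "- ln (word_weight k \<omega> w) \<le> ln 2 - ln (name_prob k \<omega> w)" using p0 by (simp add: ln_div)
      moreover have "ln (name_prob k \<omega> w) \<le> 0" using p0 name_prob_le_1[OF \<omega>, of k w] by simp
      then have "0 \<le> ln 2 - ln (name_prob k \<omega> w)" using ln_ge_zero[of "2::real"] by linarith
      ultimately have "l w \<omega> \<le> ln 2 - ln (name_prob k \<omega> w)" by (simp add: l_def)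
      then have "name_prob k \<omega> w * l w \<omega> \<le> name_prob k \<omega> w * (ln 2 - ln (name_prob k \<omega> w))"
        using p0 by (intro mult_left_mono) auto
      then show ?thesis by (simp add: right_diff_distrib)
    qed simp
    then have "(\<Sum>w\<in>words Z k. name_prob k \<omega> w * l w \<omega>)
        \<le> (\<Sum>w\<in>words Z k. name_prob k \<omega> w * ln 2 - name_prob k \<omega> w * ln (name_prob k \<omega> w))"
      by (intro sum_mono)
    also have "\<dots> = ln 2 + name_entropy k \<omega>"
      using sum_name_prob[OF \<omega>, of k]
      by (simp add: sum_subtractf sum_distrib_right[symmetric] name_entropy_def fin_entropy_def)
    finally show ?thesis .
  qed
  have "(\<integral>\<^sup>+p. ennreal (code_length k p) \<partial>\<mu>)
      = (\<integral>\<^sup>+p. (\<Sum>w\<in>words Z k. indicator (S w) p * ennreal (l w (fst p))) \<partial>\<mu>)"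
    using cJ by (intro nn_integral_cong) (simp add: space_\<mu> space_pair_measure)
  also have "\<dots> = (\<Sum>w\<in>words Z k. \<integral>\<^sup>+p. indicator (S w) p * ennreal (l w (fst p)) \<partial>\<mu>)"
  proof (rule nn_integral_sum)
    fix w
    have "(\<lambda>p. ennreal (l w (fst p))) \<in> borel_measurable PX"
      using measurable_compose[OF measurable_fst lm] by measurable
    then have "(\<lambda>p. indicator (S w) p * ennreal (l w (fst p))) \<in> borel_measurable PX"
      using Sm by measurable
    then show "(\<lambda>p. indicator (S w) p * ennreal (l w (fst p))) \<in> borel_measurable \<mu>"
      using measurable_cong_sets[OF sets_\<mu> refl] by simp
  qed
  also have "\<dots> = (\<Sum>w\<in>words Z k. \<integral>\<^sup>+\<omega>. emeasure (\<kappa> \<omega>) (Pair \<omega> -` S w) * ennreal (l w \<omega>) \<partial>P)"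
    by (intro sum.cong refl nn_integral_indicator_fst Sm measurable_compose[OF lm measurable_ennreal])
  also have "\<dots> = (\<Sum>w\<in>words Z k. \<integral>\<^sup>+\<omega>. ennreal (name_prob k \<omega> w * l w \<omega>) \<partial>P)"
    by (intro sum.cong refl nn_integral_cong) (simp add: sec ennreal_mult name_prob_nonneg l0)
  also have "\<dots> = (\<integral>\<^sup>+\<omega>. (\<Sum>w\<in>words Z k. ennreal (name_prob k \<omega> w * l w \<omega>)) \<partial>P)"
    by (intro nn_integral_sum[symmetric]) measurable
  also have "\<dots> \<le> (\<integral>\<^sup>+\<omega>. ennreal (ln 2 + name_entropy k \<omega>) \<partial>P)"
    using ent by (intro nn_integral_mono) (simp add: sum_ennreal name_prob_nonneg l0 ennreal_leI)
  also have "\<dots> = ennreal (\<integral>\<omega>. ln 2 + name_entropy k \<omega> \<partial>P)"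
    using name_entropy_integrable name_entropy_nonneg
    by (intro nn_integral_eq_integral) (auto intro!: add_nonneg_nonneg)
  also have "(\<integral>\<omega>. ln 2 + name_entropy k \<omega> \<partial>P) = ln 2 + (\<integral>\<omega>. name_entropy k \<omega> \<partial>P)"
    using name_entropy_integrable by (simp add: prob_space)
  finally have le: "(\<integral>\<^sup>+p. ennreal (code_length k p) \<partial>\<mu>) \<le> ennreal (ln 2 + (\<integral>\<omega>. name_entropy k \<omega> \<partial>P))" .
  have "(\<integral>\<omega>. name_entropy k \<omega> \<partial>P) \<ge> 0"
    using name_entropy_nonneg by (intro Bochner_Integration.integral_nonneg_AE) auto
  then have nn: "0 \<le> ln 2 + (\<integral>\<omega>. name_entropy k \<omega> \<partial>P)" by simp
  have "code_length k \<in> borel_measurable \<mu>"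
    using code_length_measurable measurable_cong_sets[OF sets_\<mu> refl] by simp
  then have "(\<integral>p. code_length k p \<partial>\<mu>) = enn2real (\<integral>\<^sup>+p. ennreal (code_length k p) \<partial>\<mu>)"
    using code_length_nonneg by (intro integral_eq_nn_integral) (auto simp: space_\<mu> space_pair_measure)
  also have "\<dots> \<le> ln 2 + (\<integral>\<omega>. name_entropy k \<omega> \<partial>P)"
    using enn2real_mono[OF le] nn by simp
  finally show ?thesis .
qed

text \<open>The law of m independent blocks of k letters, each drawn with the weights of the base
  point over which it starts.\<close>

primrec block_weight :: "nat \<Rightarrow> nat \<Rightarrow> 'w \<Rightarrow> 'b list \<Rightarrow> real" where
  "block_weight k 0 \<omega> w = 1"
| "block_weight k (Suc m) \<omega> w =
     word_weight k \<omega> (take k w) * block_weight k m ((\<theta> ^^ k) \<omega>) (drop k w)"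

lemma block_weight_pos: "block_weight k m \<omega> w > 0"
  by (induction m arbitrary: \<omega> w) (auto simp: word_weight_pos)

lemma sum_block_weight:
  "\<omega> \<in> space P \<Longrightarrow> (\<Sum>w\<in>words Z (m * k). block_weight k m \<omega> w) = 1"
proof (induction m arbitrary: \<omega>)
  case 0
  have "words Z 0 = {[]}" by (auto simp: words_def)
  then show ?case by simp
next
  case (Suc m)
  have "(\<Sum>w\<in>words Z (Suc m * k). block_weight k (Suc m) \<omega> w)
      = (\<Sum>(u, v)\<in>words Z k \<times> words Z (m * k). block_weight k (Suc m) \<omega> (u @ v))"
    using sum.reindex_bij_betw[OF bij_betw_words_append, of "block_weight k (Suc m) \<omega>" Z k "m * k"]
    by (simp add: split_def)
  also have "\<dots> = (\<Sum>(u, v)\<in>words Z k \<times> words Z (m * k). word_weight k \<omega> u * block_weight k m ((\<theta> ^^ k) \<omega>) v)"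
    by (intro sum.cong) (auto simp: words_def)
  also have "\<dots> = (\<Sum>u\<in>words Z k. word_weight k \<omega> u) * (\<Sum>v\<in>words Z (m * k). block_weight k m ((\<theta> ^^ k) \<omega>) v)"
    by (simp add: sum_product sum.cartesian_product)
  finally show ?case using Suc by (simp add: sum_word_weight)
qed

lemma block_weight_name:
  "block_weight k m (fst p) (name (m * k) p) = exp (- (\<Sum>i<m. code_length k ((\<Theta> ^^ (i * k)) p)))"
proof (induction m arbitrary: p)
  case (Suc m)
  have fst_pow: "fst ((\<Theta> ^^ k) p) = (\<theta> ^^ k) (fst p)"
    by (cases p) (simp add: skew_funpow)
  have "block_weight k (Suc m) (fst p) (name (Suc m * k) p)
      = word_weight k (fst p) (name k p) * block_weight k m (fst ((\<Theta> ^^ k) p)) (name (m * k) ((\<Theta> ^^ k) p))"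
    by (simp add: name_append fst_pow)
  also have "word_weight k (fst p) (name k p) = exp (- code_length k p)"
    using word_weight_pos[of k "fst p" "name k p"] by (simp add: code_length_def)
  also have "block_weight k m (fst ((\<Theta> ^^ k) p)) (name (m * k) ((\<Theta> ^^ k) p))
      = exp (- (\<Sum>i<m. code_length k ((\<Theta> ^^ (Suc i * k)) p)))"
  proof -
    have "(\<Theta> ^^ (i * k)) ((\<Theta> ^^ k) p) = (\<Theta> ^^ (Suc i * k)) p" for i
      by (simp only: mult_Suc add.commute[of k] funpow_add o_apply)
    then show ?thesis unfolding Suc by simp
  qed
  also have "exp (- code_length k p) * exp (- (\<Sum>i<m. code_length k ((\<Theta> ^^ (Suc i * k)) p)))
      = exp (- (\<Sum>i<Suc m. code_length k ((\<Theta> ^^ (i * k)) p)))"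
    by (subst sum.lessThan_Suc_shift) (simp add: exp_add[symmetric] del: sum.lessThan_Suc)
  finally show ?case .
qed simp

text \<open>Weights that sum to 1 leave room for at most \<open>exp t\<close> words of weight
  \<open>exp (- t)\<close> or more.\<close>

lemma card_heavy_blocks:
  assumes "\<omega> \<in> space P"
  shows "real (card {w \<in> words Z (m * k). exp (- t) \<le> block_weight k m \<omega> w}) \<le> exp t"
proof -
  let ?H = "{w \<in> words Z (m * k). exp (- t) \<le> block_weight k m \<omega> w}"
  have "real (card ?H) * exp (- t) = (\<Sum>w\<in>?H. exp (- t))" by simp
  also have "\<dots> \<le> (\<Sum>w\<in>?H. block_weight k m \<omega> w)" by (intro sum_mono) auto
  also have "\<dots> \<le> (\<Sum>w\<in>words Z (m * k). block_weight k m \<omega> w)"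
    using block_weight_pos by (intro sum_mono2) (auto simp: finite_words less_imp_le)
  also have "\<dots> = 1" by (rule sum_block_weight[OF assms])
  finally show ?thesis by (simp add: exp_minus field_simps)
qed

text \<open>One of the \<open>k\<close> ways of cutting a name of small total code length into blocks of length \<open>k\<close>
  gives a heavy word.\<close>
lemma card_cheap_names:
  assumes \<omega>: "\<omega> \<in> space P" and k: "0 < k" "k \<le> n"
    and G: "\<And>x. x \<in> G \<Longrightarrow> birkhoff_sum \<Theta> (code_length k) n (\<omega>, x) \<le> t * k"
  shows "real (card ((\<lambda>x. name n (\<omega>, x)) ` G)) \<le> k * real (card Z) ^ (2 * k) * exp t"
proof -
  \<comment> \<open>One block fewer than fits, so that m whole blocks fit into n letters from every
    starting time j < k.\<close>
  define m where "m = n div k - 1"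
  have nd: "1 \<le> n div k" using k by (simp add: div_greater_zero_iff Suc_le_eq)
  have mk: "m * k + k = n div k * k" unfolding m_def using nd by (simp add: diff_mult_distrib)
  have le: "m * k + k \<le> n" "n - m * k \<le> 2 * k"
  proof -
    show "m * k + k \<le> n" unfolding mk by simp
    have "n < n div k * k + k" using div_mult_mod_eq[of n k] mod_less_divisor[OF k(1), of n] by linarith
    then show "n - m * k \<le> 2 * k" using mk by linarith
  qed
  have sp: "(\<Theta> ^^ i) (\<omega>, x) \<in> space PX" for i x
    using \<omega> by (intro measurable_space[OF skew_funpow_measurable]) (simp add: space_pair_measure)
  \<comment> \<open>The times i * k + j with i < m and j < k run once through all times below m * k.
    The k phases thus share a total of at most t * k, and one of them gets at most t.\<close>
  have "\<exists>j<k. (\<Sum>i<m. code_length k ((\<Theta> ^^ (i * k)) ((\<Theta> ^^ j) (\<omega>, x)))) \<le> t" if x: "x \<in> G" for x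
  proof (rule ccontr)
    assume neg: "\<not> (\<exists>j<k. (\<Sum>i<m. code_length k ((\<Theta> ^^ (i * k)) ((\<Theta> ^^ j) (\<omega>, x)))) \<le> t)"
    have "t * k = (\<Sum>j<k. t)" by simp
    also have "\<dots> < (\<Sum>j<k. \<Sum>i<m. code_length k ((\<Theta> ^^ (i * k)) ((\<Theta> ^^ j) (\<omega>, x))))"
      using neg k by (intro sum_strict_mono) (auto simp: not_le)
    also have "\<dots> = (\<Sum>i<m. \<Sum>j<k. code_length k ((\<Theta> ^^ (i * k + j)) (\<omega>, x)))"
      by (subst sum.swap) (simp add: funpow_add)
    also have "\<dots> = (\<Sum>i<m. \<Sum>l\<in>{i * k..<i * k + k}. code_length k ((\<Theta> ^^ l) (\<omega>, x)))"
    proof (rule sum.cong[OF refl])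
      fix i
      show "(\<Sum>j<k. code_length k ((\<Theta> ^^ (i * k + j)) (\<omega>, x)))
          = (\<Sum>l\<in>{i * k..<i * k + k}. code_length k ((\<Theta> ^^ l) (\<omega>, x)))"
        by (rule sum.reindex_bij_witness[of _ "\<lambda>l. l - i * k" "\<lambda>j. i * k + j"]) auto
    qed
    also have "\<dots> = (\<Sum>l<m * k. code_length k ((\<Theta> ^^ l) (\<omega>, x)))"
      by (rule sum.nat_group)
    also have "\<dots> \<le> (\<Sum>l<n. code_length k ((\<Theta> ^^ l) (\<omega>, x)))"
      using le(1) code_length_nonneg[OF sp] by (intro sum_mono2) auto
    also have "\<dots> \<le> t * k" using G[OF x] by (simp add: birkhoff_sum_def)
    finally show False by simp
  qed
  then obtain j where j: "\<And>x. x \<in> G \<Longrightarrow> j x < k"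
    "\<And>x. x \<in> G \<Longrightarrow> (\<Sum>i<m. code_length k ((\<Theta> ^^ (i * k)) ((\<Theta> ^^ j x) (\<omega>, x)))) \<le> t"
    by metis
  define H where "H i = {w \<in> words Z (m * k). exp (- t) \<le> block_weight k m ((\<theta> ^^ i) \<omega>) w}" for i
  \<comment> \<open>Prefix, heavy middle and suffix. Prefix and suffix together have n - m * k \<le>
    2 * k letters, counted without any saving.\<close>
  define C where "C i = words Z i \<times> H i \<times> words Z (n - i - m * k)" for i
  have finH: "finite (H i)" for i unfolding H_def using finite_words[OF finite_Z] by simp
  have finC: "finite (C i)" for i unfolding C_def using finite_words[OF finite_Z] finH by simp
  have fin: "finite (\<Union>i<k. (\<lambda>(u, v, w). u @ v @ w) ` C i)" using finC by simp
  have "(\<lambda>x. name n (\<omega>, x)) ` G \<subseteq> (\<Union>i<k. (\<lambda>(u, v, w). u @ v @ w) ` C i)"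
  proof (rule image_subsetI)
    fix x assume x: "x \<in> G"
    define i where "i = j x"
    define p where "p = (\<omega>, x)"
    have i: "i < k" using j(1)[OF x] by (simp add: i_def)
    have n: "n = i + (m * k + (n - i - m * k))" using i le(1) by linarith
    have "name n p = name i p @ name (m * k) ((\<Theta> ^^ i) p) @ name (n - i - m * k) ((\<Theta> ^^ (m * k)) ((\<Theta> ^^ i) p))"
      by (subst n) (simp only: name_append)
    moreover have "name i p \<in> words Z i" using sp[of 0 x] by (intro name_in_words) (simp add: p_def)
    moreover have "name (n - i - m * k) ((\<Theta> ^^ (m * k)) ((\<Theta> ^^ i) p)) \<in> words Z (n - i - m * k)"
      using sp[of "m * k + i" x] by (intro name_in_words) (simp add: p_def funpow_add)
    moreover have "name (m * k) ((\<Theta> ^^ i) p) \<in> H i"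
    proof -
      have "fst ((\<Theta> ^^ i) p) = (\<theta> ^^ i) \<omega>" by (simp add: p_def skew_funpow)
      then have "block_weight k m ((\<theta> ^^ i) \<omega>) (name (m * k) ((\<Theta> ^^ i) p))
          = exp (- (\<Sum>l<m. code_length k ((\<Theta> ^^ (l * k)) ((\<Theta> ^^ i) p))))"
        using block_weight_name[of k m "(\<Theta> ^^ i) p"] by simp
      then have "exp (- t) \<le> block_weight k m ((\<theta> ^^ i) \<omega>) (name (m * k) ((\<Theta> ^^ i) p))"
        using j(2)[OF x] by (simp add: i_def p_def)
      moreover have "name (m * k) ((\<Theta> ^^ i) p) \<in> words Z (m * k)"
        unfolding p_def by (intro name_in_words sp)
      ultimately show ?thesis by (simp add: H_def)
    qed
    ultimately have "name n p \<in> (\<lambda>(u, v, w). u @ v @ w) ` C i"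
      unfolding C_def by (intro image_eqI[of _ _ "(name i p, name (m * k) ((\<Theta> ^^ i) p),
        name (n - i - m * k) ((\<Theta> ^^ (m * k)) ((\<Theta> ^^ i) p)))"]) simp_all
    then show "name n (\<omega>, x) \<in> (\<Union>i<k. (\<lambda>(u, v, w). u @ v @ w) ` C i)"
      unfolding p_def by (rule UN_I[rotated]) (simp add: i)
  qed
  then have "card ((\<lambda>x. name n (\<omega>, x)) ` G) \<le> card (\<Union>i<k. (\<lambda>(u, v, w). u @ v @ w) ` C i)"
    by (rule card_mono[OF fin])
  also have "\<dots> \<le> (\<Sum>i<k. card ((\<lambda>(u, v, w). u @ v @ w) ` C i))" by (intro card_UN_le) simp
  also have "\<dots> \<le> (\<Sum>i<k. card (C i))" by (intro sum_mono card_image_le finC)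
  finally have "real (card ((\<lambda>x. name n (\<omega>, x)) ` G)) \<le> (\<Sum>i<k. real (card (C i)))"
    by (simp flip: of_nat_sum)
  also have "\<dots> \<le> (\<Sum>i<k. real (card Z) ^ (2 * k) * exp t)"
  proof (rule sum_mono)
    fix i assume "i \<in> {..<k}"
    then have i: "i < k" by simp
    have "real (card (C i)) = real (card Z) ^ (i + (n - i - m * k)) * real (card (H i))"
      by (simp add: C_def card_cartesian_product card_words power_add)
    also have "\<dots> \<le> real (card Z) ^ (2 * k) * exp t"
    proof (rule mult_mono)
      have "i + (n - i - m * k) \<le> 2 * k" using i le by linarith
      then show "real (card Z) ^ (i + (n - i - m * k)) \<le> real (card Z) ^ (2 * k)"
        using card_Z_pos by (intro power_increasing) auto
      show "real (card (H i)) \<le> exp t"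
        unfolding H_def using \<omega> by (intro card_heavy_blocks) simp
    qed simp_all
    finally show "real (card (C i)) \<le> real (card Z) ^ (2 * k) * exp t" .
  qed
  finally show ?thesis by simp
qed

text \<open>One centre is chosen in G for each name occurring there. Points with equal names stay
  e-close at all n times, so the identity match puts them into the ball of that centre.\<close>

lemma sp_fk_le_card_names:
  assumes reg: "regular \<omega>" and n: "n > 0" and e: "0 < e" "e < \<epsilon>"
    and close: "\<And>\<omega> x x'. \<omega> \<in> space P \<Longrightarrow> c (\<omega>, x) = c (\<omega>, x') \<Longrightarrow> dist x x' < e"
    and G: "measure (\<kappa> \<omega>) G > 1 - \<epsilon>"
  shows "sp_fk \<theta> T \<kappa> \<omega> n \<epsilon> \<le> card ((\<lambda>x. name n (\<omega>, x)) ` G)"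
proof -
  have \<omega>: "\<omega> \<in> space P" using reg by (simp add: regular_def)
  interpret K: prob_space "\<kappa> \<omega>" by (rule kernel_prob[OF \<omega>])
  define nm where "nm x = name n (\<omega>, x)" for x
  define s where "s w = (SOME x. x \<in> G \<and> nm x = w)" for w
  have s: "s (nm x) \<in> G \<and> nm (s (nm x)) = nm x" if "x \<in> G" for x
    unfolding s_def by (rule someI[of _ x]) (use that in auto)
  define F where "F = s ` nm ` G"
  have "nm ` G \<subseteq> words Z n"
    unfolding nm_def using \<omega> by (auto intro!: name_in_words simp: space_pair_measure)
  then have finN: "finite (nm ` G)" using finite_words[OF finite_Z] by (rule finite_subset)
  then have finF: "finite F" by (simp add: F_def)
  have "G \<subseteq> (\<Union>y\<in>F. fk_ball \<theta> T \<omega> n y \<epsilon>)"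
  proof
    fix x assume x: "x \<in> G"
    have "dist (rds_iter \<theta> T i \<omega> (s (nm x))) (rds_iter \<theta> T i \<omega> x) < e" if i: "i < n" for i
    proof (rule close[of "(\<theta> ^^ i) \<omega>"])
      have "nm (s (nm x)) ! i = nm x ! i" using s[OF x] by simp
      then show "c ((\<theta> ^^ i) \<omega>, rds_iter \<theta> T i \<omega> (s (nm x))) = c ((\<theta> ^^ i) \<omega>, rds_iter \<theta> T i \<omega> x)"
        using i by (simp add: nm_def skew_funpow)
    qed (simp add: \<omega>)
    then have "x \<in> fk_ball \<theta> T \<omega> n (s (nm x)) \<epsilon>"
      by (intro bowen_ball_subset_fk_ball[OF n e])
    then show "x \<in> (\<Union>y\<in>F. fk_ball \<theta> T \<omega> n y \<epsilon>)" using x by (auto simp: F_def)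
  qed
  then have "measure (\<kappa> \<omega>) G \<le> measure (\<kappa> \<omega>) (\<Union>y\<in>F. fk_ball \<theta> T \<omega> n y \<epsilon>)"
    by (intro K.finite_measure_mono fk_balls_in_sets[OF reg n])
  then have "sp_fk \<theta> T \<kappa> \<omega> n \<epsilon> \<le> card F" using G finF by (intro sp_fk_le) auto
  also have "\<dots> \<le> card (nm ` G)" unfolding F_def by (rule card_image_le[OF finN])
  finally show ?thesis by (simp add: nm_def)
qed

text \<open>The block length k is fixed before n. It is large enough for ln 2 / k, the price of
  mixing with the uniform distribution, to be harmless; afterwards the factor k * card Z ^ (2 * k)
  does not depend on n.\<close>

lemma limsup_sp_rate_le:
  assumes erg: "ergodic_map \<mu> \<Theta>" and e: "0 < e" "e < \<epsilon>" and \<epsilon>1: "\<epsilon> < 1" and \<eta>: "\<eta> > 0"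
    and close: "\<And>\<omega> x x'. \<omega> \<in> space P \<Longrightarrow> c (\<omega>, x) = c (\<omega>, x') \<Longrightarrow> dist x x' < e"
  shows "AE \<omega> in P. limsup (sp_rate \<omega> \<epsilon>) \<le> ereal (entropy_rate + \<eta>)"
proof -
  have "(\<lambda>k. ln 2 / real k + 1 / real k * (\<integral>\<omega>. name_entropy k \<omega> \<partial>P)) \<longlonglongrightarrow> 0 + entropy_rate"
    by (intro tendsto_add mean_name_entropy_tendsto lim_const_over_n)
  then have "\<forall>\<^sub>F k in sequentially. ln 2 / real k + 1 / real k * (\<integral>\<omega>. name_entropy k \<omega> \<partial>P) < entropy_rate + \<eta> / 2"
    using \<eta> by (intro order_tendstoD(2)) auto
  then have "\<forall>\<^sub>F k in sequentially. ln 2 / real k + 1 / real k * (\<integral>\<omega>. name_entropy k \<omega> \<partial>P) < entropy_rate + \<eta> / 2 \<and> k > 0"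
    using eventually_gt_at_top[of 0] by (rule eventually_conj)
  then obtain k where k: "k > 0"
    and k_rate: "ln 2 / real k + 1 / real k * (\<integral>\<omega>. name_entropy k \<omega> \<partial>P) < entropy_rate + \<eta> / 2"
    using eventually_happens[of _ sequentially] by auto
  \<comment> \<open>A code length belongs to k letters, hence the factor k; averaging over the k
    phases in \<open>card_cheap_names\<close> removes it again.\<close>
  define b where "b = k * (entropy_rate + \<eta> / 2)"
  have "ln 2 + (\<integral>\<omega>. name_entropy k \<omega> \<partial>P) < b"
    using k_rate k by (simp add: b_def divide_simps mult.commute)
  then have b: "(\<integral>p. code_length k p \<partial>\<mu>) < b" using mean_code_length_le[of k] by linarith
  have Jm: "code_length k \<in> borel_measurable \<mu>"
    using code_length_measurable measurable_cong_sets[OF sets_\<mu> refl] by simp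
  have "AE p in \<mu>. \<forall>\<^sub>F n in sequentially. birkhoff_sum \<Theta> (code_length k) n p \<le> b * real n"
    using code_length_bound[of _ k]
    by (intro birkhoff_upper[OF prob_space_\<mu> erg Jm _ b]) (simp add: space_\<mu> space_pair_measure)
  then have "AE \<omega> in P. AE x in \<kappa> \<omega>. \<forall>\<^sub>F n in sequentially. birkhoff_sum \<Theta> (code_length k) n (\<omega>, x) \<le> b * real n"
    by (rule AE_fibres)
  then show ?thesis using AE_regular
  proof eventually_elim
    case (elim \<omega>)
    note ae = elim(1) and reg = elim(2)
    have \<omega>: "\<omega> \<in> space P" using reg by (simp add: regular_def)
    interpret K: prob_space "\<kappa> \<omega>" by (rule kernel_prob[OF \<omega>])
    define G where "G n = {x. birkhoff_sum \<Theta> (code_length k) n (\<omega>, x) \<le> b * real n}" for n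
    have Gm: "G n \<in> sets (\<kappa> \<omega>)" for n
    proof -
      have "birkhoff_sum \<Theta> (code_length k) n \<in> borel_measurable PX"
        using birkhoff_sum_measurable[OF skew_preserving Jm] measurable_cong_sets[OF sets_\<mu> refl] by simp
      then have "{p \<in> space PX. birkhoff_sum \<Theta> (code_length k) n p \<le> b * real n} \<in> sets PX" by measurable
      then show ?thesis unfolding G_def by (rule fibre_set_in_sets[OF \<omega>])
    qed
    \<comment> \<open>Almost every x of the fibre lies in \<open>G n\<close> for all large n, so the
      fibre measure of \<open>G n\<close> tends to 1 and exceeds 1 - \<epsilon> from some n
      on.\<close>
    have "(\<lambda>n. \<integral>x. indicator (G n) x \<partial>\<kappa> \<omega>) \<longlonglongrightarrow> (\<integral>x. (1::real) \<partial>\<kappa> \<omega>)"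
    proof (rule integral_dominated_convergence[where w = "\<lambda>_. 1"])
      show "AE x in \<kappa> \<omega>. (\<lambda>n. indicator (G n) x :: real) \<longlonglongrightarrow> 1"
        using ae
      proof eventually_elim
        case (elim x)
        then have "\<forall>\<^sub>F n in sequentially. (indicator (G n) x :: real) = 1"
          by eventually_elim (simp add: G_def)
        then show ?case by (rule tendsto_eventually)
      qed
    qed (use Gm in \<open>auto simp: indicator_def\<close>)
    then have "(\<lambda>n. measure (\<kappa> \<omega>) (G n)) \<longlonglongrightarrow> 1"
      using Gm K.prob_space by (simp add: kernel_space[OF \<omega>])
    then have big: "\<forall>\<^sub>F n in sequentially. measure (\<kappa> \<omega>) (G n) > 1 - \<epsilon>"
      using e by (intro order_tendstoD(1)) auto
    define C where "C = ln k + 2 * k * ln (card Z)"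
    have "(\<lambda>n. C / real n) \<longlonglongrightarrow> 0" by (rule lim_const_over_n)
    then have small: "\<forall>\<^sub>F n in sequentially. C / real n < \<eta> / 2"
      using \<eta> by (intro order_tendstoD(2)) auto
    have "\<forall>\<^sub>F n in sequentially. sp_rate \<omega> \<epsilon> n \<le> ereal (entropy_rate + \<eta>)"
      using big small eventually_ge_at_top[of k]
    proof eventually_elim
      case (elim n)
      have n: "n > 0" using elim(3) k by simp
      define t where "t = (entropy_rate + \<eta> / 2) * n"
      have "sp_fk \<theta> T \<kappa> \<omega> n \<epsilon> \<le> card ((\<lambda>x. name n (\<omega>, x)) ` G n)"
        using elim(1) by (intro sp_fk_le_card_names[OF reg n e close])
      then have "real (sp_fk \<theta> T \<kappa> \<omega> n \<epsilon>) \<le> real (card ((\<lambda>x. name n (\<omega>, x)) ` G n))" by simp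
      also have "\<dots> \<le> k * real (card Z) ^ (2 * k) * exp t"
      proof (rule card_cheap_names[OF \<omega> k elim(3)])
        fix x assume "x \<in> G n"
        then show "birkhoff_sum \<Theta> (code_length k) n (\<omega>, x) \<le> t * k"
          by (simp add: G_def t_def b_def mult_ac)
      qed
      finally have le: "real (sp_fk \<theta> T \<kappa> \<omega> n \<epsilon>) \<le> k * real (card Z) ^ (2 * k) * exp t" .
      have "sp_fk \<theta> T \<kappa> \<omega> n \<epsilon> > 0" using e \<epsilon>1 by (intro sp_fk_pos[OF reg n]) auto
      then have "ln (real (sp_fk \<theta> T \<kappa> \<omega> n \<epsilon>)) \<le> ln (k * real (card Z) ^ (2 * k) * exp t)"
        using le k card_Z_pos by (subst ln_le_cancel_iff) auto
      also have "\<dots> = C + t"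
        using k card_Z_pos Z_nonempty by (simp add: C_def ln_mult ln_realpow)
      finally have "1 / real n * ln (real (sp_fk \<theta> T \<kappa> \<omega> n \<epsilon>)) \<le> 1 / real n * (C + t)"
        by (intro mult_left_mono) auto
      also have "\<dots> = C / real n + (entropy_rate + \<eta> / 2)"
        using n by (simp add: t_def add_divide_distrib)
      also have "\<dots> \<le> entropy_rate + \<eta>" using elim(2) by linarith
      finally show ?case by (simp add: sp_rate_def)
    qed
    then show ?case by (rule Limsup_bounded)
  qed
qed

end

section \<open>The limit of small radii\<close>

text \<open>A monotone function converges to its supremum. Monotonicity is asked for below 1 only,
  where \<open>sp_fk\<close> is positive, and limits at 0 do not see larger radii.\<close>

lemma antimono_tendsto_SUP_at_right_0:
  fixes \<phi> :: "real \<Rightarrow> ereal"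
  assumes mono: "\<And>\<epsilon> \<epsilon>'. 0 < \<epsilon> \<Longrightarrow> \<epsilon> \<le> \<epsilon>' \<Longrightarrow> \<epsilon>' < 1 \<Longrightarrow> \<phi> \<epsilon>' \<le> \<phi> \<epsilon>"
  shows "(\<phi> \<longlongrightarrow> (SUP \<epsilon>\<in>{0<..<1}. \<phi> \<epsilon>)) (at_right 0)"
proof (rule order_tendstoI)
  fix a assume "a < (SUP \<epsilon>\<in>{0<..<1}. \<phi> \<epsilon>)"
  then obtain \<epsilon>0 where \<epsilon>0: "\<epsilon>0 \<in> {0<..<1}" "a < \<phi> \<epsilon>0" by (auto simp: less_SUP_iff)
  have "a < \<phi> \<epsilon>" if "0 < \<epsilon>" "\<epsilon> < \<epsilon>0" for \<epsilon>
    using mono[of \<epsilon> \<epsilon>0] that \<epsilon>0 by (auto intro: less_le_trans)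
  then show "\<forall>\<^sub>F \<epsilon> in at_right 0. a < \<phi> \<epsilon>"
    unfolding eventually_at_right_field using \<epsilon>0 by (intro exI[of _ \<epsilon>0]) auto
next
  fix a assume a: "(SUP \<epsilon>\<in>{0<..<1}. \<phi> \<epsilon>) < a"
  have "\<phi> \<epsilon> < a" if "0 < \<epsilon>" "\<epsilon> < 1" for \<epsilon>
    using SUP_upper[of \<epsilon> "{0<..<1}" \<phi>] that a by (auto intro: le_less_trans)
  then show "\<forall>\<^sub>F \<epsilon> in at_right 0. \<phi> \<epsilon> < a"
    unfolding eventually_at_right_field by (intro exI[of _ 1]) auto
qed

lemma inverse_Suc_tendsto: "(\<lambda>m. 1 / real (Suc m)) \<longlonglongrightarrow> 0"
  using LIMSEQ_inverse_real_of_nat by (simp add: inverse_eq_divide)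

context invariant_disintegration
begin

lemma liminf_sp_rate_antimono:
  assumes "regular \<omega>" "0 < \<epsilon>" "\<epsilon> \<le> \<epsilon>'" "\<epsilon>' < 1"
  shows "liminf (sp_rate \<omega> \<epsilon>') \<le> liminf (sp_rate \<omega> \<epsilon>)"
proof (rule Liminf_mono)
  show "\<forall>\<^sub>F n in sequentially. sp_rate \<omega> \<epsilon>' n \<le> sp_rate \<omega> \<epsilon> n"
    using eventually_gt_at_top[of 0] by eventually_elim (rule sp_rate_antimono[OF assms(1) _ assms(2-4)])
qed

lemma limsup_sp_rate_antimono:
  assumes "regular \<omega>" "0 < \<epsilon>" "\<epsilon> \<le> \<epsilon>'" "\<epsilon>' < 1"
  shows "limsup (sp_rate \<omega> \<epsilon>') \<le> limsup (sp_rate \<omega> \<epsilon>)"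
proof (rule Limsup_mono)
  show "\<forall>\<^sub>F n in sequentially. sp_rate \<omega> \<epsilon>' n \<le> sp_rate \<omega> \<epsilon> n"
    using eventually_gt_at_top[of 0] by eventually_elim (rule sp_rate_antimono[OF assms(1) _ assms(2-4)])
qed

text \<open>Finitely many balls of radius e / 2 cover the fibre; assigning each point to the first
  ball that contains it makes them disjoint. The base is left undivided.\<close>

lemma finite_partition_small_fibres:
  assumes "e > 0"
  obtains \<zeta> where "finite_measurable_partition PX \<zeta>"
    "\<And>\<omega> x x'. \<omega> \<in> space P \<Longrightarrow> atom \<zeta> (\<omega>, x) = atom \<zeta> (\<omega>, x') \<Longrightarrow> dist x x' < e"
proof -
  have cover: "UNIV \<subseteq> (\<Union>y\<in>UNIV. ball y (e / 2) :: 'x set)" using assms by auto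
  obtain C where C: "finite C" "UNIV \<subseteq> (\<Union>y\<in>C. ball y (e / 2) :: 'x set)"
    by (rule compactE_image[OF fibre_compact open_ball cover])
  obtain ys where ys: "set ys = C" using finite_list[OF C(1)] by blast
  define Q where "Q i x \<longleftrightarrow> i < length ys \<and> dist (ys ! i) x < e / 2" for i x
  have exQ: "\<exists>i. Q i x" for x
  proof -
    have "x \<in> (\<Union>y\<in>set ys. ball y (e / 2))" using C(2) unfolding ys by blast
    then obtain y where "y \<in> set ys" "dist y x < e / 2" by auto
    then show ?thesis by (metis Q_def in_set_conv_nth)
  qed
  define idx where "idx x = (LEAST i. Q i x)" for x
  have idx: "Q (idx x) x" for x unfolding idx_def using exQ by (rule LeastI_ex)
  define B where "B i = {x. idx x = i}" for i
  have B_borel: "B i \<in> sets borel" for i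
  proof (cases "i < length ys")
    case True
    have "idx x = i \<longleftrightarrow> Q i x \<and> (\<forall>j<i. \<not> Q j x)" for x
      unfolding idx_def using exQ[of x] Least_le[of "\<lambda>i. Q i x"] LeastI_ex[of "\<lambda>i. Q i x"] not_less_Least[of _ "\<lambda>i. Q i x"]
      by (metis le_antisym not_less)
    then have "B i = ball (ys ! i) (e / 2) - (\<Union>j<i. ball (ys ! j) (e / 2))"
      using True unfolding B_def Q_def by auto
    then show ?thesis by simp
  next
    case False
    then have "B i = {}" using idx by (auto simp: B_def Q_def)
    then show ?thesis by simp
  qed
  define \<zeta> where "\<zeta> = (\<lambda>i. space P \<times> B i) ` {..<length ys} - {{}}"
  have part: "partition_on (space PX) \<zeta>"
  proof (rule partition_onI)
    have "(\<omega>, x) \<in> \<Union>\<zeta>" if "\<omega> \<in> space P" for \<omega> x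
      using that idx[of x] unfolding \<zeta>_def Q_def B_def by blast
    then show "\<Union>\<zeta> = space PX" by (fastforce simp: \<zeta>_def space_pair_measure)
    show "disjnt p q" if "p \<in> \<zeta>" "q \<in> \<zeta>" "p \<noteq> q" for p q
      using that by (auto simp: \<zeta>_def B_def disjnt_def)
  qed (simp add: \<zeta>_def)
  have fmp: "finite_measurable_partition PX \<zeta>"
    unfolding finite_measurable_partition_def
    using part B_borel by (auto simp: \<zeta>_def intro!: pair_measureI)
  have "dist x x' < e" if \<omega>: "\<omega> \<in> space P" and eq: "atom \<zeta> (\<omega>, x) = atom \<zeta> (\<omega>, x')" for \<omega> x x'
  proof -
    have "atom \<zeta> (\<omega>, x) = space P \<times> B (idx x)"
    proof (rule atom_eqI[OF part])
      show "(\<omega>, x) \<in> space P \<times> B (idx x)" using \<omega> by (simp add: B_def)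
      then show "space P \<times> B (idx x) \<in> \<zeta>" using idx[of x] unfolding \<zeta>_def Q_def by blast
    qed
    moreover have "(\<omega>, x') \<in> atom \<zeta> (\<omega>, x')"
      using \<omega> by (intro atom_in(2)[OF part]) (simp add: space_pair_measure)
    ultimately have "idx x' = idx x" using eq by (auto simp: B_def)
    then have "dist (ys ! idx x) x < e / 2" "dist (ys ! idx x) x' < e / 2"
      using idx[of x] idx[of x'] by (simp_all add: Q_def)
    then show ?thesis using dist_triangle3[of x x' "ys ! idx x"] by linarith
  qed
  then show ?thesis using that fmp by blast
qed

text \<open>Each loss 1 / (m + 1) comes with its own radius and its own null set. The supremum over
  radii absorbs the former, countability the latter.\<close>

lemma AE_fibre_entropy_partition_le:
  assumes \<zeta>: "finite_measurable_partition PX \<zeta>"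
  shows "AE \<omega> in P. ereal (fibre_entropy_partition P \<theta> T \<kappa> \<zeta>)
    \<le> (SUP \<epsilon>\<in>{0<..<1}. liminf (sp_rate \<omega> \<epsilon>))"
proof -
  interpret C: coded_disintegration P \<theta> T \<mu> \<kappa> "atom \<zeta>" \<zeta>
    by (rule coded_disintegration_atom[OF \<zeta>])
  let ?h = "fibre_entropy_partition P \<theta> T \<kappa> \<zeta>"
  have h: "?h = C.entropy_rate" by (rule fibre_entropy_partition_eq_rate[OF \<zeta>])
  have "AE \<omega> in P. ereal (?h - 1 / real (Suc m)) \<le> (SUP \<epsilon>\<in>{0<..<1}. liminf (sp_rate \<omega> \<epsilon>))" for m
  proof -
    have "1 / real (Suc m) > 0" by simp
    then obtain \<epsilon> where \<epsilon>: "0 < \<epsilon>" "\<epsilon> < 1"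
      "AE \<omega> in P. ereal (C.entropy_rate - 1 / real (Suc m)) \<le> liminf (sp_rate \<omega> \<epsilon>)"
      using C.liminf_sp_rate_ge by metis
    from \<epsilon>(3) show ?thesis
    proof eventually_elim
      case (elim \<omega>)
      also have "liminf (sp_rate \<omega> \<epsilon>) \<le> (SUP \<epsilon>\<in>{0<..<1}. liminf (sp_rate \<omega> \<epsilon>))"
        using \<epsilon> by (intro SUP_upper) simp
      finally show ?case by (simp add: h)
    qed
  qed
  then have "AE \<omega> in P. \<forall>m. ereal (?h - 1 / real (Suc m)) \<le> (SUP \<epsilon>\<in>{0<..<1}. liminf (sp_rate \<omega> \<epsilon>))"
    by (simp add: AE_all_countable)
  then show ?thesis
  proof eventually_elim
    case (elim \<omega>)
    have "(\<lambda>m. ereal (?h - 1 / real (Suc m))) \<longlonglongrightarrow> ereal (?h - 0)"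
      by (intro tendsto_ereal tendsto_diff tendsto_const inverse_Suc_tendsto)
    then have "ereal (?h - 0) \<le> (SUP \<epsilon>\<in>{0<..<1}. liminf (sp_rate \<omega> \<epsilon>))"
      by (rule LIMSEQ_le_const2) (use elim in blast)
    then show ?case by simp
  qed
qed

lemma AE_fibre_entropy_le:
  "AE \<omega> in P. fibre_entropy P \<theta> T \<kappa> \<le> (SUP \<epsilon>\<in>{0<..<1}. liminf (sp_rate \<omega> \<epsilon>))"
proof -
  let ?A = "(\<lambda>\<zeta>. ereal (fibre_entropy_partition P \<theta> T \<kappa> \<zeta>)) ` {\<zeta>. finite_measurable_partition PX \<zeta>}"
  obtain \<zeta>0 where "finite_measurable_partition PX \<zeta>0"
    using finite_partition_small_fibres[of 1] zero_less_one by metis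
  then have "?A \<noteq> {}" by blast
  \<comment> \<open>The supremum runs over uncountably many partitions, but a sequence of its values
    already has the same supremum; one null set for each of them suffices.\<close>
  then obtain f :: "nat \<Rightarrow> ereal" where f: "range f \<subseteq> ?A" "Sup ?A = (SUP i. f i)"
    using Sup_countable_SUP by metis
  have "AE \<omega> in P. f i \<le> (SUP \<epsilon>\<in>{0<..<1}. liminf (sp_rate \<omega> \<epsilon>))" for i
  proof -
    have "f i \<in> ?A" using f(1) by blast
    then obtain \<zeta> where "f i = ereal (fibre_entropy_partition P \<theta> T \<kappa> \<zeta>)" "finite_measurable_partition PX \<zeta>"
      by blast
    then show ?thesis using AE_fibre_entropy_partition_le[of \<zeta>] by simp
  qed
  then have "AE \<omega> in P. \<forall>i. f i \<le> (SUP \<epsilon>\<in>{0<..<1}. liminf (sp_rate \<omega> \<epsilon>))"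
    by (simp add: AE_all_countable)
  then show ?thesis
    unfolding fibre_entropy_def f(2) by eventually_elim (rule SUP_least, blast)
qed

lemma AE_limsup_le_fibre_entropy:
  assumes erg: "ergodic_map \<mu> \<Theta>"
  shows "AE \<omega> in P. (SUP \<epsilon>\<in>{0<..<1}. limsup (sp_rate \<omega> \<epsilon>)) \<le> fibre_entropy P \<theta> T \<kappa>"
proof -
  \<comment> \<open>Radii 1 / (m + 2) are countably many, all below 1, and tend to 0; monotonicity
    transfers the bound to every other radius.\<close>
  have "AE \<omega> in P. limsup (sp_rate \<omega> (1 / real (Suc (Suc m)))) \<le> fibre_entropy P \<theta> T \<kappa>" for m
  proof -
    define \<epsilon> where "\<epsilon> = 1 / real (Suc (Suc m))"
    have "0 < \<epsilon>" "\<epsilon> < 1" by (simp_all add: \<epsilon>_def)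
    then have \<epsilon>: "0 < \<epsilon> / 2" "\<epsilon> / 2 < \<epsilon>" "\<epsilon> < 1" by simp_all
    obtain \<zeta> where \<zeta>: "finite_measurable_partition PX \<zeta>"
      and close: "\<And>\<omega> x x'. \<omega> \<in> space P \<Longrightarrow> atom \<zeta> (\<omega>, x) = atom \<zeta> (\<omega>, x') \<Longrightarrow> dist x x' < \<epsilon> / 2"
      using finite_partition_small_fibres[OF \<epsilon>(1)] by metis
    interpret C: coded_disintegration P \<theta> T \<mu> \<kappa> "atom \<zeta>" \<zeta>
      by (rule coded_disintegration_atom[OF \<zeta>])
    let ?h = "fibre_entropy_partition P \<theta> T \<kappa> \<zeta>"
    have h: "?h = C.entropy_rate" by (rule fibre_entropy_partition_eq_rate[OF \<zeta>])
    have "AE \<omega> in P. limsup (sp_rate \<omega> \<epsilon>) \<le> ereal (?h + 1 / real (Suc l))" for l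
      unfolding h by (rule C.limsup_sp_rate_le[OF erg \<epsilon> _ close]) simp_all
    then have "AE \<omega> in P. \<forall>l. limsup (sp_rate \<omega> \<epsilon>) \<le> ereal (?h + 1 / real (Suc l))"
      by (simp add: AE_all_countable)
    then have "AE \<omega> in P. limsup (sp_rate \<omega> \<epsilon>) \<le> fibre_entropy P \<theta> T \<kappa>"
    proof eventually_elim
      case (elim \<omega>)
      have "(\<lambda>l. ereal (?h + 1 / real (Suc l))) \<longlonglongrightarrow> ereal (?h + 0)"
        by (intro tendsto_ereal tendsto_add tendsto_const inverse_Suc_tendsto)
      then have "limsup (sp_rate \<omega> \<epsilon>) \<le> ereal (?h + 0)"
        by (rule LIMSEQ_le_const) (use elim in blast)
      also have "\<dots> \<le> fibre_entropy P \<theta> T \<kappa>"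
        unfolding fibre_entropy_def using \<zeta> by (auto intro: SUP_upper2)
      finally show ?case .
    qed
    then show ?thesis by (simp add: \<epsilon>_def)
  qed
  then have "AE \<omega> in P. \<forall>m. limsup (sp_rate \<omega> (1 / real (Suc (Suc m)))) \<le> fibre_entropy P \<theta> T \<kappa>"
    by (simp only: AE_all_countable) blast
  then show ?thesis using AE_regular
  proof eventually_elim
    case (elim \<omega>)
    show ?case
    proof (rule SUP_least)
      fix \<epsilon> :: real assume "\<epsilon> \<in> {0<..<1}"
      then have \<epsilon>: "0 < \<epsilon>" "\<epsilon> < 1" by simp_all
      obtain m where "1 / real (Suc m) < \<epsilon>" using nat_approx_posE[OF \<epsilon>(1)] by metis
      moreover have "1 / real (Suc (Suc m)) \<le> 1 / real (Suc m)" by (simp add: divide_simps)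
      ultimately have "1 / real (Suc (Suc m)) \<le> \<epsilon>" by linarith
      then have "limsup (sp_rate \<omega> \<epsilon>) \<le> limsup (sp_rate \<omega> (1 / real (Suc (Suc m))))"
        using \<epsilon> by (intro limsup_sp_rate_antimono elim(2)) simp_all
      also have "\<dots> \<le> fibre_entropy P \<theta> T \<kappa>" using elim(1) by blast
      finally show "limsup (sp_rate \<omega> \<epsilon>) \<le> fibre_entropy P \<theta> T \<kappa>" .
    qed
  qed
qed

lemma liminf_sp_rate_tendsto:
  assumes "regular \<omega>"
  shows "((\<lambda>\<epsilon>. liminf (sp_rate \<omega> \<epsilon>)) \<longlongrightarrow> (SUP \<epsilon>\<in>{0<..<1}. liminf (sp_rate \<omega> \<epsilon>))) (at_right 0)"
  by (rule antimono_tendsto_SUP_at_right_0) (rule liminf_sp_rate_antimono[OF assms])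

lemma limsup_sp_rate_tendsto:
  assumes "regular \<omega>"
  shows "((\<lambda>\<epsilon>. limsup (sp_rate \<omega> \<epsilon>)) \<longlongrightarrow> (SUP \<epsilon>\<in>{0<..<1}. limsup (sp_rate \<omega> \<epsilon>))) (at_right 0)"
  by (rule antimono_tendsto_SUP_at_right_0) (rule limsup_sp_rate_antimono[OF assms])

text \<open>The chain entropy \<le> lower limit \<le> upper limit \<le> entropy closes up, the
  middle step being liminf \<le> limsup at each radius.\<close>

lemma AE_ergodic_limits:
  assumes "ergodic_map \<mu> \<Theta>"
  shows "AE \<omega> in P.
    ((\<lambda>\<epsilon>. liminf (sp_rate \<omega> \<epsilon>)) \<longlongrightarrow> fibre_entropy P \<theta> T \<kappa>) (at_right 0) \<and>
    ((\<lambda>\<epsilon>. limsup (sp_rate \<omega> \<epsilon>)) \<longlongrightarrow> fibre_entropy P \<theta> T \<kappa>) (at_right 0)"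
  using AE_limsup_le_fibre_entropy[OF assms] AE_fibre_entropy_le AE_regular
proof eventually_elim
  case (elim \<omega>)
  let ?L = "SUP \<epsilon>\<in>{0<..<1}. liminf (sp_rate \<omega> \<epsilon>)"
  let ?U = "SUP \<epsilon>\<in>{0<..<1}. limsup (sp_rate \<omega> \<epsilon>)"
  have "?L \<le> ?U" by (intro SUP_subset_mono subset_refl Liminf_le_Limsup) simp
  then have "?L = fibre_entropy P \<theta> T \<kappa>" "?U = fibre_entropy P \<theta> T \<kappa>"
    using elim(1,2) by (auto intro: antisym order_trans)
  then show ?case
    using liminf_sp_rate_tendsto[OF elim(3)] limsup_sp_rate_tendsto[OF elim(3)] by simp
qed

end

theorem theorem1p3:
  fixes P :: "'w measure" and \<theta> :: "'w \<Rightarrow> 'w"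
    and T :: "'w \<Rightarrow> 'x::metric_space \<Rightarrow> 'x"
    and \<mu> :: "('w \<times> 'x) measure" and \<kappa> :: "'w \<Rightarrow> 'x measure"
  assumes "continuous_bundle_rds P \<theta> T"
    and "\<mu> \<in> invariant_measures P \<theta> T"
    and "disintegration P \<mu> \<kappa>"
  shows "(AE \<omega> in P. \<exists>L.
            ((\<lambda>\<epsilon>. liminf (\<lambda>n. ereal (1 / real n * ln (real (sp_fk \<theta> T \<kappa> \<omega> n \<epsilon>))))) \<longlongrightarrow> L) (at_right 0)
            \<and> fibre_entropy P \<theta> T \<kappa> \<le> L)
       \<and> (\<mu> \<in> ergodic_measures P \<theta> T \<and> fibre_entropy P \<theta> T \<kappa> < \<infinity> \<longrightarrow>
          (AE \<omega> in P.
            ((\<lambda>\<epsilon>. liminf (\<lambda>n. ereal (1 / real n * ln (real (sp_fk \<theta> T \<kappa> \<omega> n \<epsilon>)))))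
               \<longlongrightarrow> fibre_entropy P \<theta> T \<kappa>) (at_right 0)
            \<and> ((\<lambda>\<epsilon>. limsup (\<lambda>n. ereal (1 / real n * ln (real (sp_fk \<theta> T \<kappa> \<omega> n \<epsilon>)))))
               \<longlongrightarrow> fibre_entropy P \<theta> T \<kappa>) (at_right 0)))"
proof -
  interpret invariant_disintegration P \<theta> T \<mu> \<kappa>
    using assms by (simp add: invariant_disintegration_def invariant_disintegration_axioms_def)
  have "AE \<omega> in P. \<exists>L. ((\<lambda>\<epsilon>. liminf (sp_rate \<omega> \<epsilon>)) \<longlongrightarrow> L) (at_right 0) \<and> fibre_entropy P \<theta> T \<kappa> \<le> L"
    using AE_fibre_entropy_le AE_regular
  proof eventually_elim
    case (elim \<omega>)
    then show ?case using liminf_sp_rate_tendsto[OF elim(2)] by blast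
  qed
  moreover have "AE \<omega> in P.
    ((\<lambda>\<epsilon>. liminf (sp_rate \<omega> \<epsilon>)) \<longlongrightarrow> fibre_entropy P \<theta> T \<kappa>) (at_right 0) \<and>
    ((\<lambda>\<epsilon>. limsup (sp_rate \<omega> \<epsilon>)) \<longlongrightarrow> fibre_entropy P \<theta> T \<kappa>) (at_right 0)"
    if "\<mu> \<in> ergodic_measures P \<theta> T"
    using that by (intro AE_ergodic_limits) (simp add: ergodic_measures_def)
  ultimately show ?thesis unfolding sp_rate_def[abs_def] by blast
qed

end
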